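(* Let $G$ (finite dimensional) and $H$ be Lie groups, let $\pi\colon P\to X$ be a smooth principal $H$-bundle with connection $\Theta\in\Omega^1_P(\mathfrak h)$ and curvature $\Omega=d\Theta+\frac12[\Theta\wedge\Theta]$, and suppose $G$ acts on $P\to X$ by principal $H$-bundle automorphisms (covering a $G$-action on $X$) preserving $\Theta$. Then the curvature $\Omega_G$ of the induced connection on the principal $H$-bundle $\pi_G\colon (P_G)_\nabla\to (X_G)_\nabla$ of differential Borel quotients is, in the Cartan model, $$\Omega_G=\Omega-\chi^a\cdot\iota_a\Theta .$$
   Context: Sum over repeated indices. $\{e_a\}$ is a basis of $\mathfrak g$ with $[e_a,e_b]=f_{ab}^ce_c$. $G$ acts on $P$ on the left; $e_a$ induces the vector field $\xi_a(p)=\frac{d}{dt}|_{t=0}\exp(-te_a)p$ (so $[\xi_a,\xi_b]=f^c_{ab}\xi_c$), and $\iota_a$ is contraction with it; the same convention is used on any $G$-manifold. Sheaves. A generalized manifold is a (simplicial, here groupoid-valued) sheaf on the category $\mathbf{Man}$ of smooth manifolds. $B_\nabla G$ assigns to a test manifold $M$ the groupoid of principal $G$-bundles $Q\to M$ with connection $\phi$ (morphisms: connection-preserving isomorphisms). $E_\nabla G$ assigns to $M$ the groupoid of principal $G$-bundles over $M$ with connection and section; $E_\nabla G\to B_\nabla G$ is the universal $G$-bundle. For a $G$-manifold $Y$ the differential Borel quotient is $(Y_G)_\nabla=E_\nabla G\times_GY\to B_\nabla G$, a fiber bundle with fiber $Y$: a map $M\to (Y_G)_\nabla$ is a principal $G$-bundle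 $Q\to M$ with connection $\phi$ together with a section of $Q\times_GY\to M$, equivalently a $G$-equivariant map $f\colon Q\to Y$. The pullback of $(P_G)_\nabla\to(X_G)_\nabla\to B_\nabla G$ along the map $M\to B_\nabla G$ given by $(Q,\phi)$ is $Q\times_GP\to Q\times_GX\to M$. Induced connection. Given $(Q\to M,\phi)$, with $V=\ker\phi\subset TQ$ and $W=\ker\Theta\subset TP$, the $G$-invariant distribution $V\oplus W\subset T(Q\times P)$ descends to a connection $\Theta_Q$ on the principal $H$-bundle $Q\times_GP\to Q\times_GX$. This is functorial for maps of $G$-bundles with connection, and so defines a connection on $\pi_G\colon(P_G)_\nabla\to(X_G)_\nabla$; its curvature $\Omega_G$ is the $\mathfrak h$-valued 2-form on $(P_G)_\nabla$ whose pullback to each $Q\times_GP$ is the curvature of $\Theta_Q$. Forms; Weil and Cartan models. A differential form on a sheaf $\mathcal F$ is a natural assignment to each map $M\to\mathcal F$ of a differential form on $M$. The de Rham complex of $E_\nabla G$ is the Weil algebra $\mathrm{Sym}^\bullet\mathfrak g^*\otimes\bigwedge^\bullet\mathfrak g^*$, the free differential graded algebra on $\mathfrak g^*=\bigwedge^1\mathfrak g^*$; $\{\theta^a\}\subset\bigwedge^1\mathfrak g^*$ is the dual basis, $\chi^a=d\theta^a\in \mathrm{Sym}^1\mathfrak g^*$ (degree 2), and $\nu^a=d\theta^a+\frac12f^a_{bc}\theta^b\theta^c$; contraction is $\iota_a\theta^b=\delta_a^b$, $\iota_a\nu^b=0$. For a $G$-manifold $Y$, the de Rham complex of $(Y_G)_\nabla$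 is identified with the Weil model: the basic subcomplex ($G$-invariant elements annihilated by all $\iota_a$) of $\mathrm{Sym}^\bullet\mathfrak g^*\otimes\bigwedge^\bullet\mathfrak g^*\otimes\Omega^\bullet_Y$. Explicitly, the value on $(Q,\phi,f)$ of the form corresponding to a basic element is obtained by substituting $\theta^a\mapsto\phi^a$, $\nu^a\mapsto\omega^a$ (components of the connection form $\phi=\phi^ae_a$ and of its curvature $\omega=\omega^ae_a$), pulling forms on $Y$ back by $f$, and descending the resulting basic form from $Q$ to $M$. The Cartan model is the $G$-invariant subcomplex of $\mathrm{Sym}^\bullet\mathfrak g^*\otimes\Omega^\bullet_Y$ with differential $d_Y-\chi^a\iota_a$; the map from the Weil model to the Cartan model sends $\theta^a\mapsto0$, $\nu^a\mapsto\chi^a$ and is the identity on $\Omega_Y^\bullet$. The same applies with coefficients in $\mathfrak h$. The theorem's formula is for the image in the Cartan model (with $Y=P$, $\mathfrak h$-valued forms) of $\Omega_G$. *)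

theory Defs
  imports "HOL-Analysis.Analysis" "HOL-Algebra.Group"
begin

section \<open>Smooth maps and manifolds\<close>

text \<open>
  \<open>Ck k S f\<close> is used for open \<open>S\<close> only. It asks for iterated Frechet derivatives in fixed
  directions; for all \<open>k\<close> together this is the usual notion of a smooth map, on finite-dimensional
  spaces and, by uniform boundedness, on Banach spaces.
\<close>

primrec Ck :: "nat \<Rightarrow> 'a::real_normed_vector set \<Rightarrow> ('a \<Rightarrow> 'b::real_normed_vector) \<Rightarrow> bool" where
  "Ck 0 S f \<longleftrightarrow> continuous_on S f"
| "Ck (Suc k) S f \<longleftrightarrow>
     (\<exists>f'. (\<forall>x\<in>S. (f has_derivative f' x) (at x)) \<and> (\<forall>v. Ck k S (\<lambda>x. f' x v)))"

definition smooth_on :: "'a::real_normed_vector set \<Rightarrow> ('a \<Rightarrow> 'b::real_normed_vector) \<Rightarrow> bool" where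
  "smooth_on S f \<longleftrightarrow> (\<forall>k. Ck k S f)"

text \<open>
  A manifold is a whole type with an atlas indexed by its points: \<open>M p\<close> is a chart (domain and
  coordinate map) around \<open>p\<close>. The chart \<open>M p\<close> identifies the tangent space at \<open>p\<close> with the model
  space, so tangent vectors at any point are elements of the model space. The model space is not
  required to be of class \<open>euclidean_space\<close>, because that class excludes dimension 0.
\<close>

type_synonym ('a, 'v) atlas = "'a \<Rightarrow> 'a set \<times> ('a \<Rightarrow> 'v)"

definition cdom :: "('a, 'v) atlas \<Rightarrow> 'a \<Rightarrow> 'a set" where
  "cdom M p = fst (M p)"

definition coord :: "('a, 'v) atlas \<Rightarrow> 'a \<Rightarrow> 'a \<Rightarrow> 'v" where
  "coord M p = snd (M p)"

definition param :: "('a, 'v) atlas \<Rightarrow> 'a \<Rightarrow> 'v \<Rightarrow> 'a" where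
  "param M p = inv_into (cdom M p) (coord M p)"

definition smooth_manifold :: "('a::t2_space, 'v::banach) atlas \<Rightarrow> bool" where
  "smooth_manifold M \<longleftrightarrow>
     (\<forall>p. p \<in> cdom M p \<and> open (cdom M p) \<and> open (coord M p ` cdom M p) \<and>
        homeomorphism (cdom M p) (coord M p ` cdom M p) (coord M p) (param M p)) \<and>
     (\<forall>p q. smooth_on (coord M p ` (cdom M p \<inter> cdom M q)) (coord M q \<circ> param M p))"

definition fin_dim :: "('a, 'v::real_vector) atlas \<Rightarrow> bool" where
  "fin_dim M \<longleftrightarrow> (\<exists>D :: 'v set. finite D \<and> span D = UNIV)"

definition prod_atlas :: "('a, 'v) atlas \<Rightarrow> ('b, 'w) atlas \<Rightarrow> ('a \<times> 'b, 'v \<times> 'w) atlas"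
    (infixr "\<times>\<^sub>m" 80) where
  "M \<times>\<^sub>m N = (\<lambda>(p, q). (cdom M p \<times> cdom N q, map_prod (coord M p) (coord N q)))"

definition smooth_map_on ::
    "('a::t2_space, 'v::banach) atlas \<Rightarrow> ('b::t2_space, 'w::banach) atlas \<Rightarrow> 'a set \<Rightarrow> ('a \<Rightarrow> 'b) \<Rightarrow> bool" where
  "smooth_map_on M N S f \<longleftrightarrow> continuous_on S f \<and>
     (\<forall>a b. smooth_on (coord M a ` {p \<in> S \<inter> cdom M a. f p \<in> cdom N b})
              (coord N b \<circ> f \<circ> param M a))"

abbreviation smooth_map ::
    "('a::t2_space, 'v::banach) atlas \<Rightarrow> ('b::t2_space, 'w::banach) atlas \<Rightarrow> ('a \<Rightarrow> 'b) \<Rightarrow> bool" where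
  "smooth_map M N \<equiv> smooth_map_on M N UNIV"

definition tmap ::
    "('a, 'v::real_normed_vector) atlas \<Rightarrow> ('b, 'w::real_normed_vector) atlas \<Rightarrow>
     ('a \<Rightarrow> 'b) \<Rightarrow> 'a \<Rightarrow> 'v \<Rightarrow> 'w" where
  "tmap M N f p = frechet_derivative (coord N (f p) \<circ> f \<circ> param M p) (at (coord M p p))"

text \<open>
  \<open>to_frame M a u\<close> takes components in the chart \<open>M a\<close>, at the point \<open>p\<close> with coordinates \<open>u\<close>,
  to components in the chart \<open>M p\<close> (that is, to the tangent space at \<open>p\<close>); \<open>of_frame\<close> is the
  inverse.
\<close>

definition to_frame :: "('a, 'v::real_normed_vector) atlas \<Rightarrow> 'a \<Rightarrow> 'v \<Rightarrow> 'v \<Rightarrow> 'v" where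
  "to_frame M a u = frechet_derivative (coord M (param M a u) \<circ> param M a) (at u)"

definition of_frame :: "('a, 'v::real_normed_vector) atlas \<Rightarrow> 'a \<Rightarrow> 'v \<Rightarrow> 'v \<Rightarrow> 'v" where
  "of_frame M a u =
     frechet_derivative (coord M a \<circ> param M (param M a u))
       (at (coord M (param M a u) (param M a u)))"


section \<open>Vector fields and differential forms of degree at most 2\<close>

definition lie_bracket ::
    "('a, 'v::real_normed_vector) atlas \<Rightarrow> ('a \<Rightarrow> 'v) \<Rightarrow> ('a \<Rightarrow> 'v) \<Rightarrow> 'a \<Rightarrow> 'v" where
  "lie_bracket M X Y p =
     (let x = coord M p p;
          X' = (\<lambda>u. of_frame M p u (X (param M p u)));
          Y' = (\<lambda>u. of_frame M p u (Y (param M p u)))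
      in frechet_derivative Y' (at x) (X' x) - frechet_derivative X' (at x) (Y' x))"

type_synonym ('a, 'k) form0 = "'a \<Rightarrow> 'k"
type_synonym ('a, 'v, 'k) form1 = "'a \<Rightarrow> 'v \<Rightarrow> 'k"
type_synonym ('a, 'v, 'k) form2 = "'a \<Rightarrow> 'v \<Rightarrow> 'v \<Rightarrow> 'k"

definition local1 ::
    "('a, 'v::real_normed_vector) atlas \<Rightarrow> 'a \<Rightarrow> ('a, 'v, 'k) form1 \<Rightarrow> 'v \<Rightarrow> 'v \<Rightarrow> 'k" where
  "local1 M a \<alpha> u v = \<alpha> (param M a u) (to_frame M a u v)"

definition local2 ::
    "('a, 'v::real_normed_vector) atlas \<Rightarrow> 'a \<Rightarrow> ('a, 'v, 'k) form2 \<Rightarrow> 'v \<Rightarrow> 'v \<Rightarrow> 'v \<Rightarrow> 'k" where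
  "local2 M a \<alpha> u v w = \<alpha> (param M a u) (to_frame M a u v) (to_frame M a u w)"

definition smooth_form0 ::
    "('a, 'v::banach) atlas \<Rightarrow> ('a, 'k::banach) form0 \<Rightarrow> bool" where
  "smooth_form0 M h \<longleftrightarrow> (\<forall>a. smooth_on (coord M a ` cdom M a) (h \<circ> param M a))"

definition smooth_form1 ::
    "('a, 'v::banach) atlas \<Rightarrow> ('a, 'v, 'k::banach) form1 \<Rightarrow> bool" where
  "smooth_form1 M \<alpha> \<longleftrightarrow> (\<forall>p. linear (\<alpha> p)) \<and>
     (\<forall>a. smooth_on (coord M a ` cdom M a \<times> UNIV) (\<lambda>(u, v). local1 M a \<alpha> u v))"

definition smooth_form2 ::
    "('a, 'v::banach) atlas \<Rightarrow> ('a, 'v, 'k::banach) form2 \<Rightarrow> bool" where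
  "smooth_form2 M \<alpha> \<longleftrightarrow> (\<forall>p. bilinear (\<alpha> p) \<and> (\<forall>v. \<alpha> p v v = 0)) \<and>
     (\<forall>a. smooth_on (coord M a ` cdom M a \<times> UNIV) (\<lambda>(u, v, w). local2 M a \<alpha> u v w))"

definition pullback1 ::
    "('a, 'v::real_normed_vector) atlas \<Rightarrow> ('b, 'w::real_normed_vector) atlas \<Rightarrow>
     ('a \<Rightarrow> 'b) \<Rightarrow> ('b, 'w, 'k) form1 \<Rightarrow> ('a, 'v, 'k) form1" where
  "pullback1 M N f \<alpha> p v = \<alpha> (f p) (tmap M N f p v)"

definition pullback2 ::
    "('a, 'v::real_normed_vector) atlas \<Rightarrow> ('b, 'w::real_normed_vector) atlas \<Rightarrow>
     ('a \<Rightarrow> 'b) \<Rightarrow> ('b, 'w, 'k) form2 \<Rightarrow> ('a, 'v, 'k) form2" where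
  "pullback2 M N f \<alpha> p v w = \<alpha> (f p) (tmap M N f p v) (tmap M N f p w)"

text \<open>
  Normalised by \<open>d\<alpha>(X,Y) = X \<alpha>(Y) - Y \<alpha>(X) - \<alpha>([X,Y])\<close>; at \<open>p\<close> the coordinate formula in the
  chart \<open>M p\<close> already gives the value in the tangent space at \<open>p\<close>.
\<close>

definition ext_deriv ::
    "('a, 'v::real_normed_vector) atlas \<Rightarrow> ('a, 'v, 'k::real_normed_vector) form1 \<Rightarrow> ('a, 'v, 'k) form2" where
  "ext_deriv M \<alpha> p v w =
     frechet_derivative (\<lambda>u. local1 M p \<alpha> u w) (at (coord M p p)) v -
     frechet_derivative (\<lambda>u. local1 M p \<alpha> u v) (at (coord M p p)) w"


section \<open>Lie groups and actions\<close>

record ('g, 'v) lie_group = "'g monoid" +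
  gatlas :: "('g, 'v) atlas"

definition is_lie_group :: "('g::t2_space, 'v::banach) lie_group \<Rightarrow> bool" where
  "is_lie_group G \<longleftrightarrow> group G \<and> carrier G = UNIV \<and> smooth_manifold (gatlas G) \<and>
     smooth_map (gatlas G \<times>\<^sub>m gatlas G) (gatlas G) (\<lambda>(g, h). g \<otimes>\<^bsub>G\<^esub> h) \<and>
     smooth_map (gatlas G) (gatlas G) (\<lambda>g. inv\<^bsub>G\<^esub> g)"

text \<open>
  The Lie algebra is the tangent space at the identity, i.e. the model type \<open>'v\<close>, with the bracket
  of left-invariant vector fields.
\<close>

definition left_inv_field :: "('g, 'v::real_normed_vector) lie_group \<Rightarrow> 'v \<Rightarrow> 'g \<Rightarrow> 'v" where
  "left_inv_field G A g = tmap (gatlas G) (gatlas G) (\<lambda>x. g \<otimes>\<^bsub>G\<^esub> x) \<one>\<^bsub>G\<^esub> A"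

definition bracket :: "('g, 'v::real_normed_vector) lie_group \<Rightarrow> 'v \<Rightarrow> 'v \<Rightarrow> 'v" where
  "bracket G A B = lie_bracket (gatlas G) (left_inv_field G A) (left_inv_field G B) \<one>\<^bsub>G\<^esub>"

definition Ad :: "('g, 'v::real_normed_vector) lie_group \<Rightarrow> 'g \<Rightarrow> 'v \<Rightarrow> 'v" where
  "Ad G g = tmap (gatlas G) (gatlas G) (\<lambda>x. g \<otimes>\<^bsub>G\<^esub> x \<otimes>\<^bsub>G\<^esub> inv\<^bsub>G\<^esub> g) \<one>\<^bsub>G\<^esub>"

definition left_action ::
    "('g::t2_space, 'vg::banach) lie_group \<Rightarrow> ('y::t2_space, 'vy::banach) atlas \<Rightarrow> ('g \<Rightarrow> 'y \<Rightarrow> 'y) \<Rightarrow> bool" where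
  "left_action G Y l \<longleftrightarrow> smooth_map (gatlas G \<times>\<^sub>m Y) Y (\<lambda>(g, y). l g y) \<and>
     (\<forall>y. l \<one>\<^bsub>G\<^esub> y = y) \<and> (\<forall>g h y. l (g \<otimes>\<^bsub>G\<^esub> h) y = l g (l h y))"

definition right_action ::
    "('g::t2_space, 'vg::banach) lie_group \<Rightarrow> ('y::t2_space, 'vy::banach) atlas \<Rightarrow> ('y \<Rightarrow> 'g \<Rightarrow> 'y) \<Rightarrow> bool" where
  "right_action G Y r \<longleftrightarrow> smooth_map (Y \<times>\<^sub>m gatlas G) Y (\<lambda>(y, g). r y g) \<and>
     (\<forall>y. r y \<one>\<^bsub>G\<^esub> = y) \<and> (\<forall>g h y. r y (g \<otimes>\<^bsub>G\<^esub> h) = r (r y g) h)"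

text \<open>
  The velocity at \<open>t = 0\<close> of \<open>exp (- t A) \<cdot> y\<close>: the curve \<open>exp (- t A)\<close> has velocity \<open>- A\<close> at the
  identity, and it is mapped by \<open>g \<mapsto> g \<cdot> y\<close>.
\<close>

definition action_field ::
    "('g, 'vg::real_normed_vector) lie_group \<Rightarrow> ('y, 'vy::real_normed_vector) atlas \<Rightarrow>
     ('g \<Rightarrow> 'y \<Rightarrow> 'y) \<Rightarrow> 'vg \<Rightarrow> 'y \<Rightarrow> 'vy" where
  "action_field G Y l A y = tmap (gatlas G) Y (\<lambda>g. l g y) \<one>\<^bsub>G\<^esub> (- A)"


section \<open>Principal bundles and connections\<close>

record ('p, 'vp, 'x, 'vx, 'g) pbundle =
  total :: "('p, 'vp) atlas"
  base :: "('x, 'vx) atlas"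
  proj :: "'p \<Rightarrow> 'x"
  ract :: "'p \<Rightarrow> 'g \<Rightarrow> 'p"

definition principal_bundle ::
    "('g::t2_space, 'vg::banach) lie_group \<Rightarrow>
     ('p::t2_space, 'vp::banach, 'x::t2_space, 'vx::banach, 'g) pbundle \<Rightarrow> bool" where
  "principal_bundle G P \<longleftrightarrow>
     is_lie_group G \<and> smooth_manifold (total P) \<and> smooth_manifold (base P) \<and>
     smooth_map (total P) (base P) (proj P) \<and> right_action G (total P) (ract P) \<and>
     (\<forall>p g. proj P (ract P p g) = proj P p) \<and>
     (\<forall>x. \<exists>U \<psi> \<tau>. x \<in> U \<and> open U \<and>
        smooth_map_on (base P \<times>\<^sub>m gatlas G) (total P) (U \<times> UNIV) \<psi> \<and>
        smooth_map_on (total P) (gatlas G) (proj P -` U) \<tau> \<and>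
        (\<forall>u\<in>U. \<forall>g. proj P (\<psi> (u, g)) = u \<and> \<tau> (\<psi> (u, g)) = g) \<and>
        (\<forall>u\<in>U. \<forall>g h. \<psi> (u, g \<otimes>\<^bsub>G\<^esub> h) = ract P (\<psi> (u, g)) h) \<and>
        (\<forall>p. proj P p \<in> U \<longrightarrow> \<psi> (proj P p, \<tau> p) = p))"

definition connection ::
    "('g::t2_space, 'vg::banach) lie_group \<Rightarrow>
     ('p::t2_space, 'vp::banach, 'x::t2_space, 'vx::banach, 'g) pbundle \<Rightarrow>
     ('p, 'vp, 'vg) form1 \<Rightarrow> bool" where
  "connection G P \<Theta> \<longleftrightarrow> smooth_form1 (total P) \<Theta> \<and>
     (\<forall>p A. \<Theta> p (tmap (gatlas G) (total P) (ract P p) \<one>\<^bsub>G\<^esub> A) = A) \<and>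
     (\<forall>g p v. pullback1 (total P) (total P) (\<lambda>p. ract P p g) \<Theta> p v = Ad G (inv\<^bsub>G\<^esub> g) (\<Theta> p v))"

definition wedge_bracket ::
    "('g, 'vg::real_normed_vector) lie_group \<Rightarrow>
     ('p, 'vp, 'vg) form1 \<Rightarrow> ('p, 'vp, 'vg) form1 \<Rightarrow> ('p, 'vp, 'vg) form2" where
  "wedge_bracket G \<alpha> \<beta> p v w = bracket G (\<alpha> p v) (\<beta> p w) - bracket G (\<alpha> p w) (\<beta> p v)"

definition curvature ::
    "('g, 'vg::real_normed_vector) lie_group \<Rightarrow> ('p, 'vp::real_normed_vector) atlas \<Rightarrow>
     ('p, 'vp, 'vg) form1 \<Rightarrow> ('p, 'vp, 'vg) form2" where
  "curvature G M \<Theta> p v w = ext_deriv M \<Theta> p v w + (1 / 2) *\<^sub>R wedge_bracket G \<Theta> \<Theta> p v w"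

definition bundle_action ::
    "('g::t2_space, 'vg::banach) lie_group \<Rightarrow>
     ('p::t2_space, 'vp::banach, 'x::t2_space, 'vx::banach, 'h) pbundle \<Rightarrow>
     ('g \<Rightarrow> 'p \<Rightarrow> 'p) \<Rightarrow> ('g \<Rightarrow> 'x \<Rightarrow> 'x) \<Rightarrow> bool" where
  "bundle_action G P lP lX \<longleftrightarrow> left_action G (total P) lP \<and> left_action G (base P) lX \<and>
     (\<forall>g p. proj P (lP g p) = lX g (proj P p)) \<and>
     (\<forall>g p h. lP g (ract P p h) = ract P (lP g p) h)"

definition preserves_form1 ::
    "('y, 'vy::real_normed_vector) atlas \<Rightarrow> ('g \<Rightarrow> 'y \<Rightarrow> 'y) \<Rightarrow> ('y, 'vy, 'k) form1 \<Rightarrow> bool" where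
  "preserves_form1 Y l \<alpha> \<longleftrightarrow> (\<forall>g. pullback1 Y Y (l g) \<alpha> = \<alpha>)"


section \<open>The Borel quotient over a test manifold\<close>

text \<open>
  An object of \<open>B\<^sub>\<nabla> G\<close> over the test manifold \<open>base Q\<close>. Together with \<open>f\<close> it is an object of
  \<open>(Y\<^sub>G)\<^sub>\<nabla>\<close>, i.e. a map from \<open>base Q\<close> to \<open>(Y\<^sub>G)\<^sub>\<nabla>\<close>. Equivariance is for the left action
  \<open>g \<cdot> q = q g\<inverse>\<close>.
\<close>

definition BG_object ::
    "('g::t2_space, 'vg::banach) lie_group \<Rightarrow>
     ('q::t2_space, 'vq::banach, 'm::t2_space, 'vm::banach, 'g) pbundle \<Rightarrow>
     ('q, 'vq, 'vg) form1 \<Rightarrow> bool" where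
  "BG_object G Q \<phi> \<longleftrightarrow> fin_dim (base Q) \<and> principal_bundle G Q \<and> connection G Q \<phi>"

definition equivariant_map ::
    "('g::t2_space, 'vg::banach) lie_group \<Rightarrow>
     ('q::t2_space, 'vq::banach, 'm::t2_space, 'vm::banach, 'g) pbundle \<Rightarrow>
     ('y::t2_space, 'vy::banach) atlas \<Rightarrow> ('g \<Rightarrow> 'y \<Rightarrow> 'y) \<Rightarrow> ('q \<Rightarrow> 'y) \<Rightarrow> bool" where
  "equivariant_map G Q Y l f \<longleftrightarrow> smooth_map (total Q) Y f \<and>
     (\<forall>q g. f (ract Q q (inv\<^bsub>G\<^esub> g)) = l g (f q))"

text \<open>
  \<open>Q \<times>\<^sub>G Y\<close> is the base of the principal \<open>G\<close>-bundle on \<open>Q \<times> Y\<close> with action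
  \<open>(q, y) g = (q g, g\<inverse> y)\<close>; this fixes its smooth structure. \<open>\<kappa>\<close> is the quotient map.
\<close>

definition borel_bundle ::
    "('g::t2_space, 'vg::banach) lie_group \<Rightarrow>
     ('q::t2_space, 'vq::banach, 'm::t2_space, 'vm::banach, 'g) pbundle \<Rightarrow>
     ('y::t2_space, 'vy::banach) atlas \<Rightarrow> ('g \<Rightarrow> 'y \<Rightarrow> 'y) \<Rightarrow>
     ('e::t2_space, 've::banach) atlas \<Rightarrow> ('q \<times> 'y \<Rightarrow> 'e) \<Rightarrow>
     ('q \<times> 'y, 'vq \<times> 'vy, 'e, 've, 'g) pbundle" where
  "borel_bundle G Q Y l E \<kappa> =
     \<lparr> total = total Q \<times>\<^sub>m Y, base = E, proj = \<kappa>,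
       ract = (\<lambda>(q, y) g. (ract Q q g, l (inv\<^bsub>G\<^esub> g) y)) \<rparr>"

text \<open>
  \<open>E\<close> is the principal \<open>H\<close>-bundle \<open>Q \<times>\<^sub>G P \<rightarrow> Q \<times>\<^sub>G X\<close>, with quotient maps \<open>\<kappa>P\<close> and \<open>\<kappa>X\<close>.
\<close>

definition associated_bundle ::
    "('g::t2_space, 'vg::banach) lie_group \<Rightarrow> ('h::t2_space, 'vh::banach) lie_group \<Rightarrow>
     ('p::t2_space, 'vp::banach, 'x::t2_space, 'vx::banach, 'h) pbundle \<Rightarrow>
     ('g \<Rightarrow> 'p \<Rightarrow> 'p) \<Rightarrow> ('g \<Rightarrow> 'x \<Rightarrow> 'x) \<Rightarrow>
     ('q::t2_space, 'vq::banach, 'm::t2_space, 'vm::banach, 'g) pbundle \<Rightarrow>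
     ('e::t2_space, 've::banach, 'b::t2_space, 'vb::banach, 'h) pbundle \<Rightarrow>
     ('q \<times> 'p \<Rightarrow> 'e) \<Rightarrow> ('q \<times> 'x \<Rightarrow> 'b) \<Rightarrow> bool" where
  "associated_bundle G H P lP lX Q E \<kappa>P \<kappa>X \<longleftrightarrow>
     principal_bundle G (borel_bundle G Q (total P) lP (total E) \<kappa>P) \<and>
     principal_bundle G (borel_bundle G Q (base P) lX (base E) \<kappa>X) \<and>
     principal_bundle H E \<and>
     (\<forall>q p. proj E (\<kappa>P (q, p)) = \<kappa>X (q, proj P p)) \<and>
     (\<forall>q p h. ract E (\<kappa>P (q, p)) h = \<kappa>P (q, ract P p h))"

text \<open>The section of \<open>Q \<times>\<^sub>G Y\<close> corresponding to the equivariant map \<open>f\<close>.\<close>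

definition section_of_map ::
    "('q::t2_space, 'vq::banach, 'm::t2_space, 'vm::banach, 'g) pbundle \<Rightarrow>
     ('e::t2_space, 've::banach) atlas \<Rightarrow> ('q \<times> 'y \<Rightarrow> 'e) \<Rightarrow> ('q \<Rightarrow> 'y) \<Rightarrow> ('m \<Rightarrow> 'e) \<Rightarrow> bool" where
  "section_of_map Q E \<kappa> f s \<longleftrightarrow> smooth_map (base Q) E s \<and> (\<forall>q. s (proj Q q) = \<kappa> (q, f q))"

text \<open>The connection on \<open>E\<close> whose horizontal distribution is the image of \<open>ker \<phi> \<oplus> ker \<Theta>\<close>.\<close>

definition induced_connection ::
    "('h::t2_space, 'vh::banach) lie_group \<Rightarrow>
     ('p::t2_space, 'vp::banach, 'x::t2_space, 'vx::banach, 'h) pbundle \<Rightarrow> ('p, 'vp, 'vh) form1 \<Rightarrow>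
     ('q::t2_space, 'vq::banach, 'm::t2_space, 'vm::banach, 'g) pbundle \<Rightarrow> ('q, 'vq, 'vg::real_vector) form1 \<Rightarrow>
     ('e::t2_space, 've::banach, 'b::t2_space, 'vb::banach, 'h) pbundle \<Rightarrow> ('q \<times> 'p \<Rightarrow> 'e) \<Rightarrow>
     ('e, 've, 'vh) form1 \<Rightarrow> bool" where
  "induced_connection H P \<Theta> Q \<phi> E \<kappa> \<Theta>Q \<longleftrightarrow> connection H E \<Theta>Q \<and>
     (\<forall>q p. {z. \<Theta>Q (\<kappa> (q, p)) z = 0} =
        tmap (total Q \<times>\<^sub>m total P) (total E) \<kappa> (q, p) ` ({u. \<phi> q u = 0} \<times> {v. \<Theta> p v = 0}))"


section \<open>Weil and Cartan models in degree 2\<close>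

text \<open>
  An element of total degree 2 of \<open>Sym \<gg>\<^sup>* \<otimes> \<Lambda> \<gg>\<^sup>* \<otimes> \<Omega>(Y; k)\<close>, with \<open>Sym\<close> generated by the \<open>\<nu>\<^sup>a\<close>
  (degree 2) and \<open>\<Lambda>\<close> by the \<open>\<theta>\<^sup>a\<close> (degree 1), is uniquely
  \<open>\<alpha> + \<theta>\<^sup>a \<beta>\<^sub>a + 1/2 \<theta>\<^sup>a \<theta>\<^sup>b \<gamma>\<^sub>a\<^sub>b + \<nu>\<^sup>a \<delta>\<^sub>a\<close>. The coefficients are stored basis-free, as
  (bi)linear functions on the Lie algebra: \<open>\<beta>\<^sub>a = w\<theta> w e\<^sub>a\<close>, \<open>\<gamma>\<^sub>a\<^sub>b = w\<theta>\<theta> w e\<^sub>a e\<^sub>b\<close>,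
  \<open>\<delta>\<^sub>a = w\<nu> w e\<^sub>a\<close>. The \<open>\<nu>\<^sup>a = d\<theta>\<^sup>a + 1/2 f\<^sup>a\<^sub>b\<^sub>c \<theta>\<^sup>b \<theta>\<^sup>c\<close> replace the generators \<open>d\<theta>\<^sup>a\<close>, so the
  structure constants enter only through the curvature substituted for \<open>\<nu>\<close>.
\<close>

record ('vg, 'y, 'vy, 'k) weil2 =
  w\<Omega> :: "('y, 'vy, 'k) form2"
  w\<theta> :: "'vg \<Rightarrow> ('y, 'vy, 'k) form1"
  w\<theta>\<theta> :: "'vg \<Rightarrow> 'vg \<Rightarrow> ('y, 'k) form0"
  w\<nu> :: "'vg \<Rightarrow> ('y, 'k) form0"

definition weil_element ::
    "('y, 'vy::banach) atlas \<Rightarrow> ('vg::banach, 'y, 'vy, 'k::banach) weil2 \<Rightarrow> bool" where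
  "weil_element Y w \<longleftrightarrow>
     smooth_form2 Y (w\<Omega> w) \<and>
     (\<forall>A. smooth_form1 Y (w\<theta> w A)) \<and> (\<forall>y v. linear (\<lambda>A. w\<theta> w A y v)) \<and>
     (\<forall>A B. smooth_form0 Y (w\<theta>\<theta> w A B)) \<and>
     (\<forall>y. bilinear (\<lambda>A B. w\<theta>\<theta> w A B y) \<and> (\<forall>A. w\<theta>\<theta> w A A y = 0)) \<and>
     (\<forall>A. smooth_form0 Y (w\<nu> w A)) \<and> (\<forall>y. linear (\<lambda>A. w\<nu> w A y))"

text \<open>Invariance for the coadjoint action on the generators and pull-back on \<open>Y\<close>.\<close>

definition weil_invariant ::
    "('g, 'vg::real_normed_vector) lie_group \<Rightarrow> ('y, 'vy::real_normed_vector) atlas \<Rightarrow>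
     ('g \<Rightarrow> 'y \<Rightarrow> 'y) \<Rightarrow> ('vg, 'y, 'vy, 'k) weil2 \<Rightarrow> bool" where
  "weil_invariant G Y l w \<longleftrightarrow> (\<forall>g A B.
     pullback2 Y Y (l g) (w\<Omega> w) = w\<Omega> w \<and>
     pullback1 Y Y (l g) (w\<theta> w (Ad G g A)) = w\<theta> w A \<and>
     w\<theta>\<theta> w (Ad G g A) (Ad G g B) \<circ> l g = w\<theta>\<theta> w A B \<and>
     w\<nu> w (Ad G g A) \<circ> l g = w\<nu> w A)"

text \<open>
  Contraction with \<open>A\<close> is the derivation with \<open>\<iota>\<^sub>A \<theta> = A\<close>, \<open>\<iota>\<^sub>A \<nu> = 0\<close> and contraction with the
  action field of \<open>A\<close> on \<open>\<Omega>(Y)\<close>; the two conditions are the vanishing of the parts of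
  \<open>\<iota>\<^sub>A w\<close> without \<open>\<theta>\<close> and linear in \<open>\<theta>\<close>.
\<close>

definition weil_horizontal ::
    "('g, 'vg::real_normed_vector) lie_group \<Rightarrow> ('y, 'vy::real_normed_vector) atlas \<Rightarrow>
     ('g \<Rightarrow> 'y \<Rightarrow> 'y) \<Rightarrow> ('vg, 'y, 'vy, 'k::real_vector) weil2 \<Rightarrow> bool" where
  "weil_horizontal G Y l w \<longleftrightarrow> (\<forall>A y.
     (\<forall>v. w\<Omega> w y (action_field G Y l A y) v + w\<theta> w A y v = 0) \<and>
     (\<forall>B. w\<theta>\<theta> w A B y - w\<theta> w B y (action_field G Y l A y) = 0))"

definition weil_basic ::
    "('g, 'vg::banach) lie_group \<Rightarrow> ('y, 'vy::banach) atlas \<Rightarrow>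
     ('g \<Rightarrow> 'y \<Rightarrow> 'y) \<Rightarrow> ('vg, 'y, 'vy, 'k::banach) weil2 \<Rightarrow> bool" where
  "weil_basic G Y l w \<longleftrightarrow> weil_element Y w \<and> weil_invariant G Y l w \<and> weil_horizontal G Y l w"

text \<open>
  The form on \<open>Q\<close> obtained by \<open>\<theta> \<mapsto> \<phi>\<close>, \<open>\<nu> \<mapsto>\<close> curvature of \<open>\<phi>\<close>, and pull-back along \<open>f\<close>.
\<close>

definition weil_value ::
    "('g, 'vg::real_normed_vector) lie_group \<Rightarrow> ('q, 'vq::real_normed_vector) atlas \<Rightarrow>
     ('y, 'vy::real_normed_vector) atlas \<Rightarrow> ('q, 'vq, 'vg) form1 \<Rightarrow> ('q \<Rightarrow> 'y) \<Rightarrow>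
     ('vg, 'y, 'vy, 'k::real_vector) weil2 \<Rightarrow> ('q, 'vq, 'k) form2" where
  "weil_value G Q Y \<phi> f w q u v =
     pullback2 Q Y f (w\<Omega> w) q u v +
     (pullback1 Q Y f (w\<theta> w (\<phi> q u)) q v - pullback1 Q Y f (w\<theta> w (\<phi> q v)) q u) +
     w\<theta>\<theta> w (\<phi> q u) (\<phi> q v) (f q) +
     w\<nu> w (curvature G Q \<phi> q u v) (f q)"

text \<open>For a surjective submersion \<open>f\<close> there is at most one \<open>\<psi>\<close>.\<close>

definition descends_to ::
    "('a, 'v::real_normed_vector) atlas \<Rightarrow> ('b, 'w::real_normed_vector) atlas \<Rightarrow> ('a \<Rightarrow> 'b) \<Rightarrow>
     ('a, 'v, 'k) form2 \<Rightarrow> ('b, 'w, 'k) form2 \<Rightarrow> bool" where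
  "descends_to M N f \<eta> \<psi> \<longleftrightarrow> pullback2 M N f \<psi> = \<eta>"

text \<open>
  Degree 2 of \<open>Sym \<gg>\<^sup>* \<otimes> \<Omega>(Y; k)\<close>: the pair \<open>(\<alpha>, \<delta>)\<close> is \<open>\<alpha> + \<chi>\<^sup>a \<delta>\<^sub>a\<close> with \<open>\<delta>\<^sub>a = \<delta> e\<^sub>a\<close>.
\<close>

type_synonym ('vg, 'y, 'vy, 'k) cartan2 = "('y, 'vy, 'k) form2 \<times> ('vg \<Rightarrow> ('y, 'k) form0)"

definition weil_to_cartan :: "('vg, 'y, 'vy, 'k) weil2 \<Rightarrow> ('vg, 'y, 'vy, 'k) cartan2" where
  "weil_to_cartan w = (w\<Omega> w, w\<nu> w)"

definition is_basis :: "'v::real_vector set \<Rightarrow> bool" where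
  "is_basis B \<longleftrightarrow> finite B \<and> independent B \<and> span B = UNIV"

text \<open>A basis indexes itself: for \<open>a \<in> B\<close>, \<open>e\<^sub>a = a\<close>, and \<open>dual_basis B a\<close> is \<open>\<chi>\<^sup>a\<close> as a linear function.\<close>

definition dual_basis :: "'v::real_vector set \<Rightarrow> 'v \<Rightarrow> 'v \<Rightarrow> real" where
  "dual_basis B a A = representation B A a"

definition contraction :: "('y \<Rightarrow> 'vy) \<Rightarrow> ('y, 'vy, 'k) form1 \<Rightarrow> ('y, 'k) form0" where
  "contraction \<xi> \<alpha> y = \<alpha> y (\<xi> y)"

end

theory Submission
  imports Defs
begin

text \<open>
  Write \<open>\<xi> A\<close> for the action field of \<open>A\<close>. Horizontality forces the Weil element with
  leading term \<open>\<Omega>\<close>, whose \<open>\<nu>\<close>-part is \<open>- \<Theta>(\<xi> A)\<close>. Substituting \<open>\<phi>\<close> and its curvature \<open>F\<close>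
  gives \<open>\<Omega>(v - \<xi> (\<phi> u), v' - \<xi> (\<phi> u')) - \<Theta>(\<xi> (F(u, u')))\<close> on tangent vectors \<open>(u, v)\<close>, \<open>(u', v')\<close>
  of \<open>Q \<times> P\<close>.

  On \<open>Q \<times> P\<close> the induced connection pulls back to \<open>(u, v) \<mapsto> \<Theta>(v) - \<Theta>(\<xi> (\<phi> u))\<close>, because \<open>\<kappa>(q g, p) = \<kappa>(q, g p)\<close>
  makes the vectors \<open>(vertical A, \<xi> A)\<close> tangent to the fibres of \<open>\<kappa>\<close>. Its curvature is computed from two
  consequences of invariance: \<open>d(\<Theta>(\<xi> A)) = - d\<Theta>(\<xi> A, _)\<close> (Cartan's formula, as the Lie derivative of \<open>\<Theta>\<close> along \<open>\<xi> A\<close> vanishes) and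
  \<open>d\<Theta>(\<xi> A, \<xi> B) = \<Theta>(\<xi> [A, B])\<close>.

  Smoothness is only given through derivatives in fixed directions. By uniform boundedness the derivative of
  a smooth map is then smooth as a map into the bounded operators, so that forms, action fields and
  tangent maps can be treated in charts as smooth operator-valued functions.
\<close>

section \<open>Smooth maps between Banach spaces\<close>

text \<open>No flow and no exponential map is constructed. Each infinitesimal fact comes from an
  identity valid for all group elements, written in a chart around the unit and differentiated
  there: associativity of the action gives [\<xi> A, \<xi> B] = \<xi> [A, B], and invariance of
  \<Theta> gives its vanishing Lie derivative. Symmetry of the second derivative of the action is
  used in both. The two consequences of invariance enter at different places. The pulled-back
  connection contains \<Theta>(\<xi> (\<phi> u)), a function on P paired with a form on Q; Cartan's
  formula turns the derivative of the function into d\<Theta>. The second consequence makes the term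
  d\<Theta>(\<xi> A, \<xi> B) contained in \<Omega>(v - _, v' - _) cancel against the bracket part
  of F, so that only d\<phi> remains inside \<Theta>(\<xi> _), exactly as in the curvature of the
  pulled-back connection. The total space \<open>E\<close> is known only through its quotient map
  \<kappa>. Curvatures are therefore compared after pull-back along \<kappa>, and this is also the
  form in which \<open>descends_to\<close> poses the question.\<close>

abbreviation dir_deriv :: "('a::real_normed_vector \<Rightarrow> 'b::real_normed_vector) \<Rightarrow> 'a \<Rightarrow> 'a \<Rightarrow> 'b" where
  "dir_deriv f v \<equiv> (\<lambda>x. frechet_derivative f (at x) v)"

lemma has_derivative_frechet:
  "f differentiable at x \<Longrightarrow> (f has_derivative frechet_derivative f (at x)) (at x)"
  by (simp add: frechet_derivative_works)

lemma bounded_linear_frechet_derivative: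
  "f differentiable at x \<Longrightarrow> bounded_linear (frechet_derivative f (at x))"
  using has_derivative_bounded_linear has_derivative_frechet by blast

section \<open>Closure properties of \<open>Ck\<close> and \<open>smooth_on\<close>\<close>

lemma Ck_cong:
  assumes "open S" "\<And>x. x \<in> S \<Longrightarrow> f x = g x" "Ck k S f"
  shows "Ck k S g"
proof (cases k)
  case 0
  then show ?thesis using assms continuous_on_cong by fastforce
next
  case (Suc j)
  then obtain f' where f': "\<And>x. x \<in> S \<Longrightarrow> (f has_derivative f' x) (at x)" "\<And>v. Ck j S (\<lambda>x. f' x v)"
    using assms(3) by auto
  then show ?thesis
    unfolding Suc Ck.simps using assms has_derivative_transform_within_open by metis
qed

text \<open>A derivative is unique where it exists, so the existential \<open>f'\<close> of
  \<open>Ck\<close> can be replaced by \<open>frechet_derivative\<close>; openness lets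
  \<open>Ck_cong\<close> transport the condition of order \<open>k\<close>.\<close>

lemma Ck_Suc_iff:
  assumes "open S"
  shows "Ck (Suc k) S f \<longleftrightarrow> (\<forall>x\<in>S. f differentiable at x) \<and> (\<forall>v. Ck k S (dir_deriv f v))"
proof
  assume "Ck (Suc k) S f"
  then obtain f' where f': "\<And>x. x \<in> S \<Longrightarrow> (f has_derivative f' x) (at x)" "\<And>v. Ck k S (\<lambda>x. f' x v)"
    by auto
  have "Ck k S (dir_deriv f v)" for v
    using frechet_derivative_at[OF f'(1)] by (intro Ck_cong[OF assms _ f'(2)[of v]]) auto
  then show "(\<forall>x\<in>S. f differentiable at x) \<and> (\<forall>v. Ck k S (dir_deriv f v))"
    using f'(1) differentiable_def by blast
next
  assume "(\<forall>x\<in>S. f differentiable at x) \<and> (\<forall>v. Ck k S (dir_deriv f v))"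
  then show "Ck (Suc k) S f"
    using has_derivative_frechet by fastforce
qed

lemma Ck_SucD: "Ck (Suc k) S f \<Longrightarrow> Ck k S f"
proof (induction k arbitrary: f)
  case 0
  then show ?case
    using continuous_at_imp_continuous_on has_derivative_continuous
    by (metis Ck.simps(1) Ck.simps(2))
next
  case (Suc k)
  then show ?case by (metis Ck.simps(2))
qed

lemma Ck_const: "Ck k S (\<lambda>x. c)"
proof (induction k arbitrary: c)
  case (Suc k)
  show ?case
    unfolding Ck.simps by (rule exI[of _ "\<lambda>x v. 0"]) (use Suc in auto)
qed auto

lemma Ck_bounded_linear:
  assumes "bounded_linear L"
  shows "Ck k S L"
proof (cases k)
  case 0
  then show ?thesis using assms by (simp add: linear_continuous_on)
next
  case (Suc j)
  then show ?thesis
    using assms Ck_const bounded_linear_imp_has_derivative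
    by (auto intro!: exI[of _ "\<lambda>x. L"])
qed

lemma Ck_add:
  "Ck k S f \<Longrightarrow> Ck k S g \<Longrightarrow> Ck k S (\<lambda>x. f x + g x)"
proof (induction k arbitrary: f g)
  case 0
  then show ?case by (simp add: continuous_on_add)
next
  case (Suc k)
  from Suc.prems obtain f' where f: "\<And>x. x \<in> S \<Longrightarrow> (f has_derivative f' x) (at x)" "\<And>v. Ck k S (\<lambda>x. f' x v)"
    by auto
  from Suc.prems obtain g' where g: "\<And>x. x \<in> S \<Longrightarrow> (g has_derivative g' x) (at x)" "\<And>v. Ck k S (\<lambda>x. g' x v)"
    by auto
  show ?case
    unfolding Ck.simps
    by (rule exI[of _ "\<lambda>x v. f' x v + g' x v"]) (use f g Suc.IH has_derivative_add in blast)
qed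

lemma Ck_bilinear:
  assumes B: "bounded_bilinear B"
  shows "Ck k S f \<Longrightarrow> Ck k S g \<Longrightarrow> Ck k S (\<lambda>x. B (f x) (g x))"
proof (induction k arbitrary: f g)
  case 0
  then show ?case by (simp add: bounded_bilinear.continuous_on[OF B])
next
  case (Suc k)
  from Suc.prems obtain f' where f: "\<And>x. x \<in> S \<Longrightarrow> (f has_derivative f' x) (at x)" "\<And>v. Ck k S (\<lambda>x. f' x v)"
    by auto
  from Suc.prems obtain g' where g: "\<And>x. x \<in> S \<Longrightarrow> (g has_derivative g' x) (at x)" "\<And>v. Ck k S (\<lambda>x. g' x v)"
    by auto
  have "Ck k S f" "Ck k S g"
    using Suc.prems Ck_SucD by auto
  then have "Ck k S (\<lambda>x. B (f x) (g' x v) + B (f' x v) (g x))" for v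
    using Suc.IH f g by (intro Ck_add) auto
  then show ?case
    unfolding Ck.simps using f g bounded_bilinear.FDERIV[OF B]
    by (intro exI[of _ "\<lambda>x v. B (f x) (g' x v) + B (f' x v) (g x)"]) blast
qed

lemma Ck_linear_compose:
  assumes L: "bounded_linear L"
  shows "Ck k S f \<Longrightarrow> Ck k S (\<lambda>x. L (f x))"
proof (induction k arbitrary: f)
  case 0
  then show ?case by (simp add: bounded_linear.continuous_on[OF L])
next
  case (Suc k)
  then obtain f' where f: "\<And>x. x \<in> S \<Longrightarrow> (f has_derivative f' x) (at x)" "\<And>v. Ck k S (\<lambda>x. f' x v)"
    by auto
  show ?case
    unfolding Ck.simps
    by (rule exI[of _ "\<lambda>x v. L (f' x v)"]) (use f Suc.IH bounded_linear.has_derivative[OF L] in blast)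
qed

text \<open>An affine inner map carries the fixed direction \<open>v\<close> to the fixed direction
  \<open>L v\<close>, so the induction closes. For a general inner map the direction would vary with
  \<open>x\<close>, which \<open>Ck\<close> does not control directly.\<close>

lemma Ck_compose_affine:
  assumes L: "bounded_linear L" and sub: "\<And>x. x \<in> T \<Longrightarrow> c + L x \<in> S"
  shows "Ck k S f \<Longrightarrow> Ck k T (\<lambda>x. f (c + L x))"
proof (induction k arbitrary: f)
  case 0
  have "continuous_on T (\<lambda>x. c + L x)"
    using L by (simp add: continuous_on_add linear_continuous_on)
  with 0 show ?case
    using continuous_on_compose2 sub by (metis Ck.simps(1) image_subsetI)
next
  case (Suc k)
  then obtain f' where f: "\<And>x. x \<in> S \<Longrightarrow> (f has_derivative f' x) (at x)" "\<And>v. Ck k S (\<lambda>x. f' x v)"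
    by auto
  have L': "((\<lambda>x. c + L x) has_derivative L) (at x)" for x
    using bounded_linear_imp_has_derivative[OF L] by (auto intro!: derivative_eq_intros)
  have "((\<lambda>x. f (c + L x)) has_derivative (\<lambda>v. f' (c + L x) (L v))) (at x)" if "x \<in> T" for x
    using has_derivative_compose[OF L' f(1)[OF sub[OF that]]] .
  then show ?case
    unfolding Ck.simps using f Suc.IH
    by (intro exI[of _ "\<lambda>x v. f' (c + L x) (L v)"]) blast
qed

lemma smooth_on_iff:
  assumes "open S"
  shows "smooth_on S f \<longleftrightarrow> (\<forall>x\<in>S. f differentiable at x) \<and> (\<forall>v. smooth_on S (dir_deriv f v))"
  unfolding smooth_on_def using Ck_Suc_iff[OF assms] Ck_SucD by metis

lemma smooth_on_differentiable: "open S \<Longrightarrow> smooth_on S f \<Longrightarrow> x \<in> S \<Longrightarrow> f differentiable at x"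
  using smooth_on_iff by blast

lemma smooth_on_dir_deriv: "open S \<Longrightarrow> smooth_on S f \<Longrightarrow> smooth_on S (dir_deriv f v)"
  using smooth_on_iff by blast

lemma smooth_on_cong:
  "open S \<Longrightarrow> (\<And>x. x \<in> S \<Longrightarrow> f x = g x) \<Longrightarrow> smooth_on S f \<Longrightarrow> smooth_on S g"
  unfolding smooth_on_def using Ck_cong by blast

lemma smooth_on_bounded_linear: "bounded_linear L \<Longrightarrow> smooth_on S L"
  unfolding smooth_on_def using Ck_bounded_linear by blast

lemma smooth_on_add: "smooth_on S f \<Longrightarrow> smooth_on S g \<Longrightarrow> smooth_on S (\<lambda>x. f x + g x)"
  unfolding smooth_on_def using Ck_add by blast

lemma smooth_on_bilinear:
  "bounded_bilinear B \<Longrightarrow> smooth_on S f \<Longrightarrow> smooth_on S g \<Longrightarrow> smooth_on S (\<lambda>x. B (f x) (g x))"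
  unfolding smooth_on_def using Ck_bilinear by blast

lemma smooth_on_linear_compose:
  "bounded_linear L \<Longrightarrow> smooth_on S f \<Longrightarrow> smooth_on S (\<lambda>x. L (f x))"
  unfolding smooth_on_def using Ck_linear_compose by blast

lemma smooth_on_compose_affine:
  "bounded_linear L \<Longrightarrow> (\<And>x. x \<in> T \<Longrightarrow> c + L x \<in> S) \<Longrightarrow> smooth_on S f \<Longrightarrow> smooth_on T (\<lambda>x. f (c + L x))"
  unfolding smooth_on_def using Ck_compose_affine by blast

lemma smooth_on_compose_linear:
  "bounded_linear L \<Longrightarrow> (\<And>x. x \<in> T \<Longrightarrow> L x \<in> S) \<Longrightarrow> smooth_on S f \<Longrightarrow> smooth_on T (\<lambda>x. f (L x))"
  using smooth_on_compose_affine[of L T 0 S f] by simp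

lemma smooth_on_minus: "smooth_on S f \<Longrightarrow> smooth_on S (\<lambda>x. - f x)"
  by (rule smooth_on_linear_compose[OF bounded_linear_minus[OF bounded_linear_ident]])

lemma smooth_on_diff: "smooth_on S f \<Longrightarrow> smooth_on S g \<Longrightarrow> smooth_on S (\<lambda>x. f x - g x)"
  using smooth_on_add[OF _ smooth_on_minus] by fastforce

lemma smooth_on_Pair:
  assumes "smooth_on S f" "smooth_on S g"
  shows "smooth_on S (\<lambda>x. (f x, g x))"
proof -
  have "bounded_linear (\<lambda>x. (x, 0))" "bounded_linear (\<lambda>x. (0, x))"
    by (intro bounded_linear_Pair bounded_linear_ident bounded_linear_zero)+
  then have "smooth_on S (\<lambda>x. (f x, 0) + (0, g x))"
    using assms by (intro smooth_on_add) (auto intro: smooth_on_linear_compose[of "\<lambda>x. (x, 0)"]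
      smooth_on_linear_compose[of "\<lambda>x. (0, x)"])
  then show ?thesis by simp
qed

lemma smooth_on_continuous_on: "smooth_on S f \<Longrightarrow> continuous_on S f"
  unfolding smooth_on_def using Ck.simps(1) by blast

subsection \<open>Symmetry of second derivatives\<close>

text \<open>Mean value inequality on the segment from \<open>a\<close> to \<open>a + h\<close>,
  after subtracting the straight path \<open>t *\<^sub>R c\<close>.\<close>

lemma frechet_derivative_bound:
  fixes f :: "'a::real_normed_vector \<Rightarrow> 'b::real_normed_vector"
  assumes "\<And>t. t \<in> {0..1} \<Longrightarrow> f differentiable at (a + t *\<^sub>R h)"
    and "\<And>t. t \<in> {0..1} \<Longrightarrow> norm (frechet_derivative f (at (a + t *\<^sub>R h)) h - c) \<le> B"
  shows "norm (f (a + h) - f a - c) \<le> B"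
proof -
  define g where "g t = f (a + t *\<^sub>R h) - t *\<^sub>R c" for t
  have g: "(g has_derivative (\<lambda>s. s *\<^sub>R (frechet_derivative f (at (a + t *\<^sub>R h)) h - c))) (at t within {0..1})"
    if "t \<in> {0..1}" for t
  proof -
    have f: "(f has_derivative frechet_derivative f (at (a + t *\<^sub>R h))) (at (a + t *\<^sub>R h))"
      using assms(1)[OF that] has_derivative_frechet by blast
    have l: "((\<lambda>t. a + t *\<^sub>R h) has_derivative (\<lambda>s. s *\<^sub>R h)) (at t)"
      by (auto intro!: derivative_eq_intros)
    have "((\<lambda>t. f (a + t *\<^sub>R h)) has_derivative (\<lambda>s. frechet_derivative f (at (a + t *\<^sub>R h)) (s *\<^sub>R h))) (at t)"
      using has_derivative_compose[OF l f] .
    then have "(g has_derivative (\<lambda>s. frechet_derivative f (at (a + t *\<^sub>R h)) (s *\<^sub>R h) - s *\<^sub>R c)) (at t)"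
      unfolding g_def by (auto intro!: derivative_eq_intros)
    then show ?thesis
      using linear_frechet_derivative[OF assms(1)[OF that]]
      by (simp add: linear_scale scaleR_diff_right has_derivative_at_withinI)
  qed
  have o: "onorm (\<lambda>s. s *\<^sub>R (frechet_derivative f (at (a + t *\<^sub>R h)) h - c)) \<le> B" if "t \<in> {0..1}" for t
    using mult_left_mono[OF assms(2)[OF that]] by (intro onorm_le) (simp add: mult.commute[of B])
  have "norm (g 1 - g 0) \<le> B * norm (1 - 0 :: real)"
    by (rule differentiable_bound[of "{0..1}", OF _ g o]) auto
  then show ?thesis by (simp add: g_def algebra_simps)
qed

text \<open>Two nested mean value estimates: in direction \<open>v\<close> for the difference
  \<open>g y = f (u + y) - f y\<close>, then in direction \<open>u\<close> for
  \<open>dir_deriv f v\<close>.\<close>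

lemma second_difference_bound:
  fixes f :: "'a::real_normed_vector \<Rightarrow> 'b::real_normed_vector"
  assumes S: "open S" "smooth_on S f"
    and in_S: "\<And>a b. a \<in> {0..1} \<Longrightarrow> b \<in> {0..1} \<Longrightarrow> x + a *\<^sub>R u + b *\<^sub>R v \<in> S"
    and bd: "\<And>a b. a \<in> {0..1} \<Longrightarrow> b \<in> {0..1} \<Longrightarrow>
      norm (dir_deriv (dir_deriv f v) u (x + a *\<^sub>R u + b *\<^sub>R v) - c) \<le> B"
  shows "norm (f (x + u + v) - f (x + u) - f (x + v) + f x - c) \<le> B"
proof -
  define g where "g y = f (u + y) - f y" for y
  have tr: "(\<lambda>y. f (u + y)) differentiable at y"
      "frechet_derivative (\<lambda>y. f (u + y)) (at y) = frechet_derivative f (at (u + y))"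
    if "u + y \<in> S" for y
  proof -
    have 1: "((\<lambda>y. u + y) has_derivative (\<lambda>h. h)) (at y)"
      by (auto intro!: derivative_eq_intros)
    have "(f has_derivative frechet_derivative f (at (u + y))) (at (u + y))"
      using S that smooth_on_differentiable has_derivative_frechet by blast
    from has_derivative_compose[OF 1 this]
    show "(\<lambda>y. f (u + y)) differentiable at y"
      "frechet_derivative (\<lambda>y. f (u + y)) (at y) = frechet_derivative f (at (u + y))"
      using frechet_derivative_at differentiable_def by (blast, metis)
  qed
  have f_diff: "f differentiable at y" if "y \<in> S" for y
    using S that smooth_on_differentiable by blast
  have inS1: "x + b *\<^sub>R v \<in> S" if "b \<in> {0..1}" for b
    using in_S[of 0 b] that by simp
  have inS2: "u + (x + b *\<^sub>R v) \<in> S" if "b \<in> {0..1}" for b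
    using in_S[of 1 b] that by (simp add: algebra_simps)
  have g_diff: "g differentiable at (x + b *\<^sub>R v)" if "b \<in> {0..1}" for b
    unfolding g_def using tr(1)[OF inS2] f_diff[OF inS1] that by (intro differentiable_diff) auto
  have g': "frechet_derivative g (at (x + b *\<^sub>R v)) v
      = dir_deriv f v (x + b *\<^sub>R v + u) - dir_deriv f v (x + b *\<^sub>R v)" if b: "b \<in> {0..1}" for b
  proof -
    have "(g has_derivative (\<lambda>h. frechet_derivative (\<lambda>y. f (u + y)) (at (x + b *\<^sub>R v)) h
        - frechet_derivative f (at (x + b *\<^sub>R v)) h)) (at (x + b *\<^sub>R v))"
      unfolding g_def using tr(1)[OF inS2[OF b]] f_diff[OF inS1[OF b]]
      by (intro has_derivative_diff has_derivative_frechet) auto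
    from frechet_derivative_at[OF this] tr(2)[OF inS2[OF b]] show ?thesis
      by (metis add.commute)
  qed
  have "norm (g (x + v) - g x - c) \<le> B"
  proof (rule frechet_derivative_bound)
    fix b :: real assume b: "b \<in> {0..1}"
    show "g differentiable at (x + b *\<^sub>R v)"
      using g_diff b .
    have "norm (dir_deriv f v (x + b *\<^sub>R v + u) - dir_deriv f v (x + b *\<^sub>R v) - c) \<le> B"
    proof (rule frechet_derivative_bound)
      fix a :: real assume a: "a \<in> {0..1}"
      have eq: "x + b *\<^sub>R v + a *\<^sub>R u = x + a *\<^sub>R u + b *\<^sub>R v" by simp
      show "dir_deriv f v differentiable at (x + b *\<^sub>R v + a *\<^sub>R u)"
        unfolding eq
        using S in_S[OF a b] smooth_on_dir_deriv smooth_on_differentiable by blast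
      show "norm (dir_deriv (dir_deriv f v) u (x + b *\<^sub>R v + a *\<^sub>R u) - c) \<le> B"
        unfolding eq using bd[OF a b] .
    qed
    then show "norm (frechet_derivative g (at (x + b *\<^sub>R v)) v - c) \<le> B"
      using g'[OF b] by simp
  qed
  then show ?thesis by (simp add: g_def algebra_simps)
qed

lemma frechet_derivative_scale_dir:
  assumes "open S" "\<And>y. y \<in> S \<Longrightarrow> f differentiable at y" "x \<in> S" "dir_deriv f v differentiable at x"
  shows "frechet_derivative (dir_deriv f (t *\<^sub>R v)) (at x) = (\<lambda>u. t *\<^sub>R dir_deriv (dir_deriv f v) u x)"
proof -
  have "((\<lambda>y. t *\<^sub>R dir_deriv f v y) has_derivative (\<lambda>u. t *\<^sub>R dir_deriv (dir_deriv f v) u x)) (at x)"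
    using assms(4) has_derivative_frechet by (intro derivative_eq_intros) auto
  then have "(dir_deriv f (t *\<^sub>R v) has_derivative (\<lambda>u. t *\<^sub>R dir_deriv (dir_deriv f v) u x)) (at x)"
    using assms(1,3) linear_frechet_derivative[OF assms(2)]
    by (elim has_derivative_transform_within_open) (auto simp: linear_scale)
  then show ?thesis using frechet_derivative_at by metis
qed

text \<open>The second difference of \<open>f\<close> over the parallelogram spanned by
  \<open>t *\<^sub>R u\<close> and \<open>t *\<^sub>R v\<close> is symmetric in \<open>u\<close> and
  \<open>v\<close>, and by continuity it is within \<open>t * t * e\<close> of \<open>t * t\<close>
  times either mixed derivative. Dividing by \<open>t * t\<close> bounds their distance by
  \<open>2 * e\<close>.\<close>

lemma dir_deriv_commute:
  fixes f :: "'a::real_normed_vector \<Rightarrow> 'b::real_normed_vector"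
  assumes S: "open S" "smooth_on S f" "x \<in> S"
  shows "dir_deriv (dir_deriv f v) u x = dir_deriv (dir_deriv f u) v x"
proof -
  have main: "norm (dir_deriv (dir_deriv f v) u x - dir_deriv (dir_deriv f u) v x) \<le> 2 * e" if e: "e > 0" for e
  proof -
    define D where "D v u = dir_deriv (dir_deriv f v) u" for v u
    have D: "smooth_on S (D v u)" for v u
      unfolding D_def using S smooth_on_dir_deriv by blast
    have "\<exists>d>0. \<forall>y. dist y x < d \<longrightarrow> y \<in> S \<and> norm (D v u y - D v u x) < e" for v u
    proof -
      have "isCont (D v u) x"
        using D S continuous_on_eq_continuous_at smooth_on_continuous_on by blast
      then obtain d1 where d1: "d1 > 0" "\<And>y. dist y x < d1 \<Longrightarrow> dist (D v u y) (D v u x) < e"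
        using e unfolding continuous_at_eps_delta by metis
      obtain d2 where d2: "d2 > 0" "\<And>y. dist y x < d2 \<Longrightarrow> y \<in> S"
        using S unfolding open_dist by metis
      show ?thesis
        using d1 d2 by (intro exI[of _ "min d1 d2"]) (auto simp: dist_norm)
    qed
    from this[of v u] this[of u v] obtain d1 d2 where
      d1: "d1 > 0" "\<And>y. dist y x < d1 \<Longrightarrow> y \<in> S \<and> norm (D v u y - D v u x) < e" and
      d2: "d2 > 0" "\<And>y. dist y x < d2 \<Longrightarrow> y \<in> S \<and> norm (D u v y - D u v x) < e" by metis
    define d where "d = min d1 d2"
    \<comment> \<open>Chosen so that \<open>t * (norm u + norm v + 1) = d / 2\<close>, which keeps
      the parallelogram inside the ball of radius \<open>d\<close>; the summand 1 avoids division by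
      zero when both directions vanish.\<close>
    define t where "t = d / (2 * (norm u + norm v + 1))"
    have pos: "norm u + norm v + 1 > 0"
      using norm_ge_zero[of u] norm_ge_zero[of v] by linarith
    have t: "t > 0" "t * (norm u + norm v) < d"
    proof -
      have dpos: "d > 0" using d1 d2 by (simp add: d_def)
      then show "t > 0" using pos by (simp add: t_def)
      have "t * (norm u + norm v) \<le> t * (norm u + norm v + 1)"
        using \<open>t > 0\<close> by (simp add: mult_left_mono)
      also have "\<dots> = d / 2" using pos by (simp add: t_def field_simps)
      finally show "t * (norm u + norm v) < d" using dpos by linarith
    qed
    have near: "dist (x + a *\<^sub>R (t *\<^sub>R u) + b *\<^sub>R (t *\<^sub>R v)) x < d"
      if "a \<in> {0..1}" "b \<in> {0..1}" for a b
    proof -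
      have "norm (a *\<^sub>R (t *\<^sub>R u) + b *\<^sub>R (t *\<^sub>R v)) \<le> norm (a *\<^sub>R (t *\<^sub>R u)) + norm (b *\<^sub>R (t *\<^sub>R v))"
        by (rule norm_triangle_ineq)
      also have "\<dots> \<le> t * norm u + t * norm v"
        using that t by (auto intro!: add_mono mult_left_le_one_le)
      also have "\<dots> < d" using t by (simp add: algebra_simps)
      finally show ?thesis by (simp add: dist_norm add.assoc)
    qed
    have sc: "dir_deriv (dir_deriv f (t *\<^sub>R v)) (t *\<^sub>R u) y = (t * t) *\<^sub>R D v u y" if y: "y \<in> S" for v u y
    proof -
      have "dir_deriv f v differentiable at y"
        using S y smooth_on_dir_deriv smooth_on_differentiable by blast
      moreover from this have "linear (frechet_derivative (dir_deriv f v) (at y))"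
        by (rule linear_frechet_derivative)
      moreover have "\<And>y. y \<in> S \<Longrightarrow> f differentiable at y"
        using S smooth_on_differentiable by blast
      ultimately show ?thesis
        using frechet_derivative_scale_dir[of S f y v t] S y by (simp add: D_def linear_scale)
    qed
    let ?\<Delta> = "f (x + t *\<^sub>R u + t *\<^sub>R v) - f (x + t *\<^sub>R u) - f (x + t *\<^sub>R v) + f x"
    have A: "norm (?\<Delta> - (t * t) *\<^sub>R D v u x) \<le> t * t * e"
    proof (rule second_difference_bound[OF S(1,2)])
      fix a b :: real assume ab: "a \<in> {0..1}" "b \<in> {0..1}"
      let ?y = "x + a *\<^sub>R (t *\<^sub>R u) + b *\<^sub>R (t *\<^sub>R v)"
      have y: "?y \<in> S" "norm (D v u ?y - D v u x) < e"
        using near[OF ab] d1(2) by (auto simp: d_def)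
      then show "?y \<in> S" by blast
      have "norm ((t * t) *\<^sub>R (D v u ?y - D v u x)) \<le> t * t * e"
        using y(2) t by (simp add: mult_left_mono)
      then show "norm (dir_deriv (dir_deriv f (t *\<^sub>R v)) (t *\<^sub>R u) ?y - (t * t) *\<^sub>R D v u x) \<le> t * t * e"
        by (simp only: sc[OF y(1)] scaleR_diff_right)
    qed
    have B: "norm (f (x + t *\<^sub>R v + t *\<^sub>R u) - f (x + t *\<^sub>R v) - f (x + t *\<^sub>R u) + f x - (t * t) *\<^sub>R D u v x)
        \<le> t * t * e"
    proof (rule second_difference_bound[OF S(1,2)])
      fix b a :: real assume ab: "b \<in> {0..1}" "a \<in> {0..1}"
      let ?y = "x + b *\<^sub>R (t *\<^sub>R v) + a *\<^sub>R (t *\<^sub>R u)"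
      have eq: "?y = x + a *\<^sub>R (t *\<^sub>R u) + b *\<^sub>R (t *\<^sub>R v)" by simp
      have y: "?y \<in> S" "norm (D u v ?y - D u v x) < e"
        using near[OF ab(2,1)] d2(2) unfolding eq by (auto simp: d_def)
      then show "?y \<in> S" by blast
      have "norm ((t * t) *\<^sub>R (D u v ?y - D u v x)) \<le> t * t * e"
        using y(2) t by (simp add: mult_left_mono)
      then show "norm (dir_deriv (dir_deriv f (t *\<^sub>R u)) (t *\<^sub>R v) ?y - (t * t) *\<^sub>R D u v x) \<le> t * t * e"
        by (simp only: sc[OF y(1)] scaleR_diff_right)
    qed
    have eq: "f (x + t *\<^sub>R v + t *\<^sub>R u) - f (x + t *\<^sub>R v) - f (x + t *\<^sub>R u) + f x = ?\<Delta>"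
      by (simp add: algebra_simps)
    have "norm ((t * t) *\<^sub>R (D v u x - D u v x))
        = norm ((?\<Delta> - (t * t) *\<^sub>R D u v x) - (?\<Delta> - (t * t) *\<^sub>R D v u x))"
      by (simp add: algebra_simps)
    also have "\<dots> \<le> t * t * e + t * t * e"
      using A B unfolding eq by (meson add_mono norm_triangle_le_diff order_trans)
    finally have "t * t * norm (D v u x - D u v x) \<le> t * t * (2 * e)"
      by (simp add: mult_ac)
    then show ?thesis using t by (simp add: D_def mult_le_cancel_left_pos)
  qed
  have "norm (dir_deriv (dir_deriv f v) u x - dir_deriv (dir_deriv f u) v x) \<le> 0"
  proof (rule field_le_epsilon)
    fix e :: real assume "e > 0"
    then show "norm (dir_deriv (dir_deriv f v) u x - dir_deriv (dir_deriv f u) v x) \<le> 0 + e"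
      using main[of "e / 2"] by simp
  qed
  then show ?thesis by simp
qed

subsection \<open>The derivative of a smooth map as a map into the space of bounded operators\<close>

text \<open>Banach-Steinhaus from Baire's theorem: the closed sets \<open>A n\<close> cover the
  complete space, so some \<open>A n\<close> contains a ball of radius \<open>r\<close>. The points
  \<open>a\<close> and \<open>a + s *\<^sub>R x\<close> with \<open>s = r / (2 * norm x)\<close> lie
  in it, and the difference of their images has norm at most \<open>2 * n\<close>; this is the
  origin of the constant \<open>4 * n / r\<close>.\<close>

lemma uniform_boundedness:
  fixes T :: "'i \<Rightarrow> 'a::banach \<Rightarrow> 'b::real_normed_vector"
  assumes T: "\<And>i. i \<in> I \<Longrightarrow> bounded_linear (T i)"
    and bd: "\<And>x. \<exists>C. \<forall>i\<in>I. norm (T i x) \<le> C"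
  shows "\<exists>C. \<forall>i\<in>I. \<forall>x. norm (T i x) \<le> C * norm x"
proof -
  define A where "A n = (\<Inter>i\<in>I. {x. norm (T i x) \<le> real n})" for n
  have cl: "closed (A n)" for n
    unfolding A_def
    by (intro closed_INT ballI closed_Collect_le continuous_on_norm linear_continuous_on T continuous_on_const)
  have "x \<in> (\<Union>n. A n)" for x
  proof -
    obtain C where C: "\<forall>i\<in>I. norm (T i x) \<le> C" using bd by blast
    obtain n where "C \<le> real n" using real_arch_simple by blast
    with C have "x \<in> A n" by (force simp: A_def)
    then show ?thesis by blast
  qed
  then have UN: "\<Union>(range A) = UNIV" by blast
  have "\<exists>n. interior (A n) \<noteq> {}"
  proof (rule ccontr)
    assume "\<not> (\<exists>n. interior (A n) \<noteq> {})"
    then have "euclidean interior_of (\<Union>(range A)) = {}"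
      using cl completely_metrizable_space_euclidean by (intro Baire_category_alt) auto
    then show False by (simp add: UN)
  qed
  then obtain n a where "a \<in> interior (A n)" by blast
  then obtain r where r: "r > 0" "ball a r \<subseteq> A n"
    using mem_interior by blast
  have "norm (T i x) \<le> (4 * real n / r) * norm x" if i: "i \<in> I" for i x
  proof (cases "x = 0")
    case True
    then show ?thesis using T[OF i] by (simp add: linear_simps)
  next
    case False
    interpret bounded_linear "T i" using T[OF i] .
    define s where "s = r / (2 * norm x)"
    have s: "s > 0" using r False by (simp add: s_def)
    have "a + s *\<^sub>R x \<in> ball a r" "a \<in> ball a r"
      using r False by (auto simp: dist_norm s_def)
    then have "a + s *\<^sub>R x \<in> A n" "a \<in> A n"
      using r by blast+
    then have "norm (T i (a + s *\<^sub>R x)) \<le> n" "norm (T i a) \<le> n"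
      using i by (auto simp: A_def)
    then have "norm (T i (a + s *\<^sub>R x) - T i a) \<le> 2 * n"
      using norm_triangle_ineq4[of "T i (a + s *\<^sub>R x)" "T i a"] by linarith
    then have "s * norm (T i x) \<le> 2 * n"
      using s by (simp add: add scaleR)
    then show ?thesis
      using s r False by (simp add: s_def field_simps)
  qed
  then show ?thesis by blast
qed

text \<open>For fixed \<open>x\<close> the linear case bounds the family on the unit ball of the
  second argument. That ball is then adjoined to the index set and the linear case is applied again,
  now in the first argument.\<close>

lemma uniform_boundedness_bilinear:
  fixes T :: "'i \<Rightarrow> 'a::banach \<Rightarrow> 'b::banach \<Rightarrow> 'c::real_normed_vector"
  assumes l: "\<And>i y. i \<in> I \<Longrightarrow> bounded_linear (\<lambda>x. T i x y)"
    and r: "\<And>i x. i \<in> I \<Longrightarrow> bounded_linear (T i x)"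
    and bd: "\<And>x y. \<exists>C. \<forall>i\<in>I. norm (T i x y) \<le> C"
  shows "\<exists>C. \<forall>i\<in>I. \<forall>x y. norm (T i x y) \<le> C * norm x * norm y"
proof -
  have 1: "\<exists>C. \<forall>i\<in>I. \<forall>y. norm (T i x y) \<le> C * norm y" for x
    using uniform_boundedness[of I "\<lambda>i. T i x"] r bd by blast
  let ?J = "I \<times> {y :: 'b. norm y \<le> 1}"
  have "\<exists>C. \<forall>j\<in>?J. \<forall>x. norm (T (fst j) x (snd j)) \<le> C * norm x"
  proof (rule uniform_boundedness)
    show "bounded_linear (\<lambda>x. T (fst j) x (snd j))" if "j \<in> ?J" for j
      using l that by auto
    fix x
    obtain C where C: "\<forall>i\<in>I. \<forall>y. norm (T i x y) \<le> C * norm y" using 1 by blast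
    have "norm (T i x y) \<le> \<bar>C\<bar>" if "i \<in> I" "norm y \<le> 1" for i y
    proof -
      have "norm (T i x y) \<le> C * norm y" using C that by blast
      also have "\<dots> \<le> \<bar>C\<bar> * 1" using that by (intro mult_mono) auto
      finally show ?thesis by simp
    qed
    then show "\<exists>C. \<forall>j\<in>?J. norm (T (fst j) x (snd j)) \<le> C" by force
  qed
  then obtain C where C: "\<And>i x y. i \<in> I \<Longrightarrow> norm y \<le> 1 \<Longrightarrow> norm (T i x y) \<le> C * norm x" by auto
  have "norm (T i x y) \<le> C * norm x * norm y" if i: "i \<in> I" for i x y
  proof (cases "y = 0")
    case True
    then show ?thesis using r[OF i] by (simp add: linear_simps)
  next
    case False
    interpret bounded_linear "T i x" using r[OF i] .
    have "norm (T i x ((1 / norm y) *\<^sub>R y)) \<le> C * norm x"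
      using C[OF i] False by simp
    then show ?thesis using False by (simp add: scaleR field_simps)
  qed
  then show ?thesis by blast
qed

text \<open>The middle argument, restricted to the unit ball, joins the index set, which leaves the
  bilinear case in the two outer arguments.\<close>

lemma uniform_boundedness_trilinear:
  fixes T :: "'i \<Rightarrow> 'a::banach \<Rightarrow> 'b::banach \<Rightarrow> 'c::banach \<Rightarrow> 'd::real_normed_vector"
  assumes l: "\<And>i y z. i \<in> I \<Longrightarrow> bounded_linear (\<lambda>x. T i x y z)"
    and m: "\<And>i x z. i \<in> I \<Longrightarrow> bounded_linear (\<lambda>y. T i x y z)"
    and r: "\<And>i x y. i \<in> I \<Longrightarrow> bounded_linear (T i x y)"
    and bd: "\<And>x y z. \<exists>C. \<forall>i\<in>I. norm (T i x y z) \<le> C"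
  shows "\<exists>C. \<forall>i\<in>I. \<forall>x y z. norm (T i x y z) \<le> C * norm x * norm y * norm z"
proof -
  have 1: "\<exists>C. \<forall>i\<in>I. \<forall>y. norm (T i x y z) \<le> C * norm y" for x z
    using uniform_boundedness[of I "\<lambda>i y. T i x y z"] m bd by blast
  let ?J = "I \<times> {y :: 'b. norm y \<le> 1}"
  have "\<exists>C. \<forall>j\<in>?J. \<forall>x z. norm (T (fst j) x (snd j) z) \<le> C * norm x * norm z"
  proof (rule uniform_boundedness_bilinear)
    show "bounded_linear (\<lambda>x. T (fst j) x (snd j) y)" if "j \<in> ?J" for j y
      using l that by auto
    show "bounded_linear (T (fst j) x (snd j))" if "j \<in> ?J" for j x
      using r that by auto
    fix x z
    obtain C where C: "\<forall>i\<in>I. \<forall>y. norm (T i x y z) \<le> C * norm y" using 1 by blast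
    have "norm (T i x y z) \<le> \<bar>C\<bar>" if "i \<in> I" "norm y \<le> 1" for i y
    proof -
      have "norm (T i x y z) \<le> C * norm y" using C that by blast
      also have "\<dots> \<le> \<bar>C\<bar> * 1" using that by (intro mult_mono) auto
      finally show ?thesis by simp
    qed
    then show "\<exists>C. \<forall>j\<in>?J. norm (T (fst j) x (snd j) z) \<le> C" by force
  qed
  then obtain C where C: "\<And>i x y z. i \<in> I \<Longrightarrow> norm y \<le> 1 \<Longrightarrow> norm (T i x y z) \<le> C * norm x * norm z"
    by fastforce
  have "norm (T i x y z) \<le> C * norm x * norm y * norm z" if i: "i \<in> I" for i x y z
  proof (cases "y = 0")
    case True
    then show ?thesis using linear_0[OF bounded_linear.linear[OF m[OF i]]] by simp
  next
    case False
    interpret bounded_linear "\<lambda>y. T i x y z" using m[OF i] .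
    have "norm (T i x ((1 / norm y) *\<^sub>R y) z) \<le> C * norm x * norm z"
      using C[OF i] False by simp
    then show ?thesis using False by (simp add: scaleR field_simps)
  qed
  then show ?thesis by blast
qed

text \<open>Continuity is known only for each fixed triple of directions, so the neighbourhood on
  which a bound holds could depend on the triple. Along a sequence converging to \<open>x\<close>,
  however, each triple gives a convergent and hence bounded sequence, and uniform boundedness
  applies. If no common bound existed near \<open>x\<close>, points \<open>y n\<close> violating the
  bound \<open>n\<close> would form such a sequence.\<close>

lemma smooth_on_third_derivative_bound:
  fixes f :: "'a::banach \<Rightarrow> 'b::real_normed_vector"
  assumes S: "open S" "smooth_on S f" "x \<in> S"
  shows "\<exists>d>0. \<exists>C. \<forall>y\<in>ball x d. \<forall>u v w.
    norm (dir_deriv (dir_deriv (dir_deriv f u) v) w y) \<le> C * norm u * norm v * norm w"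
proof (rule ccontr)
  assume neg: "\<not> ?thesis"
  define D where "D u v w = dir_deriv (dir_deriv (dir_deriv f u) v) w" for u v w
  obtain d0 where d0: "d0 > 0" "ball x d0 \<subseteq> S"
    using S open_contains_ball by blast
  have "\<exists>y. y \<in> ball x (min d0 (1 / real (Suc n))) \<and>
      (\<exists>u v w. norm (D u v w y) > real n * norm u * norm v * norm w)" for n
  proof -
    have "min d0 (1 / real (Suc n)) > 0" using d0 by simp
    with neg have "\<not> (\<forall>y\<in>ball x (min d0 (1 / real (Suc n))). \<forall>u v w. norm (D u v w y) \<le> real n * norm u * norm v * norm w)"
      unfolding D_def by blast
    then show ?thesis by (metis Int_iff ball_min_Int not_le)
  qed
  then obtain y where y: "\<And>n. y n \<in> ball x (min d0 (1 / real (Suc n)))"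
    "\<And>n. \<exists>u v w. norm (D u v w (y n)) > real n * norm u * norm v * norm w"
    by metis
  have yS: "y n \<in> S" for n
    using y(1)[of n] d0 by auto
  have "(\<lambda>n. dist (y n) x) \<longlonglongrightarrow> 0"
  proof (rule tendsto_sandwich[of "\<lambda>n. 0" _ _ "\<lambda>n. 1 / real (Suc n)"])
    show "\<forall>\<^sub>F n in sequentially. dist (y n) x \<le> 1 / real (Suc n)"
      using y(1) by (auto intro!: always_eventually less_imp_le simp: dist_commute)
    show "(\<lambda>n. 1 / real (Suc n)) \<longlonglongrightarrow> 0"
      using LIMSEQ_inverse_real_of_nat by (simp add: inverse_eq_divide)
  qed auto
  then have lim: "y \<longlonglongrightarrow> x"
    using tendsto_dist_iff by blast
  have sm: "smooth_on S (D u v w)" for u v w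
    unfolding D_def by (intro smooth_on_dir_deriv[OF S(1)] S(2))
  have bl: "bounded_linear (\<lambda>w. D u v w (y n))" for u v n
    unfolding D_def
    by (intro bounded_linear_frechet_derivative smooth_on_differentiable[OF S(1)]
        smooth_on_dir_deriv[OF S(1)] S(2) yS)
  \<comment> \<open>A Frechet derivative is linear in the direction taken last. The exchanges
    \<open>D1\<close> and \<open>D2\<close> move either of the other directions to that place, which
    gives linearity in all three.\<close>
  have D1: "D u v w (y n) = D u w v (y n)" for u v w n
    unfolding D_def by (intro dir_deriv_commute[OF S(1)] smooth_on_dir_deriv[OF S(1)] S(2) yS)
  have D2: "D u v w (y n) = D v u w (y n)" for u v w n
  proof -
    have "frechet_derivative (dir_deriv (dir_deriv f u) v) (at (y n))
        = frechet_derivative (dir_deriv (dir_deriv f v) u) (at (y n))"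
    proof (rule frechet_derivative_transform_within_open[OF _ S(1) yS])
      show "dir_deriv (dir_deriv f u) v differentiable at (y n)"
        by (intro smooth_on_differentiable[OF S(1)] smooth_on_dir_deriv[OF S(1)] S(2) yS)
    qed (rule dir_deriv_commute[OF S(1,2)])
    then show ?thesis by (simp add: D_def)
  qed
  have "\<exists>C. \<forall>n\<in>UNIV. \<forall>u v w. norm (D u v w (y n)) \<le> C * norm u * norm v * norm w"
  proof (rule uniform_boundedness_trilinear)
    show "bounded_linear (\<lambda>w. D u v w (y n))" for u v n by (rule bl)
    show "bounded_linear (\<lambda>v. D u v w (y n))" for u w n
      using bl[of u w n] by (simp add: D1[of u _ w])
    show "bounded_linear (\<lambda>u. D u v w (y n))" for v w n
      using bl[of v w n] by (simp add: D2[of _ v] D1[of v _ w])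
    fix u v w
    have "isCont (D u v w) x"
      using sm S continuous_on_eq_continuous_at smooth_on_continuous_on by blast
    then have "(\<lambda>n. D u v w (y n)) \<longlonglongrightarrow> D u v w x"
      using lim isCont_tendsto_compose by blast
    then have "Bseq (\<lambda>n. D u v w (y n))"
      using convergentI convergent_imp_Bseq by blast
    then show "\<exists>C. \<forall>n\<in>UNIV. norm (D u v w (y n)) \<le> C"
      by (auto simp: Bseq_def)
  qed
  then obtain C where C: "\<And>n u v w. norm (D u v w (y n)) \<le> C * norm u * norm v * norm w"
    by auto
  obtain n where "C \<le> real n" using real_arch_simple by blast
  obtain u v w where "norm (D u v w (y n)) > real n * norm u * norm v * norm w"
    using y(2) by blast
  moreover have "C * norm u * norm v * norm w \<le> real n * norm u * norm v * norm w"
    using \<open>C \<le> real n\<close> by (intro mult_right_mono) auto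
  ultimately show False
    using C[of u v w n] by linarith
qed

definition Bderiv :: "('a::real_normed_vector \<Rightarrow> 'b::real_normed_vector) \<Rightarrow> 'a \<Rightarrow> 'a \<Rightarrow>\<^sub>L 'b" where
  "Bderiv f x = Blinfun (frechet_derivative f (at x))"

lemma Bderiv_apply:
  "f differentiable at x \<Longrightarrow> blinfun_apply (Bderiv f x) = frechet_derivative f (at x)"
  by (simp add: Bderiv_def bounded_linear_Blinfun_apply bounded_linear_frechet_derivative)

lemma has_derivative_Bderiv:
  "f differentiable at x \<Longrightarrow> (f has_derivative Bderiv f x) (at x)"
  by (simp add: Bderiv_apply has_derivative_frechet)

lemma smooth_on_has_derivative:
  "open S \<Longrightarrow> smooth_on S f \<Longrightarrow> x \<in> S \<Longrightarrow> (f has_derivative Bderiv f x) (at x)"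
  using has_derivative_Bderiv smooth_on_differentiable by blast

text \<open>The third derivative bounds the error of the linear approximation to the first one.\<close>

lemma has_derivative_Bderiv_smooth:
  fixes f :: "'a::banach \<Rightarrow> 'b::real_normed_vector"
  assumes S: "open S" "smooth_on S f" "x \<in> S"
  shows "(Bderiv f has_derivative (\<lambda>h. Bderiv (dir_deriv f h) x)) (at x)"
proof -
  obtain d1 C0 where d1: "d1 > 0" and C0: "\<And>y u v w. y \<in> ball x d1 \<Longrightarrow>
      norm (dir_deriv (dir_deriv (dir_deriv f u) v) w y) \<le> C0 * norm u * norm v * norm w"
    using smooth_on_third_derivative_bound[OF S] by blast
  obtain d2 where d2: "d2 > 0" "ball x d2 \<subseteq> S"
    using S open_contains_ball by blast
  define d C where "d = min d1 d2" and "C = \<bar>C0\<bar>"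
  have d: "d > 0" "ball x d \<subseteq> S" "C \<ge> 0"
    using d1 d2 by (auto simp: d_def C_def)
  have diff0: "f differentiable at y" and diff1: "dir_deriv f u differentiable at y"
    and diff2: "dir_deriv (dir_deriv f u) v differentiable at y" if "y \<in> S" for y u v
    using that by (intro smooth_on_differentiable[OF S(1)] smooth_on_dir_deriv[OF S(1)] S(2); assumption)+
  have C: "norm (dir_deriv (dir_deriv (dir_deriv f u) v) w y) \<le> C * norm u * norm v * norm w"
    if "y \<in> ball x d" for y u v w
  proof -
    have "norm (dir_deriv (dir_deriv (dir_deriv f u) v) w y) \<le> C0 * norm u * norm v * norm w"
      using C0 that by (auto simp: d_def)
    also have "\<dots> \<le> C * norm u * norm v * norm w"
      by (intro mult_right_mono) (auto simp: C_def)
    finally show ?thesis .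
  qed
  have D1: "Bderiv f y v = dir_deriv f v y" if "y \<in> S" for y v
    using Bderiv_apply diff0 that by metis
  have D2: "Bderiv (dir_deriv f u) y v = dir_deriv (dir_deriv f v) u y" if "y \<in> S" for y u v
    using Bderiv_apply[OF diff1[OF that]] dir_deriv_commute[OF S(1,2) that] by metis
  \<comment> \<open>The mean value inequality with the third-derivative bound makes second
    derivatives Lipschitz near \<open>x\<close>, with a constant proportional to the norms of the
    two directions.\<close>
  have second: "norm (dir_deriv (dir_deriv f u) v y - dir_deriv (dir_deriv f u) v x)
      \<le> C * norm u * norm v * norm (y - x)" if y: "y \<in> ball x d" for y u v
  proof (rule differentiable_bound[of "ball x d"])
    fix z assume z: "z \<in> ball x d"
    then have "z \<in> S" using d by blast
    then show "(dir_deriv (dir_deriv f u) v has_derivative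
        frechet_derivative (dir_deriv (dir_deriv f u) v) (at z)) (at z within ball x d)"
      using diff2 has_derivative_frechet has_derivative_at_withinI by blast
    show "onorm (frechet_derivative (dir_deriv (dir_deriv f u) v) (at z)) \<le> C * norm u * norm v"
      using C[OF z] d(3) by (intro onorm_bound) auto
  qed (use y d in auto)
  have first: "norm (Bderiv f y - Bderiv f x - Bderiv (dir_deriv f (y - x)) x)
      \<le> C * norm (y - x) * norm (y - x)" if y: "y \<in> ball x d" for y
  proof (rule norm_blinfun_bound)
    show "0 \<le> C * norm (y - x) * norm (y - x)" using d by simp
    fix v
    have "norm (dir_deriv f v (x + (y - x)) - dir_deriv f v x - dir_deriv (dir_deriv f v) (y - x) x)
        \<le> C * norm (y - x) * norm (y - x) * norm v"
    proof (rule frechet_derivative_bound)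
      fix t :: real assume t: "t \<in> {0..1}"
      let ?z = "x + t *\<^sub>R (y - x)"
      have tn: "t * norm (y - x) \<le> norm (y - x)"
        using t by (simp add: mult_left_le_one_le)
      then have z: "?z \<in> ball x d"
        using y t by (simp add: dist_norm norm_minus_commute)
      then have "?z \<in> S" using d by blast
      then show "dir_deriv f v differentiable at ?z" by (rule diff1)
      have "norm (dir_deriv (dir_deriv f v) (y - x) ?z - dir_deriv (dir_deriv f v) (y - x) x)
          \<le> C * norm v * norm (y - x) * norm (?z - x)"
        by (rule second[OF z])
      also have "\<dots> \<le> C * norm v * norm (y - x) * norm (y - x)"
        using tn t d by (intro mult_left_mono) auto
      finally show "norm (dir_deriv (dir_deriv f v) (y - x) ?z - dir_deriv (dir_deriv f v) (y - x) x)
          \<le> C * norm (y - x) * norm (y - x) * norm v"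
        by (simp add: mult_ac)
    qed
    moreover have "y \<in> S" using y d by blast
    ultimately show "norm ((Bderiv f y - Bderiv f x - Bderiv (dir_deriv f (y - x)) x) v)
        \<le> C * norm (y - x) * norm (y - x) * norm v"
      using D1 D2[OF S(3)] S(3) by (simp add: blinfun.diff_left)
  qed
  have lin: "bounded_linear (\<lambda>h. Bderiv (dir_deriv f h) x)"
  proof -
    \<comment> \<open>With a one-element index set, uniform boundedness says that a separately
      continuous bilinear map is jointly bounded. Hence the candidate derivative is bounded in
      operator norm.\<close>
    have "\<exists>K. \<forall>i\<in>(UNIV::unit set). \<forall>u v. norm (dir_deriv (dir_deriv f v) u x) \<le> K * norm u * norm v"
    proof (rule uniform_boundedness_bilinear)
      show "bounded_linear (\<lambda>u. dir_deriv (dir_deriv f v) u x)" for v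
        using diff1 S bounded_linear_frechet_derivative by blast
      then show "bounded_linear (\<lambda>v. dir_deriv (dir_deriv f v) u x)" for u
        by (simp add: dir_deriv_commute[OF S, of _ u])
    qed auto
    then obtain K0 where K0: "\<And>u v. norm (dir_deriv (dir_deriv f v) u x) \<le> K0 * norm u * norm v" by auto
    have K: "norm (dir_deriv (dir_deriv f v) u x) \<le> norm u * \<bar>K0\<bar> * norm v" for u v
    proof -
      have "K0 * norm u * norm v \<le> \<bar>K0\<bar> * norm u * norm v"
        by (intro mult_right_mono) auto
      with K0[of v u] show ?thesis by (simp add: mult.commute)
    qed
    show ?thesis
    proof (rule bounded_linear_intro)
      have l: "linear (frechet_derivative (dir_deriv f v) (at x))" for v
        using diff1 S linear_frechet_derivative by blast
      show "Bderiv (dir_deriv f (a + b)) x = Bderiv (dir_deriv f a) x + Bderiv (dir_deriv f b) x" for a b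
        by (rule blinfun_eqI) (simp add: D2[OF S(3)] blinfun.add_left linear_add[OF l])
      show "Bderiv (dir_deriv f (r *\<^sub>R a)) x = r *\<^sub>R Bderiv (dir_deriv f a) x" for r a
        by (rule blinfun_eqI) (simp add: D2[OF S(3)] blinfun.scaleR_left linear_scale[OF l])
      show "norm (Bderiv (dir_deriv f a) x) \<le> norm a * \<bar>K0\<bar>" for a
        using K by (intro norm_blinfun_bound) (auto simp: D2[OF S(3)])
    qed
  qed
  show ?thesis
    unfolding has_derivative_at_alt
  proof (intro conjI lin allI impI)
    fix e :: real assume e: "e > 0"
    have Cp: "C + 1 > 0" using d by simp
    show "\<exists>da>0. \<forall>y. norm (y - x) < da \<longrightarrow>
        norm (Bderiv f y - Bderiv f x - Bderiv (dir_deriv f (y - x)) x) \<le> e * norm (y - x)"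
    \<comment> \<open>The error is at most \<open>C * norm (y - x) * norm (y - x)\<close>; dividing
      by \<open>C + 1\<close> allows for \<open>C = 0\<close>.\<close>
    proof (intro exI[of _ "min d (e / (C + 1))"] conjI allI impI)
      show "min d (e / (C + 1)) > 0" using e d Cp by simp
      fix y assume y: "norm (y - x) < min d (e / (C + 1))"
      have "C * norm (y - x) \<le> (C + 1) * norm (y - x)"
        by (intro mult_right_mono) auto
      also have "\<dots> \<le> e" using y Cp by (simp add: field_simps)
      finally have "C * norm (y - x) * norm (y - x) \<le> e * norm (y - x)"
        by (intro mult_right_mono) auto
      with first[of y] y show "norm (Bderiv f y - Bderiv f x - Bderiv (dir_deriv f (y - x)) x) \<le> e * norm (y - x)"
        by (simp add: dist_norm norm_minus_commute)
    qed
  qed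
qed

text \<open>The derivative of \<open>Bderiv f\<close> in direction \<open>h\<close> is
  \<open>Bderiv (dir_deriv f h)\<close>, again the operator derivative of a smooth map. The
  induction on \<open>k\<close> therefore closes once \<open>f\<close> is generalised.\<close>

lemma smooth_on_Bderiv:
  fixes f :: "'a::banach \<Rightarrow> 'b::real_normed_vector"
  assumes "open S" "smooth_on S f"
  shows "smooth_on S (Bderiv f)"
proof -
  have "Ck k S (Bderiv f)" if "smooth_on S f" for k and f :: "'a \<Rightarrow> 'b"
    using that
  proof (induction k arbitrary: f)
    case 0
    then show ?case
      using has_derivative_Bderiv_smooth[OF assms(1)] has_derivative_continuous continuous_at_imp_continuous_on
      by (metis Ck.simps(1))
  next
    case (Suc k)
    have "Ck k S (\<lambda>y. Bderiv (dir_deriv f h) y)" for h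
      using Suc.IH[OF smooth_on_dir_deriv[OF assms(1) Suc.prems]] .
    then show ?case
      using has_derivative_Bderiv_smooth[OF assms(1) Suc.prems]
      by (auto intro!: exI[of _ "\<lambda>x h. Bderiv (dir_deriv f h) x"])
  qed
  with assms(2) show ?thesis by (simp add: smooth_on_def)
qed

lemma Bderiv_Bderiv_commute:
  fixes f :: "'a::banach \<Rightarrow> 'b::real_normed_vector"
  assumes S: "open S" "smooth_on S f" "x \<in> S"
  shows "Bderiv (Bderiv f) x u v = Bderiv (Bderiv f) x v u"
proof -
  have "blinfun_apply (Bderiv (Bderiv f) x) = (\<lambda>h. Bderiv (dir_deriv f h) x)"
    using has_derivative_Bderiv_smooth[OF S]
    by (metis Bderiv_apply differentiable_def frechet_derivative_at)
  moreover have "dir_deriv f h differentiable at x" for h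
    by (intro smooth_on_differentiable[OF S(1)] smooth_on_dir_deriv[OF S(1)] S(2,3))
  ultimately show ?thesis
    using dir_deriv_commute[OF S] by (simp add: Bderiv_apply)
qed

section \<open>Charts and tangent maps\<close>

definition cimg :: "('a, 'v) atlas \<Rightarrow> 'a \<Rightarrow> 'v set" where
  "cimg M a = coord M a ` cdom M a"

definition lrep :: "('a, 'v) atlas \<Rightarrow> ('b, 'w) atlas \<Rightarrow> 'a \<Rightarrow> 'b \<Rightarrow> ('a \<Rightarrow> 'b) \<Rightarrow> 'v \<Rightarrow> 'w" where
  "lrep M N a b f u = coord N b (f (param M a u))"

definition ldom :: "('a, 'v) atlas \<Rightarrow> ('b, 'w) atlas \<Rightarrow> 'a \<Rightarrow> 'b \<Rightarrow> ('a \<Rightarrow> 'b) \<Rightarrow> 'v set" where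
  "ldom M N a b f = {u \<in> cimg M a. f (param M a u) \<in> cdom N b}"

lemma
  assumes "smooth_manifold M"
  shows center_in_cdom: "p \<in> cdom M p"
    and open_cdom: "open (cdom M p)"
    and open_cimg: "open (cimg M p)"
    and homeomorphism_chart: "homeomorphism (cdom M p) (cimg M p) (coord M p) (param M p)"
    and smooth_transition: "smooth_on (coord M p ` (cdom M p \<inter> cdom M q)) (coord M q \<circ> param M p)"
  using assms unfolding smooth_manifold_def cimg_def by blast+

lemma param_coord: "smooth_manifold M \<Longrightarrow> p \<in> cdom M a \<Longrightarrow> param M a (coord M a p) = p"
  using homeomorphism_chart homeomorphism_apply1 by metis

lemma coord_param: "smooth_manifold M \<Longrightarrow> u \<in> cimg M a \<Longrightarrow> coord M a (param M a u) = u"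
  using homeomorphism_chart homeomorphism_apply2 by metis

lemma param_in_cdom: "smooth_manifold M \<Longrightarrow> u \<in> cimg M a \<Longrightarrow> param M a u \<in> cdom M a"
  using homeomorphism_chart homeomorphism_image2 by (metis image_eqI)

lemma coord_in_cimg: "p \<in> cdom M a \<Longrightarrow> coord M a p \<in> cimg M a"
  by (simp add: cimg_def)

lemma center_in_cimg: "smooth_manifold M \<Longrightarrow> coord M p p \<in> cimg M p"
  using center_in_cdom coord_in_cimg by metis

lemma param_center: "smooth_manifold M \<Longrightarrow> param M p (coord M p p) = p"
  using param_coord center_in_cdom by metis

lemma continuous_on_param: "smooth_manifold M \<Longrightarrow> continuous_on (cimg M a) (param M a)"
  using homeomorphism_chart unfolding homeomorphism_def by blast

lemma ldom_eq:
  assumes "smooth_manifold M"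
  shows "ldom M N a b f = coord M a ` {p \<in> UNIV \<inter> cdom M a. f p \<in> cdom N b}"
  using param_coord[OF assms] coord_in_cimg[of _ M a] param_in_cdom[OF assms] coord_param[OF assms]
  unfolding ldom_def by (force simp: image_iff)

lemma open_ldom:
  assumes M: "smooth_manifold M" and N: "smooth_manifold N" and f: "continuous_on UNIV f"
  shows "open (ldom M N a b f)"
proof -
  have "continuous_on (cimg M a) (\<lambda>u. f (param M a u))"
    using continuous_on_compose2[OF f continuous_on_param[OF M]] by simp
  then have "open (cimg M a \<inter> (\<lambda>u. f (param M a u)) -` cdom N b)"
    using open_cimg[OF M] open_cdom[OF N] by (simp add: continuous_on_open_vimage inf_commute)
  moreover have "ldom M N a b f = cimg M a \<inter> (\<lambda>u. f (param M a u)) -` cdom N b"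
    by (auto simp: ldom_def)
  ultimately show ?thesis by simp
qed

lemma smooth_map_continuous: "smooth_map M N f \<Longrightarrow> continuous_on UNIV f"
  by (simp add: smooth_map_on_def)

lemma smooth_on_lrep:
  assumes "smooth_manifold M" "smooth_map M N f"
  shows "smooth_on (ldom M N a b f) (lrep M N a b f)"
proof -
  have "lrep M N a b f = coord N b \<circ> f \<circ> param M a"
    by (auto simp: lrep_def)
  then show ?thesis
    using assms(2) unfolding smooth_map_on_def ldom_eq[OF assms(1)] by simp
qed

lemma smooth_mapI:
  assumes "smooth_manifold M" "continuous_on UNIV f" "\<And>a b. smooth_on (ldom M N a b f) (lrep M N a b f)"
  shows "smooth_map M N f"
proof -
  have "lrep M N a b f = coord N b \<circ> f \<circ> param M a" for a b
    by (auto simp: lrep_def)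
  then show ?thesis
    using assms(2,3) unfolding smooth_map_on_def ldom_eq[OF assms(1)] by simp
qed

lemma lrep_differentiable:
  assumes "smooth_manifold M" "smooth_manifold N" "smooth_map M N f" "u \<in> ldom M N a b f"
  shows "(lrep M N a b f has_derivative Bderiv (lrep M N a b f) u) (at u)"
  using smooth_on_has_derivative[OF open_ldom smooth_on_lrep] assms smooth_map_continuous by blast

lemma smooth_map_ident:
  assumes M: "smooth_manifold M"
  shows "smooth_map M M (\<lambda>x. x)"
proof (rule smooth_mapI[OF M])
  show "smooth_on (ldom M M a b (\<lambda>x. x)) (lrep M M a b (\<lambda>x. x))" for a b
  proof -
    have "lrep M M a b (\<lambda>x. x) = coord M b \<circ> param M a"
      by (auto simp: lrep_def)
    moreover have "ldom M M a b (\<lambda>x. x) = coord M a ` (cdom M a \<inter> cdom M b)"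
      unfolding ldom_eq[OF M] by (rule arg_cong[where f = "image (coord M a)"]) auto
    ultimately show ?thesis
      using smooth_transition[OF M] by simp
  qed
qed auto

text \<open>The composite of the two representatives represents \<open>g \<circ> f\<close> only
  while \<open>f\<close> stays in the intermediate chart \<open>b\<close>. Continuity of
  \<open>f\<close> at the point supplies a neighbourhood where it does.\<close>

lemma lrep_compose_has_derivative:
  assumes M: "smooth_manifold M" and N: "smooth_manifold N"
    and u: "u \<in> cimg M a" "f (param M a u) \<in> cdom N b"
    and f: "isCont f (param M a u)"
    and F: "(lrep M N a b f has_derivative F) (at u)"
    and G: "(lrep N K b c g has_derivative G) (at (coord N b (f (param M a u))))"
  shows "(lrep M K a c (\<lambda>x. g (f x)) has_derivative (\<lambda>v. G (F v))) (at u)"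
proof -
  have "isCont (param M a) u"
    using continuous_on_param[OF M] open_cimg[OF M] u continuous_on_eq_continuous_at by blast
  then have "isCont (\<lambda>u. f (param M a u)) u"
    using f isCont_o2 by blast
  then have "((\<lambda>z. f (param M a z)) \<longlongrightarrow> f (param M a u)) (nhds u)"
    using tendsto_at_iff_tendsto_nhds[of "\<lambda>z. f (param M a z)" u] by (simp add: isCont_def)
  from topological_tendstoD[OF this open_cdom[OF N] u(2)] obtain S where S: "open S" "u \<in> S" "\<And>z. z \<in> S \<Longrightarrow> f (param M a z) \<in> cdom N b"
    unfolding eventually_nhds by blast
  have "lrep M N a b f u = coord N b (f (param M a u))"
    by (simp add: lrep_def)
  then have "((\<lambda>z. lrep N K b c g (lrep M N a b f z)) has_derivative (\<lambda>v. G (F v))) (at u)"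
    using has_derivative_compose[OF F, of "lrep N K b c g" G] G by simp
  moreover have "lrep N K b c g (lrep M N a b f z) = lrep M K a c (\<lambda>x. g (f x)) z" if "z \<in> S" for z
    using S(3)[OF that] by (simp add: lrep_def param_coord[OF N])
  ultimately show ?thesis
    using has_derivative_transform_within_open S(1,2) by blast
qed

lemma to_frame_has_derivative:
  assumes M: "smooth_manifold M" and u: "u \<in> cimg M a"
  shows "(lrep M M a (param M a u) (\<lambda>x. x) has_derivative to_frame M a u) (at u)"
proof -
  have "u \<in> ldom M M a (param M a u) (\<lambda>x. x)"
    using u center_in_cdom[OF M] by (auto simp: ldom_def)
  then have "lrep M M a (param M a u) (\<lambda>x. x) differentiable at u"
    using lrep_differentiable[OF M M smooth_map_ident[OF M]] differentiable_def by blast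
  moreover have "lrep M M a (param M a u) (\<lambda>x. x) = coord M (param M a u) \<circ> param M a"
    by (auto simp: lrep_def)
  ultimately show ?thesis
    using has_derivative_frechet unfolding to_frame_def by metis
qed

lemma linear_to_frame: "smooth_manifold M \<Longrightarrow> u \<in> cimg M a \<Longrightarrow> linear (to_frame M a u)"
  using to_frame_has_derivative has_derivative_linear by blast

lemma to_frame_center:
  assumes M: "smooth_manifold M"
  shows "to_frame M p (coord M p p) v = v"
proof -
  have "((\<lambda>u. u) has_derivative (\<lambda>v. v)) (at (coord M p p))"
    by (rule has_derivative_ident)
  then have "(lrep M M p p (\<lambda>x. x) has_derivative (\<lambda>v. v)) (at (coord M p p))"
    using open_cimg[OF M] center_in_cimg[OF M]
    by (rule has_derivative_transform_within_open) (simp add: lrep_def coord_param[OF M])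
  moreover have "(lrep M M p p (\<lambda>x. x) has_derivative to_frame M p (coord M p p)) (at (coord M p p))"
    using to_frame_has_derivative[OF M center_in_cimg[OF M], of p] by (simp add: param_center[OF M])
  ultimately show ?thesis
    using has_derivative_unique by metis
qed

text \<open>A relational form of \<open>tmap\<close>. Since \<open>tmap\<close> is a chosen
  \<open>frechet_derivative\<close>, it says nothing unless differentiability is known;
  \<open>has_tmap\<close> carries differentiability and continuity along, so it composes, and
  \<open>tmap_eq\<close> recovers the value.\<close>

definition has_tmap ::
    "('a::t2_space, 'v::real_normed_vector) atlas \<Rightarrow> ('b::t2_space, 'w::real_normed_vector) atlas \<Rightarrow>
     ('a \<Rightarrow> 'b) \<Rightarrow> 'a \<Rightarrow> ('v \<Rightarrow> 'w) \<Rightarrow> bool" where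
  "has_tmap M N f p F \<longleftrightarrow> isCont f p \<and> (lrep M N p (f p) f has_derivative F) (at (coord M p p))"

lemma tmap_eq: "has_tmap M N f p F \<Longrightarrow> tmap M N f p = F"
proof -
  assume "has_tmap M N f p F"
  moreover have "lrep M N p (f p) f = coord N (f p) \<circ> f \<circ> param M p"
    by (auto simp: lrep_def)
  ultimately show ?thesis
    unfolding tmap_def has_tmap_def using frechet_derivative_at by metis
qed

lemma has_tmap_linear: "has_tmap M N f p F \<Longrightarrow> linear F"
  unfolding has_tmap_def using has_derivative_linear by blast

lemma has_tmap_compose:
  assumes "smooth_manifold M" "smooth_manifold N"
    and f: "has_tmap M N f p F" and g: "has_tmap N K g (f p) G"
  shows "has_tmap M K (\<lambda>x. g (f x)) p (\<lambda>v. G (F v))"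
  unfolding has_tmap_def
proof
  show "isCont (\<lambda>x. g (f x)) p"
    using f g isCont_o2 unfolding has_tmap_def by blast
  show "(lrep M K p (g (f p)) (\<lambda>x. g (f x)) has_derivative (\<lambda>v. G (F v))) (at (coord M p p))"
    using f g unfolding has_tmap_def
    by (intro lrep_compose_has_derivative[where f = f and g = g and F = F and G = G and b = "f p", OF assms(1,2)])
      (auto simp: param_center assms center_in_cdom center_in_cimg)
qed

lemma has_tmap_ident:
  assumes M: "smooth_manifold M"
  shows "has_tmap M M (\<lambda>x. x) p (\<lambda>v. v)"
proof -
  have "to_frame M p (coord M p p) = (\<lambda>v. v)"
    using to_frame_center[OF M] by blast
  then show ?thesis
    using to_frame_has_derivative[OF M center_in_cimg[OF M], of p]
    by (simp add: has_tmap_def param_center[OF M])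
qed

lemma has_tmap_const: "has_tmap M N (\<lambda>x. c) p (\<lambda>v. 0)"
  unfolding has_tmap_def lrep_def by (simp add: has_derivative_const)

lemma center_in_ldom:
  "smooth_manifold M \<Longrightarrow> smooth_manifold N \<Longrightarrow> coord M p p \<in> ldom M N p (f p) f"
  by (simp add: ldom_def param_center center_in_cdom center_in_cimg)

lemma smooth_map_has_tmap:
  assumes "smooth_manifold M" "smooth_manifold N" "smooth_map M N f"
  shows "has_tmap M N f p (tmap M N f p)"
proof -
  have "has_tmap M N f p (Bderiv (lrep M N p (f p) f) (coord M p p))"
    unfolding has_tmap_def
    using lrep_differentiable[OF assms center_in_ldom[OF assms(1,2)]]
      smooth_map_continuous[OF assms(3)] by (simp add: continuous_on_eq_continuous_at)
  then show ?thesis using tmap_eq by metis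
qed

lemma tmap_center:
  assumes "smooth_manifold M" "smooth_manifold N" "smooth_map M N f"
  shows "tmap M N f p = Bderiv (lrep M N p (f p) f) (coord M p p)"
  using smooth_map_has_tmap[OF assms, of p] lrep_differentiable[OF assms center_in_ldom[OF assms(1,2)]]
    has_derivative_unique unfolding has_tmap_def by blast

text \<open>Both sides are the derivative of \<open>f\<close> from the chart \<open>a\<close> to the
  chart centred at the image point: one factors through the chart centred at
  \<open>param M a u\<close>, the other through the chart \<open>b\<close>.\<close>

lemma tmap_to_frame:
  assumes M: "smooth_manifold M" and N: "smooth_manifold N" and f: "smooth_map M N f"
    and u: "u \<in> ldom M N a b f"
  shows "tmap M N f (param M a u) (to_frame M a u v)
    = to_frame N b (lrep M N a b f u) (Bderiv (lrep M N a b f) u v)"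
proof -
  let ?p = "param M a u" and ?w = "lrep M N a b f u"
  have u': "u \<in> cimg M a" "f ?p \<in> cdom N b" "?w \<in> cimg N b" "param N b ?w = f ?p"
    using u by (auto simp: ldom_def lrep_def coord_in_cimg param_coord[OF N])
  have cont: "isCont f x" for x
    using smooth_map_continuous[OF f] by (simp add: continuous_on_eq_continuous_at)
  have "(lrep M N a (f ?p) f has_derivative (\<lambda>v. tmap M N f ?p (to_frame M a u v))) (at u)"
    using to_frame_has_derivative[OF M u'(1)] smooth_map_has_tmap[OF M N f, of ?p] u'(1)
    by (intro lrep_compose_has_derivative[where f = "\<lambda>x. x" and g = f and b = ?p
          and F = "to_frame M a u" and G = "tmap M N f ?p", OF M M])
      (auto simp: has_tmap_def center_in_cdom[OF M])
  moreover have "(lrep M N a (f ?p) (\<lambda>x. f x) has_derivative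
      (\<lambda>v. to_frame N b ?w (Bderiv (lrep M N a b f) u v))) (at u)"
    using to_frame_has_derivative[OF N u'(3)] lrep_differentiable[OF M N f u] u' cont[of ?p]
    by (intro lrep_compose_has_derivative[where g = "\<lambda>x. x" and f = f and b = b
          and F = "Bderiv (lrep M N a b f) u" and G = "to_frame N b ?w", OF M N])
      (auto simp: lrep_def)
  ultimately show ?thesis
    using has_derivative_unique by metis
qed

lemma to_frame_eq_Bderiv:
  assumes "smooth_manifold M" "u \<in> cimg M a"
  shows "to_frame M a u v = Bderiv (lrep M M a (param M a u) (\<lambda>x. x)) u v"
  using to_frame_has_derivative[OF assms] Bderiv_apply differentiable_def frechet_derivative_at by metis

lemma of_frame_has_derivative:
  assumes M: "smooth_manifold M" and u: "u \<in> cimg M a"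
  shows "(lrep M M (param M a u) a (\<lambda>x. x) has_derivative of_frame M a u) 
    (at (coord M (param M a u) (param M a u)))"
proof -
  let ?p = "param M a u"
  have "coord M ?p ?p \<in> ldom M M ?p a (\<lambda>x. x)"
    using param_in_cdom[OF M u] by (simp add: ldom_def center_in_cimg[OF M] param_center[OF M])
  then have "lrep M M ?p a (\<lambda>x. x) differentiable at (coord M ?p ?p)"
    using lrep_differentiable[OF M M smooth_map_ident[OF M]] differentiable_def by blast
  moreover have "lrep M M ?p a (\<lambda>x. x) = coord M a \<circ> param M ?p"
    by (auto simp: lrep_def)
  ultimately show ?thesis
    using has_derivative_frechet unfolding of_frame_def by metis
qed

text \<open>The two transition maps compose to the identity near \<open>u\<close>. Besides the
  inverse this gives injectivity of \<open>to_frame\<close>, by which frames are cancelled from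
  chart identities.\<close>

lemma of_frame_to_frame:
  assumes M: "smooth_manifold M" and u: "u \<in> cimg M a"
  shows "of_frame M a u (to_frame M a u v) = v"
proof -
  let ?p = "param M a u"
  have "(lrep M M a a (\<lambda>x. x) has_derivative (\<lambda>v. of_frame M a u (to_frame M a u v))) (at u)"
    using to_frame_has_derivative[OF M u] of_frame_has_derivative[OF M u] u
    by (intro lrep_compose_has_derivative[where f = "\<lambda>x. x" and g = "\<lambda>x. x" and b = ?p
          and F = "to_frame M a u" and G = "of_frame M a u", OF M M])
      (auto simp: center_in_cdom[OF M])
  moreover have "(lrep M M a a (\<lambda>x. x) has_derivative (\<lambda>v. v)) (at u)"
    using has_derivative_ident open_cimg[OF M] u
    by (rule has_derivative_transform_within_open) (simp add: lrep_def coord_param[OF M])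
  ultimately show ?thesis
    using has_derivative_unique by metis
qed

subsection \<open>Products\<close>

lemma cdom_prod: "cdom (M \<times>\<^sub>m N) (p, q) = cdom M p \<times> cdom N q"
  by (simp add: prod_atlas_def cdom_def)

lemma coord_prod: "coord (M \<times>\<^sub>m N) (p, q) (x, y) = (coord M p x, coord N q y)"
  by (simp add: prod_atlas_def coord_def)

lemma coord_prod_fun: "coord (M \<times>\<^sub>m N) (p, q) = map_prod (coord M p) (coord N q)"
  by (simp add: prod_atlas_def coord_def)

lemma cimg_prod: "cimg (M \<times>\<^sub>m N) (p, q) = cimg M p \<times> cimg N q"
  by (auto simp: cimg_def cdom_prod coord_prod_fun)

lemma inj_on_coord: "smooth_manifold M \<Longrightarrow> inj_on (coord M p) (cdom M p)"
  by (metis inj_onI param_coord)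

text \<open>\<open>param\<close> is an \<open>inv_into\<close>; injectivity of the product chart
  makes it split into its factors at points of the chart image.\<close>

lemma param_prod:
  assumes M: "smooth_manifold M" and N: "smooth_manifold N" and "u \<in> cimg M p" "v \<in> cimg N q"
  shows "param (M \<times>\<^sub>m N) (p, q) (u, v) = (param M p u, param N q v)"
  unfolding param_def[of "M \<times>\<^sub>m N"] cdom_prod
proof (rule inv_into_f_eq)
  show "inj_on (coord (M \<times>\<^sub>m N) (p, q)) (cdom M p \<times> cdom N q)"
    unfolding coord_prod_fun using M N by (intro map_prod_inj_on inj_on_coord)
qed (use assms in \<open>auto simp: coord_prod coord_param param_in_cdom\<close>)

lemma smooth_manifold_prod:
  assumes M: "smooth_manifold M" and N: "smooth_manifold N"
  shows "smooth_manifold (M \<times>\<^sub>m N)"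
proof -
  have hom: "homeomorphism (cdom M p \<times> cdom N q) (cimg M p \<times> cimg N q)
      (coord (M \<times>\<^sub>m N) (p, q)) (param (M \<times>\<^sub>m N) (p, q))" for p q
  proof -
    have cp: "continuous_on (cimg M p \<times> cimg N q) (param (M \<times>\<^sub>m N) (p, q))"
    proof -
      have "continuous_on (cimg M p \<times> cimg N q) (\<lambda>z. (param M p (fst z), param N q (snd z)))"
        by (intro continuous_on_Pair continuous_on_compose2[OF continuous_on_param[OF M]]
            continuous_on_compose2[OF continuous_on_param[OF N]] continuous_on_fst continuous_on_snd
            continuous_on_id) auto
      then show ?thesis
        by (rule continuous_on_eq) (auto simp: param_prod[OF M N])
    qed
    have cM: "continuous_on (cdom M p) (coord M p)" and cN: "continuous_on (cdom N q) (coord N q)"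
      using homeomorphism_chart[OF M] homeomorphism_chart[OF N] unfolding homeomorphism_def by blast+
    have cc: "continuous_on (cdom M p \<times> cdom N q) (coord (M \<times>\<^sub>m N) (p, q))"
    proof -
      have "continuous_on (cdom M p \<times> cdom N q) (\<lambda>z. (coord M p (fst z), coord N q (snd z)))"
        by (intro continuous_on_Pair continuous_on_compose2[OF cM]
            continuous_on_compose2[OF cN] continuous_on_fst continuous_on_snd
            continuous_on_id) auto
      then show ?thesis
        by (rule continuous_on_eq) (auto simp: coord_prod)
    qed
    show ?thesis
      using cp cc
      by (rule_tac homeomorphismI)
        (auto simp: param_prod[OF M N] coord_prod coord_in_cimg param_in_cdom M N coord_param param_coord)
  qed
  have trans: "smooth_on (coord (M \<times>\<^sub>m N) (p, q) ` (cdom (M \<times>\<^sub>m N) (p, q) \<inter> cdom (M \<times>\<^sub>m N) (p', q')))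
      (coord (M \<times>\<^sub>m N) (p', q') \<circ> param (M \<times>\<^sub>m N) (p, q))" for p q p' q'
  proof -
    let ?A = "ldom M M p p' (\<lambda>x. x)" and ?B = "ldom N N q q' (\<lambda>x. x)"
    have S: "coord (M \<times>\<^sub>m N) (p, q) ` (cdom (M \<times>\<^sub>m N) (p, q) \<inter> cdom (M \<times>\<^sub>m N) (p', q')) = ?A \<times> ?B"
      unfolding ldom_eq[OF M] ldom_eq[OF N] cdom_prod coord_prod_fun Times_Int_Times map_prod_image[symmetric]
      by (simp add: map_prod_surj_on Int_def)
    have sm: "smooth_on (?A \<times> ?B) (\<lambda>z. (lrep M M p p' (\<lambda>x. x) (fst z), lrep N N q q' (\<lambda>x. x) (snd z)))"
      by (intro smooth_on_Pair smooth_on_compose_linear[OF bounded_linear_fst _ smooth_on_lrep]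
          smooth_on_compose_linear[OF bounded_linear_snd _ smooth_on_lrep] smooth_map_ident M N) auto
    have eq: "(lrep M M p p' (\<lambda>x. x) (fst z), lrep N N q q' (\<lambda>x. x) (snd z))
        = (coord (M \<times>\<^sub>m N) (p', q') \<circ> param (M \<times>\<^sub>m N) (p, q)) z" if "z \<in> ?A \<times> ?B" for z
      using that by (auto simp: lrep_def ldom_def param_prod[OF M N] coord_prod)
    have o: "open (?A \<times> ?B)"
      by (intro open_Times open_ldom M N continuous_on_id)
    show ?thesis
      unfolding S by (rule smooth_on_cong[OF o eq sm])
  qed
  show ?thesis
    unfolding smooth_manifold_def cimg_def[symmetric]
    using hom trans
    by (auto simp: cdom_prod cimg_prod open_Times open_cdom open_cimg M N center_in_cdom)
qed

lemma has_tmap_Pair: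
  assumes f: "has_tmap M N f p F" and g: "has_tmap M K g p G"
  shows "has_tmap M (N \<times>\<^sub>m K) (\<lambda>x. (f x, g x)) p (\<lambda>v. (F v, G v))"
proof -
  have "lrep M (N \<times>\<^sub>m K) p (f p, g p) (\<lambda>x. (f x, g x)) = (\<lambda>u. (lrep M N p (f p) f u, lrep M K p (g p) g u))"
    by (auto simp: lrep_def coord_prod)
  then show ?thesis
    using f g unfolding has_tmap_def by (auto intro: has_derivative_Pair isCont_Pair)
qed

lemma smooth_map_fst:
  assumes M: "smooth_manifold M" and N: "smooth_manifold N"
  shows "smooth_map (M \<times>\<^sub>m N) M fst"
proof (rule smooth_mapI[OF smooth_manifold_prod[OF M N]])
  show "smooth_on (ldom (M \<times>\<^sub>m N) M a b fst) (lrep (M \<times>\<^sub>m N) M a b fst)" for a b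
  proof -
    obtain p q where a: "a = (p, q)" by (cases a)
    have o: "open (ldom (M \<times>\<^sub>m N) M a b fst)"
      by (intro open_ldom smooth_manifold_prod M N continuous_on_fst continuous_on_id)
    have "smooth_on (ldom (M \<times>\<^sub>m N) M a b fst) (\<lambda>z. lrep M M p b (\<lambda>x. x) (fst z))"
      by (rule smooth_on_compose_linear[OF bounded_linear_fst _ smooth_on_lrep[OF M smooth_map_ident[OF M]]])
        (auto simp: ldom_def a cimg_prod param_prod[OF M N])
    then show ?thesis
      by (rule smooth_on_cong[OF o, rotated]) (auto simp: ldom_def a cimg_prod lrep_def param_prod[OF M N])
  qed
qed (intro continuous_on_fst continuous_on_id)

lemma has_tmap_fst:
  assumes M: "smooth_manifold M" and N: "smooth_manifold N"
  shows "has_tmap (M \<times>\<^sub>m N) M fst z fst"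
proof -
  obtain p q where z: "z = (p, q)" by (cases z)
  have o: "open (cimg (M \<times>\<^sub>m N) (p, q))"
    by (intro open_cimg smooth_manifold_prod M N)
  have "(fst has_derivative fst) (at (coord (M \<times>\<^sub>m N) (p, q) (p, q)))"
    by (rule bounded_linear_imp_has_derivative[OF bounded_linear_fst])
  then have "(lrep (M \<times>\<^sub>m N) M (p, q) p fst has_derivative fst) (at (coord (M \<times>\<^sub>m N) (p, q) (p, q)))"
    by (rule has_derivative_transform_within_open[OF _ o center_in_cimg[OF smooth_manifold_prod[OF M N]]])
      (auto simp: cimg_prod lrep_def param_prod[OF M N] coord_param[OF M])
  then show ?thesis
    by (simp add: has_tmap_def z isCont_fst)
qed

lemma has_tmap_snd:
  assumes M: "smooth_manifold M" and N: "smooth_manifold N"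
  shows "has_tmap (M \<times>\<^sub>m N) N snd z snd"
proof -
  obtain p q where z: "z = (p, q)" by (cases z)
  have o: "open (cimg (M \<times>\<^sub>m N) (p, q))"
    by (intro open_cimg smooth_manifold_prod M N)
  have "(snd has_derivative snd) (at (coord (M \<times>\<^sub>m N) (p, q) (p, q)))"
    by (rule bounded_linear_imp_has_derivative[OF bounded_linear_snd])
  then have "(lrep (M \<times>\<^sub>m N) N (p, q) q snd has_derivative snd) (at (coord (M \<times>\<^sub>m N) (p, q) (p, q)))"
    by (rule has_derivative_transform_within_open[OF _ o center_in_cimg[OF smooth_manifold_prod[OF M N]]])
      (auto simp: cimg_prod lrep_def param_prod[OF M N] coord_param[OF N])
  then show ?thesis
    by (simp add: has_tmap_def z isCont_snd)
qed

lemma to_frame_prod: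
  assumes M: "smooth_manifold M" and N: "smooth_manifold N" and u: "u \<in> cimg M a" "v \<in> cimg N b"
  shows "to_frame (M \<times>\<^sub>m N) (a, b) (u, v) (x, y) = (to_frame M a u x, to_frame N b v y)"
proof -
  let ?p = "param M a u" and ?q = "param N b v"
  have o: "open (cimg M a \<times> cimg N b)"
    by (intro open_Times open_cimg M N)
  have "((\<lambda>z. (lrep M M a ?p (\<lambda>x. x) (fst z), lrep N N b ?q (\<lambda>x. x) (snd z))) has_derivative
      (\<lambda>z. (to_frame M a u (fst z), to_frame N b v (snd z)))) (at (u, v))"
    using has_derivative_compose[OF bounded_linear_imp_has_derivative[OF bounded_linear_fst], of _ _ "(u, v)"]
      has_derivative_compose[OF bounded_linear_imp_has_derivative[OF bounded_linear_snd], of _ _ "(u, v)"]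
      to_frame_has_derivative[OF M u(1)] to_frame_has_derivative[OF N u(2)]
    by (intro has_derivative_Pair) auto
  then have 1: "(lrep (M \<times>\<^sub>m N) (M \<times>\<^sub>m N) (a, b) (?p, ?q) (\<lambda>x. x) has_derivative
      (\<lambda>z. (to_frame M a u (fst z), to_frame N b v (snd z)))) (at (u, v))"
    by (rule has_derivative_transform_within_open[OF _ o]) (use u in
      \<open>auto simp: lrep_def param_prod[OF M N] coord_prod\<close>)
  have 2: "(lrep (M \<times>\<^sub>m N) (M \<times>\<^sub>m N) (a, b) (?p, ?q) (\<lambda>x. x) has_derivative
      to_frame (M \<times>\<^sub>m N) (a, b) (u, v)) (at (u, v))"
    using to_frame_has_derivative[OF smooth_manifold_prod[OF M N], of "(u, v)" "(a, b)"] u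
    by (simp add: cimg_prod param_prod[OF M N])
  show ?thesis
    using fun_cong[OF has_derivative_unique[OF 2 1], of "(x, y)"] by simp
qed

section \<open>Forms in charts\<close>

definition lform :: "('a, 'v::real_normed_vector) atlas \<Rightarrow> 'a \<Rightarrow> ('a, 'v, 'k::real_normed_vector) form1 \<Rightarrow>
    'v \<Rightarrow> 'v \<Rightarrow>\<^sub>L 'k" where
  "lform M a \<alpha> u = Blinfun (local1 M a \<alpha> u)"

lemma bounded_linear_blinfun_compose_right: "bounded_linear (\<lambda>A. A o\<^sub>L B)"
  by (rule bounded_bilinear.bounded_linear_left[OF bounded_bilinear_blinfun_compose])

lemma bounded_linear_inl: "bounded_linear (\<lambda>x. (x, 0))" and bounded_linear_inr: "bounded_linear (\<lambda>x. (0, x))"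
  by (intro bounded_linear_Pair bounded_linear_ident bounded_linear_zero)+

text \<open>Being linear in \<open>v\<close>, the chart expression \<open>g (u, v)\<close> equals
  its own derivative in \<open>v\<close> at 0, namely \<open>Bderiv g (u, 0) (0, v)\<close>. This
  yields boundedness in \<open>v\<close>, and smoothness in operator norm through
  \<open>smooth_on_Bderiv\<close>.\<close>

lemma
  fixes M :: "('a::t2_space, 'v::banach) atlas" and \<alpha> :: "('a, 'v, 'k::banach) form1"
  assumes M: "smooth_manifold M" and \<alpha>: "smooth_form1 M \<alpha>"
  shows lform_apply: "u \<in> cimg M a \<Longrightarrow> blinfun_apply (lform M a \<alpha> u) = local1 M a \<alpha> u"
    and smooth_on_lform: "smooth_on (cimg M a) (lform M a \<alpha>)"
proof -
  define g where "g = (\<lambda>(u, v). local1 M a \<alpha> u v)"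
  define R :: "'v \<Rightarrow>\<^sub>L ('v \<times> 'v)" where "R = Blinfun (\<lambda>v. (0, v))"
  have R: "blinfun_apply R = (\<lambda>v. (0, v))"
    unfolding R_def by (rule bounded_linear_Blinfun_apply[OF bounded_linear_inr])
  have g: "smooth_on (cimg M a \<times> UNIV) g"
    using \<alpha> unfolding smooth_form1_def cimg_def[symmetric] g_def by blast
  have o: "open (cimg M a \<times> (UNIV :: 'v set))"
    by (intro open_Times open_cimg M open_UNIV)
  have lin: "linear (local1 M a \<alpha> u)" if "u \<in> cimg M a" for u
  proof -
    have "linear (\<lambda>v. \<alpha> (param M a u) (to_frame M a u v))"
      using linear_compose[OF linear_to_frame[OF M that]] \<alpha>
      unfolding smooth_form1_def o_def by blast
    then show ?thesis by (simp add: local1_def[abs_def])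
  qed
  have eq: "local1 M a \<alpha> u v = Bderiv g (u, 0) (0, v)" if u: "u \<in> cimg M a" for u v
  proof -
    have "(g has_derivative Bderiv g (u, 0)) (at (u, 0))"
      using u by (intro smooth_on_has_derivative[OF o g]) auto
    moreover have "((\<lambda>t. (u, t *\<^sub>R v)) has_derivative (\<lambda>s. (0, s *\<^sub>R v))) (at 0)"
      by (auto intro!: derivative_eq_intros)
    ultimately have "((\<lambda>t. g (u, t *\<^sub>R v)) has_derivative (\<lambda>s. Bderiv g (u, 0) (0, s *\<^sub>R v))) (at (0::real))"
      using has_derivative_compose[of "\<lambda>t. (u, t *\<^sub>R v)" "\<lambda>s. (0, s *\<^sub>R v)" 0 UNIV g "Bderiv g (u, 0)"] by simp
    moreover have "((\<lambda>t. g (u, t *\<^sub>R v)) has_derivative (\<lambda>s. s *\<^sub>R local1 M a \<alpha> u v)) (at (0::real))"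
      unfolding g_def using linear_scale[OF lin[OF u]] by (auto intro!: derivative_eq_intros)
    ultimately have "(\<lambda>s. Bderiv g (u, 0) (0, s *\<^sub>R v)) = (\<lambda>s. s *\<^sub>R local1 M a \<alpha> u v)"
      by (rule has_derivative_unique)
    from fun_cong[OF this, of 1] show ?thesis by simp
  qed
  have lform: "lform M a \<alpha> u = Bderiv g (u, 0) o\<^sub>L R" and app: "blinfun_apply (lform M a \<alpha> u) = local1 M a \<alpha> u"
    if u: "u \<in> cimg M a" for u
  proof -
    have *: "local1 M a \<alpha> u = blinfun_apply (Bderiv g (u, 0) o\<^sub>L R)"
      using eq[OF u] by (auto simp: R)
    then show "lform M a \<alpha> u = Bderiv g (u, 0) o\<^sub>L R"
      by (simp add: lform_def blinfun_apply_inverse)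
    with * show "blinfun_apply (lform M a \<alpha> u) = local1 M a \<alpha> u" by simp
  qed
  show "u \<in> cimg M a \<Longrightarrow> blinfun_apply (lform M a \<alpha> u) = local1 M a \<alpha> u"
    by (rule app)
  have "smooth_on (cimg M a) (\<lambda>u. Bderiv g (u, 0) o\<^sub>L R)"
    by (intro smooth_on_linear_compose[OF bounded_linear_blinfun_compose_right]
        smooth_on_compose_linear[OF bounded_linear_inl _ smooth_on_Bderiv[OF o g]]) auto
  then show "smooth_on (cimg M a) (lform M a \<alpha>)"
    by (rule smooth_on_cong[OF open_cimg[OF M], rotated]) (simp add: lform)
qed

lemma local1_center: "smooth_manifold M \<Longrightarrow> local1 M p \<alpha> (coord M p p) v = \<alpha> p v"
  by (simp add: local1_def to_frame_center param_center)

lemma local2_center: "smooth_manifold M \<Longrightarrow> local2 M p \<alpha> (coord M p p) v w = \<alpha> p v w"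
  by (simp add: local2_def to_frame_center param_center)

lemma lform_center:
  "smooth_manifold M \<Longrightarrow> smooth_form1 M \<alpha> \<Longrightarrow> lform M p \<alpha> (coord M p p) v = \<alpha> p v"
  by (simp add: lform_apply center_in_cimg local1_center)

lemma lform_has_derivative:
  assumes "smooth_manifold M" "smooth_form1 M \<alpha>" "u \<in> cimg M a"
  shows "(lform M a \<alpha> has_derivative Bderiv (lform M a \<alpha>) u) (at u)"
  using smooth_on_has_derivative[OF open_cimg smooth_on_lform] assms by blast

section \<open>Exterior derivatives in charts and their naturality\<close>

definition chart_ext_deriv :: "('v::real_normed_vector \<Rightarrow> 'v \<Rightarrow>\<^sub>L 'k::real_normed_vector) \<Rightarrow> 'v \<Rightarrow> 'v \<Rightarrow> 'v \<Rightarrow> 'k" where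
  "chart_ext_deriv B x v w = Bderiv B x v w - Bderiv B x w v"

lemma pullback_has_derivative:
  fixes f :: "'v::banach \<Rightarrow> 'w::banach" and A :: "'w \<Rightarrow> 'w \<Rightarrow>\<^sub>L 'k::real_normed_vector"
  assumes S: "open S" "x \<in> S" "smooth_on S f" and A: "(A has_derivative blinfun_apply A') (at (f x))"
    and B: "\<And>u. u \<in> S \<Longrightarrow> B u = A (f u) o\<^sub>L Bderiv f u"
  shows "(B has_derivative (\<lambda>v. (A (f x) o\<^sub>L Bderiv (Bderiv f) x v) + (A' (Bderiv f x v) o\<^sub>L Bderiv f x))) (at x)"
proof -
  have 1: "((\<lambda>u. A (f u)) has_derivative (\<lambda>v. A' (Bderiv f x v))) (at x)"
    using has_derivative_compose[OF smooth_on_has_derivative[OF S(1,3,2)] A] .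
  have 2: "(Bderiv f has_derivative Bderiv (Bderiv f) x) (at x)"
    using smooth_on_has_derivative[OF S(1) smooth_on_Bderiv[OF S(1,3)] S(2)] .
  have "((\<lambda>u. A (f u) o\<^sub>L Bderiv f u) has_derivative
      (\<lambda>v. (A (f x) o\<^sub>L Bderiv (Bderiv f) x v) + (A' (Bderiv f x v) o\<^sub>L Bderiv f x))) (at x)"
    using bounded_bilinear.FDERIV[OF bounded_bilinear_blinfun_compose 1 2] .
  then show ?thesis
    using S B by (elim has_derivative_transform_within_open) auto
qed

text \<open>The product rule leaves one term with the second derivative of \<open>f\<close>. It is
  symmetric in \<open>v\<close> and \<open>w\<close> and drops out of the
  antisymmetrisation.\<close>

lemma chart_ext_deriv_pullback:
  fixes f :: "'v::banach \<Rightarrow> 'w::banach" and A :: "'w \<Rightarrow> 'w \<Rightarrow>\<^sub>L 'k::real_normed_vector"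
  assumes S: "open S" "x \<in> S" "smooth_on S f" and A: "A differentiable at (f x)"
    and B: "\<And>u. u \<in> S \<Longrightarrow> B u = A (f u) o\<^sub>L Bderiv f u"
    and B': "(B has_derivative B') (at x)"
  shows "B' v w - B' w v = chart_ext_deriv A (f x) (Bderiv f x v) (Bderiv f x w)"
proof -
  have "B' = (\<lambda>v. (A (f x) o\<^sub>L Bderiv (Bderiv f) x v) + (Bderiv A (f x) (Bderiv f x v) o\<^sub>L Bderiv f x))"
    using has_derivative_unique[OF B' pullback_has_derivative[OF S has_derivative_Bderiv[OF A] B]] by simp
  then show ?thesis
    using Bderiv_Bderiv_commute[OF S(1,3,2), of v w] by (simp add: chart_ext_deriv_def blinfun.add_left)
qed

text \<open>Serves pulled-back forms, for which a differentiable operator-valued expression near the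
  centre is at hand while \<open>smooth_form1\<close> has not been established.\<close>

lemma ext_deriv_eqI:
  assumes M: "smooth_manifold M" and S: "open S" "coord M p p \<in> S"
    and eq: "\<And>u w. u \<in> S \<Longrightarrow> u \<in> cimg M p \<Longrightarrow> local1 M p \<beta> u w = blinfun_apply (B u) w"
    and B: "(B has_derivative B') (at (coord M p p))"
  shows "ext_deriv M \<beta> p v w = B' v w - B' w v"
proof -
  have "frechet_derivative (\<lambda>u. local1 M p \<beta> u w) (at (coord M p p)) v = B' v w" for v w
  proof -
    have "((\<lambda>u. blinfun_apply (B u) w) has_derivative (\<lambda>v. B' v w)) (at (coord M p p))"
      using bounded_linear.has_derivative[OF bounded_linear_apply_blinfun B] .
    then have "((\<lambda>u. local1 M p \<beta> u w) has_derivative (\<lambda>v. B' v w)) (at (coord M p p))"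
      by (rule has_derivative_transform_within_open[where s = "S \<inter> cimg M p"])
        (use S eq open_cimg[OF M] center_in_cimg[OF M] in auto)
    then show ?thesis using frechet_derivative_at by metis
  qed
  then show ?thesis by (simp add: ext_deriv_def)
qed

lemma ext_deriv_center:
  assumes "smooth_manifold M" "smooth_form1 M \<alpha>"
  shows "ext_deriv M \<alpha> p v w = chart_ext_deriv (lform M p \<alpha>) (coord M p p) v w"
  unfolding chart_ext_deriv_def
  using assms by (intro ext_deriv_eqI[OF _ open_UNIV, where B = "lform M p \<alpha>"])
    (auto simp: lform_apply lform_has_derivative center_in_cimg)

lemma local1_pullback:
  assumes M: "smooth_manifold M" and N: "smooth_manifold N" and f: "smooth_map M N f"
    and \<alpha>: "smooth_form1 N \<alpha>" and u: "u \<in> ldom M N a b f"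
  shows "local1 M a (pullback1 M N f \<alpha>) u v
    = lform N b \<alpha> (lrep M N a b f u) (Bderiv (lrep M N a b f) u v)"
proof -
  have w: "lrep M N a b f u \<in> cimg N b" "param N b (lrep M N a b f u) = f (param M a u)"
    using u by (auto simp: ldom_def lrep_def coord_in_cimg param_coord[OF N])
  show ?thesis
    by (simp add: lform_apply[OF N \<alpha> w(1)] local1_def pullback1_def tmap_to_frame[OF M N f u] w(2))
qed

lemma pullback1_ident:
  assumes "smooth_manifold M"
  shows "pullback1 M M (\<lambda>x. x) \<alpha> = \<alpha>"
  using tmap_eq[OF has_tmap_ident[OF assms]] by (auto simp: pullback1_def fun_eq_iff)

lemma lform_transition:
  assumes M: "smooth_manifold M" and \<alpha>: "smooth_form1 M \<alpha>" and u: "u \<in> ldom M M a b (\<lambda>x. x)"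
  shows "lform M a \<alpha> u
    = lform M b \<alpha> (lrep M M a b (\<lambda>x. x) u) o\<^sub>L Bderiv (lrep M M a b (\<lambda>x. x)) u"
proof (rule blinfun_eqI)
  fix v
  have "u \<in> cimg M a" using u by (simp add: ldom_def)
  then show "lform M a \<alpha> u v
    = (lform M b \<alpha> (lrep M M a b (\<lambda>x. x) u) o\<^sub>L Bderiv (lrep M M a b (\<lambda>x. x)) u) v"
    using local1_pullback[OF M M smooth_map_ident[OF M] \<alpha> u, of v]
    by (simp add: lform_apply[OF M \<alpha>] pullback1_ident[OF M])
qed

text \<open>\<open>ext_deriv\<close> uses a different chart at every point. Applying
  \<open>chart_ext_deriv_pullback\<close> to the transition map shows that the single chart
  \<open>a\<close> gives the same values, so d\<alpha> can be handled as a function of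
  \<open>u\<close>.\<close>

lemma local2_ext_deriv:
  assumes M: "smooth_manifold M" and \<alpha>: "smooth_form1 M \<alpha>" and u: "u \<in> cimg M a"
  shows "local2 M a (ext_deriv M \<alpha>) u v w = chart_ext_deriv (lform M a \<alpha>) u v w"
proof -
  let ?p = "param M a u" and ?S = "ldom M M a (param M a u) (\<lambda>x. x)"
  let ?\<tau> = "lrep M M a ?p (\<lambda>x. x)"
  have S: "open ?S" "u \<in> ?S" "smooth_on ?S ?\<tau>"
    using open_ldom[OF M M continuous_on_id] u center_in_cdom[OF M] smooth_on_lrep[OF M smooth_map_ident[OF M]]
    by (auto simp: ldom_def)
  have \<tau>: "?\<tau> u = coord M ?p ?p"
    by (simp add: lrep_def)
  have "Bderiv (lform M a \<alpha>) u v w - Bderiv (lform M a \<alpha>) u w v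
      = chart_ext_deriv (lform M ?p \<alpha>) (?\<tau> u) (Bderiv ?\<tau> u v) (Bderiv ?\<tau> u w)"
  proof (rule chart_ext_deriv_pullback[OF S])
    show "lform M ?p \<alpha> differentiable at (?\<tau> u)"
      using lform_has_derivative[OF M \<alpha> center_in_cimg[OF M]] \<tau> differentiable_def by metis
  qed (use lform_transition[OF M \<alpha>] lform_has_derivative[OF M \<alpha> u] in auto)
  then show ?thesis
    by (simp add: local2_def ext_deriv_center[OF M \<alpha>] to_frame_eq_Bderiv[OF M u] \<tau> chart_ext_deriv_def)
qed

lemma ext_deriv_pullback:
  assumes M: "smooth_manifold M" and N: "smooth_manifold N" and f: "smooth_map M N f"
    and \<alpha>: "smooth_form1 N \<alpha>"
  shows "ext_deriv M (pullback1 M N f \<alpha>) p v w = ext_deriv N \<alpha> (f p) (tmap M N f p v) (tmap M N f p w)"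
proof -
  let ?x = "coord M p p" and ?f = "lrep M N p (f p) f" and ?S = "ldom M N p (f p) f"
  define B where "B u = lform N (f p) \<alpha> (?f u) o\<^sub>L Bderiv ?f u" for u
  have S: "open ?S" "?x \<in> ?S" "smooth_on ?S ?f"
    using open_ldom[OF M N smooth_map_continuous[OF f]] center_in_ldom[OF M N] smooth_on_lrep[OF M f] by auto
  have fx: "?f ?x = coord N (f p) (f p)"
    by (simp add: lrep_def param_center[OF M])
  have A: "(lform N (f p) \<alpha> has_derivative Bderiv (lform N (f p) \<alpha>) (?f ?x)) (at (?f ?x))"
    unfolding fx using lform_has_derivative[OF N \<alpha> center_in_cimg[OF N]] .
  note B' = pullback_has_derivative[OF S A, of B, OF B_def]
  have "ext_deriv M (pullback1 M N f \<alpha>) p v w = chart_ext_deriv (lform N (f p) \<alpha>) (?f ?x) (Bderiv ?f ?x v) (Bderiv ?f ?x w)"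
    unfolding chart_ext_deriv_pullback[OF S differentiableI[OF A] B_def B', symmetric]
    by (rule ext_deriv_eqI[OF M S(1,2) _ B']) (simp add: B_def local1_pullback[OF M N f \<alpha>])
  then show ?thesis
    by (simp add: ext_deriv_center[OF N \<alpha>] tmap_center[OF M N f] fx)
qed

section \<open>Lie groups and actions in charts\<close>

locale lie_grp =
  fixes G :: "('g::t2_space, 'vg::banach) lie_group"
  assumes lie: "is_lie_group G"
begin

abbreviation "A \<equiv> gatlas G"
abbreviation mult (infixl "\<cdot>" 70) where "g \<cdot> h \<equiv> g \<otimes>\<^bsub>G\<^esub> h"
abbreviation unit ("\<e>") where "\<e> \<equiv> \<one>\<^bsub>G\<^esub>"

definition "c = coord A \<e> \<e>"
definition "m = lrep (A \<times>\<^sub>m A) A (\<e>, \<e>) \<e> (\<lambda>(g, h). g \<cdot> h)"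
definition "D2m = Bderiv (Bderiv m) (c, c)"

lemma mfdG: "smooth_manifold A"
  and smooth_mult: "smooth_map (A \<times>\<^sub>m A) A (\<lambda>(g, h). g \<cdot> h)"
  using lie unfolding is_lie_group_def by auto

lemma group_laws: "\<e> \<cdot> g = g" "g \<cdot> \<e> = g" "(g \<cdot> h) \<cdot> k = g \<cdot> (h \<cdot> k)"
  "inv\<^bsub>G\<^esub> g \<cdot> g = \<e>" "g \<cdot> inv\<^bsub>G\<^esub> g = \<e>" "inv\<^bsub>G\<^esub> (inv\<^bsub>G\<^esub> g) = g"
proof -
  interpret group G using lie by (simp add: is_lie_group_def)
  have [simp]: "x \<in> carrier G" for x using lie by (simp add: is_lie_group_def)
  show "\<e> \<cdot> g = g" "g \<cdot> \<e> = g" "(g \<cdot> h) \<cdot> k = g \<cdot> (h \<cdot> k)"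
    "inv\<^bsub>G\<^esub> g \<cdot> g = \<e>" "g \<cdot> inv\<^bsub>G\<^esub> g = \<e>" "inv\<^bsub>G\<^esub> (inv\<^bsub>G\<^esub> g) = g"
    by (simp_all add: m_assoc)
qed

lemma mfdGG: "smooth_manifold (A \<times>\<^sub>m A)"
  by (intro smooth_manifold_prod mfdG)

lemma c_in: "c \<in> cimg A \<e>" and param_c: "param A \<e> c = \<e>"
  unfolding c_def by (rule center_in_cimg[OF mfdG], rule param_center[OF mfdG])

lemma to_frame_c: "to_frame A \<e> c v = v"
  unfolding c_def by (rule to_frame_center[OF mfdG])

definition "dom_m = ldom (A \<times>\<^sub>m A) A (\<e>, \<e>) \<e> (\<lambda>(g, h). g \<cdot> h)"

lemma open_dom_m: "open dom_m" and smooth_m: "smooth_on dom_m m"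
  unfolding dom_m_def m_def
  by (intro open_ldom smooth_on_lrep mfdGG mfdG smooth_mult smooth_map_continuous[OF smooth_mult])+

lemma in_dom_m: "s \<in> cimg A \<e> \<Longrightarrow> (s, c) \<in> dom_m" and m_c: "s \<in> cimg A \<e> \<Longrightarrow> m (s, c) = s"
  using c_in by (auto simp: dom_m_def ldom_def m_def lrep_def cimg_prod param_prod[OF mfdG mfdG] param_c
    group_laws param_in_cdom[OF mfdG] coord_param[OF mfdG])

lemma has_tmap_mult: "has_tmap (A \<times>\<^sub>m A) A (\<lambda>(g, h). g \<cdot> h) z (tmap (A \<times>\<^sub>m A) A (\<lambda>(g, h). g \<cdot> h) z)"
  by (intro smooth_map_has_tmap mfdGG mfdG smooth_mult)

lemma has_tmap_left_mult:
  "has_tmap A A (\<lambda>x. g \<cdot> x) h (\<lambda>v. tmap (A \<times>\<^sub>m A) A (\<lambda>(g, h). g \<cdot> h) (g, h) (0, v))"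
  using has_tmap_compose[OF mfdG mfdGG has_tmap_Pair[OF has_tmap_const has_tmap_ident[OF mfdG]] has_tmap_mult]
  by simp

lemma has_tmap_right_mult:
  "has_tmap A A (\<lambda>x. x \<cdot> g) h (\<lambda>v. tmap (A \<times>\<^sub>m A) A (\<lambda>(g, h). g \<cdot> h) (h, g) (v, 0))"
  using has_tmap_compose[OF mfdG mfdGG has_tmap_Pair[OF has_tmap_ident[OF mfdG] has_tmap_const] has_tmap_mult]
  by simp

lemma has_tmap_left_inv_field: "has_tmap A A (\<lambda>x. g \<cdot> x) \<e> (\<lambda>v. left_inv_field G v g)"
  using has_tmap_left_mult[of g \<e>] tmap_eq[OF has_tmap_left_mult[of g \<e>]]
  by (simp add: left_inv_field_def)

lemma has_tmap_Ad: "has_tmap A A (\<lambda>x. g \<cdot> x \<cdot> inv\<^bsub>G\<^esub> g) \<e> (Ad G g)"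
proof -
  note * = has_tmap_compose[OF mfdG mfdG has_tmap_left_mult[of g \<e>] has_tmap_right_mult[of "inv\<^bsub>G\<^esub> g"]]
  show ?thesis
    using * tmap_eq[OF *] by (simp add: Ad_def)
qed

lemma left_inv_field_local:
  assumes s: "s \<in> cimg A \<e>"
  shows "left_inv_field G X (param A \<e> s) = to_frame A \<e> s (Bderiv m (s, c) (0, X))"
proof -
  let ?g = "param A \<e> s"
  have "left_inv_field G X ?g = tmap (A \<times>\<^sub>m A) A (\<lambda>(g, h). g \<cdot> h) (?g, \<e>) (0, X)"
    unfolding left_inv_field_def using tmap_eq[OF has_tmap_left_mult[of ?g \<e>]] by simp
  also have "\<dots> = tmap (A \<times>\<^sub>m A) A (\<lambda>(g, h). g \<cdot> h) (param (A \<times>\<^sub>m A) (\<e>, \<e>) (s, c))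
      (to_frame (A \<times>\<^sub>m A) (\<e>, \<e>) (s, c) (0, X))"
    by (simp add: param_prod[OF mfdG mfdG] to_frame_prod[OF mfdG mfdG] s c_in param_c to_frame_c
        linear_0[OF linear_to_frame[OF mfdG s]])
  also have "\<dots> = to_frame A \<e> s (Bderiv m (s, c) (0, X))"
    using tmap_to_frame[OF mfdGG mfdG smooth_mult in_dom_m[OF s, unfolded dom_m_def]]
    by (simp add: m_def[symmetric] m_c[OF s])
  finally show ?thesis .
qed

lemma Bderiv_m_c: "Bderiv m (c, c) (0, X) = X"
proof -
  have "left_inv_field G X \<e> = X"
    using tmap_eq[OF has_tmap_left_inv_field[of \<e>]] tmap_eq[OF has_tmap_ident[OF mfdG, of \<e>]]
    by (simp add: group_laws fun_eq_iff)
  then show ?thesis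
    using left_inv_field_local[OF c_in, of X] by (simp add: param_c to_frame_c)
qed

lemma D2m_derivative:
  "((\<lambda>s. Bderiv m (s, c)) has_derivative (\<lambda>X. D2m (X, 0))) (at c)"
proof -
  have "((\<lambda>s. (s, c)) has_derivative (\<lambda>X. (X, 0))) (at c)"
    by (auto intro!: derivative_eq_intros)
  moreover have "(Bderiv m has_derivative D2m) (at (c, c))"
    unfolding D2m_def
    by (rule smooth_on_has_derivative[OF open_dom_m smooth_on_Bderiv[OF open_dom_m smooth_m] in_dom_m[OF c_in]])
  ultimately show ?thesis
    using has_derivative_compose[of "\<lambda>s. (s, c)" "\<lambda>X. (X, 0)" c UNIV "Bderiv m" D2m] by simp
qed

text \<open>In the identity chart the left-invariant field of \<open>X\<close> is
  \<open>s \<mapsto> Bderiv m (s, c) (0, X)\<close>, with value \<open>X\<close> at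
  \<open>c\<close>. Its derivative in direction \<open>Y\<close> is the mixed second derivative
  \<open>D2m (Y, 0) (0, X)\<close> of the multiplication.\<close>

lemma bracket_eq: "bracket G X Y = D2m (X, 0) (0, Y) - D2m (Y, 0) (0, X)"
proof -
  let ?F = "\<lambda>X u. of_frame A \<e> u (left_inv_field G X (param A \<e> u))"
  have F: "?F X s = Bderiv m (s, c) (0, X)" if "s \<in> cimg A \<e>" for X s
    using left_inv_field_local[OF that] of_frame_to_frame[OF mfdG that] by simp
  have "(?F X has_derivative (\<lambda>Y. D2m (Y, 0) (0, X))) (at c)" for X
  proof (rule has_derivative_transform_within_open[OF _ open_cimg[OF mfdG] c_in])
    show "((\<lambda>s. Bderiv m (s, c) (0, X)) has_derivative (\<lambda>Y. D2m (Y, 0) (0, X))) (at c)"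
      by (rule bounded_linear.has_derivative[OF bounded_linear_apply_blinfun D2m_derivative])
  qed (simp add: F)
  then have "frechet_derivative (?F X) (at c) = (\<lambda>Y. D2m (Y, 0) (0, X))" for X
    by (rule frechet_derivative_at[symmetric])
  moreover have "?F X c = X" for X
    using F[OF c_in] Bderiv_m_c by simp
  ultimately show ?thesis
    unfolding bracket_def lie_bracket_def Let_def c_def[symmetric] by simp
qed

lemma bounded_bilinear_bracket: "bounded_bilinear (bracket G)"
proof -
  have b: "bounded_bilinear (\<lambda>X Y. D2m (X, 0) (0, Y))"
    by (intro bounded_bilinear.comp[OF bounded_bilinear_blinfun_apply] bounded_linear_inr
        bounded_linear_compose[OF blinfun.bounded_linear_right bounded_linear_inl])
  interpret b: bounded_bilinear "\<lambda>X Y. D2m (X, 0) (0, Y)" by (rule b)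
  obtain K where K: "K \<ge> 0" "\<And>X Y. norm (D2m (X, 0) (0, Y)) \<le> norm X * norm Y * K"
    using b.nonneg_bounded by blast
  show ?thesis
  proof
    fix X X' Y Y' r
    show "bracket G (X + X') Y = bracket G X Y + bracket G X' Y"
      "bracket G X (Y + Y') = bracket G X Y + bracket G X Y'"
      by (simp_all add: bracket_eq b.add_left b.add_right)
    show "bracket G (r *\<^sub>R X) Y = r *\<^sub>R bracket G X Y" "bracket G X (r *\<^sub>R Y) = r *\<^sub>R bracket G X Y"
      by (simp_all add: bracket_eq b.scaleR_left b.scaleR_right scaleR_diff_right)
    have "norm (bracket G X Y) \<le> norm X * norm Y * (2 * K)" for X Y
    proof -
      have "norm (bracket G X Y) \<le> norm (D2m (X, 0) (0, Y)) + norm (D2m (Y, 0) (0, X))"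
        unfolding bracket_eq by (rule norm_triangle_ineq4)
      also have "\<dots> \<le> norm X * norm Y * (2 * K)"
        using K(2)[of X Y] K(2)[of Y X] by (simp add: algebra_simps)
      finally show ?thesis .
    qed
    then show "\<exists>K. \<forall>X Y. norm (bracket G X Y) \<le> norm X * norm Y * K" by blast
  qed
qed

lemma bracket_commute: "bracket G X Y = - bracket G Y X"
  by (simp add: bracket_eq)

lemma curvature_eq: "curvature G M \<Theta> p v w = ext_deriv M \<Theta> p v w + bracket G (\<Theta> p v) (\<Theta> p w)"
proof -
  have "wedge_bracket G \<Theta> \<Theta> p v w = 2 *\<^sub>R bracket G (\<Theta> p v) (\<Theta> p w)"
    using bracket_commute[of "\<Theta> p w"] by (simp add: wedge_bracket_def scaleR_2)
  then show ?thesis by (simp add: curvature_def)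
qed

lemma curvature_pullback:
  assumes "smooth_manifold M" "smooth_manifold N" "smooth_map M N f" "smooth_form1 N \<Theta>"
  shows "curvature G M (pullback1 M N f \<Theta>) p v w = curvature G N \<Theta> (f p) (tmap M N f p v) (tmap M N f p w)"
  by (simp add: curvature_eq ext_deriv_pullback[OF assms]) (simp add: pullback1_def)

end

section \<open>Left actions: fundamental vector fields and their brackets\<close>

locale lie_action = lie_grp G
  for G :: "('g::t2_space, 'vg::banach) lie_group" +
  fixes Y :: "('y::t2_space, 'vy::banach) atlas" and l :: "'g \<Rightarrow> 'y \<Rightarrow> 'y"
  assumes mfdY: "smooth_manifold Y" and action: "left_action G Y l"
begin

abbreviation act where "act \<equiv> (\<lambda>(g, y). l g y)"
abbreviation "\<xi> \<equiv> action_field G Y l"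

lemma smooth_act: "smooth_map (A \<times>\<^sub>m Y) Y act"
  and act_unit: "l \<e> y = y" and act_mult: "l (g \<cdot> h) y = l g (l h y)"
  using action unfolding left_action_def by auto

lemma mfdGY: "smooth_manifold (A \<times>\<^sub>m Y)"
  by (intro smooth_manifold_prod mfdG mfdY)

lemma has_tmap_act: "has_tmap (A \<times>\<^sub>m Y) Y act z (tmap (A \<times>\<^sub>m Y) Y act z)"
  by (intro smooth_map_has_tmap mfdGY mfdY smooth_act)

lemma linear_tmap_act: "linear (tmap (A \<times>\<^sub>m Y) Y act z)"
  using has_tmap_linear[OF has_tmap_act] .

lemma has_tmap_translation: "has_tmap Y Y (l g) y (\<lambda>v. tmap (A \<times>\<^sub>m Y) Y act (g, y) (0, v))"
  using has_tmap_compose[OF mfdY mfdGY has_tmap_Pair[OF has_tmap_const has_tmap_ident[OF mfdY]] has_tmap_act]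
  by simp

lemma smooth_translation: "smooth_map Y Y (l g)"
proof (rule smooth_mapI[OF mfdY])
  show cont: "continuous_on UNIV (l g)"
    using continuous_on_compose2[OF smooth_map_continuous[OF smooth_act], of UNIV "\<lambda>y. (g, y)"]
    by (simp add: continuous_on_Pair)
  fix a b
  let ?s = "coord A g g"
  have s: "?s \<in> cimg A g" "param A g ?s = g"
    by (rule center_in_cimg[OF mfdG], rule param_center[OF mfdG])
  \<comment> \<open>With the group coordinate frozen at \<open>?s\<close>, the map
    \<open>u \<mapsto> (?s, u)\<close> is affine, so the affine composition rule suffices.\<close>
  have "smooth_on (ldom Y Y a b (l g)) (\<lambda>u. lrep (A \<times>\<^sub>m Y) Y (g, a) b act ((?s, 0) + (0, u)))"
    using s by (intro smooth_on_compose_affine[OF bounded_linear_inr _ smooth_on_lrep[OF mfdGY smooth_act]])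
      (auto simp: ldom_def cimg_prod param_prod[OF mfdG mfdY])
  then show "smooth_on (ldom Y Y a b (l g)) (lrep Y Y a b (l g))"
    by (rule smooth_on_cong[OF open_ldom[OF mfdY mfdY cont], rotated])
      (use s in \<open>auto simp: ldom_def lrep_def param_prod[OF mfdG mfdY]\<close>)
qed

lemma has_tmap_orbit: "has_tmap A Y (\<lambda>g. l g y) h (\<lambda>v. tmap (A \<times>\<^sub>m Y) Y act (h, y) (v, 0))"
  using has_tmap_compose[OF mfdG mfdGY has_tmap_Pair[OF has_tmap_ident[OF mfdG] has_tmap_const] has_tmap_act]
  by simp

lemma action_field_eq: "\<xi> X y = - tmap (A \<times>\<^sub>m Y) Y act (\<e>, y) (X, 0)"
proof -
  have "\<xi> X y = tmap (A \<times>\<^sub>m Y) Y act (\<e>, y) (- (X, 0))"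
    unfolding action_field_def using tmap_eq[OF has_tmap_orbit[of y \<e>]] by simp
  also have "\<dots> = - tmap (A \<times>\<^sub>m Y) Y act (\<e>, y) (X, 0)"
    by (rule linear_neg[OF linear_tmap_act])
  finally show ?thesis .
qed

lemma linear_action_field: "linear (\<lambda>X. \<xi> X y)"
  unfolding action_field_eq
  using linear_compose[OF has_tmap_linear[OF has_tmap_orbit[of y \<e>]] linear_uminus]
  by (simp add: o_def)

lemma tmap_translation_action_field: "tmap Y Y (l g) y (\<xi> X y) = \<xi> (Ad G g X) (l g y)"
proof -
  have 1: "has_tmap A Y (\<lambda>h. l g (l h y)) \<e> (\<lambda>v. tmap Y Y (l g) y (- \<xi> v y))"
    using has_tmap_compose[OF mfdG mfdY has_tmap_orbit[of y \<e>], of Y "l g" "tmap Y Y (l g) y"]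
      has_tmap_translation[of g y] tmap_eq[OF has_tmap_translation[of g y]]
    by (simp add: act_unit action_field_eq)
  have 2: "has_tmap A Y (\<lambda>h. l (g \<cdot> h \<cdot> inv\<^bsub>G\<^esub> g) (l g y)) \<e> (\<lambda>v. - \<xi> (Ad G g v) (l g y))"
    using has_tmap_compose[OF mfdG mfdG has_tmap_Ad[of g] has_tmap_orbit[of "l g y"]]
    by (simp add: action_field_eq group_laws)
  have "l (g \<cdot> h \<cdot> inv\<^bsub>G\<^esub> g) (l g y) = l g (l h y)" for h
    by (simp add: act_mult[symmetric] group_laws)
  then have "tmap Y Y (l g) y (- \<xi> X y) = - \<xi> (Ad G g X) (l g y)"
    using tmap_eq[OF 1] tmap_eq[OF 2] by (metis (no_types, lifting) ext)
  moreover have "linear (tmap Y Y (l g) y)"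
    using has_tmap_linear[OF has_tmap_translation] tmap_eq[OF has_tmap_translation] by metis
  ultimately show ?thesis by (simp add: linear_neg)
qed

text \<open>Derivative of \<open>l (g \<cdot> h) y = l g (l h y)\<close> in \<open>h\<close> at the
  unit. The element \<open>g\<close> stays free, so that the identity can be differentiated once
  more, in \<open>g\<close>, to reach the bracket.\<close>

lemma tmap_act_left_inv_field:
  "tmap (A \<times>\<^sub>m Y) Y act (g, y) (left_inv_field G X g, 0) = tmap (A \<times>\<^sub>m Y) Y act (g, y) (0, - \<xi> X y)"
proof -
  have 1: "has_tmap A Y (\<lambda>h. l (g \<cdot> h) y) \<e> (\<lambda>v. tmap (A \<times>\<^sub>m Y) Y act (g, y) (left_inv_field G v g, 0))"
    using has_tmap_compose[OF mfdG mfdG has_tmap_left_inv_field[of g] has_tmap_orbit[of y]]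
    by (simp add: group_laws)
  have 2: "has_tmap A Y (\<lambda>h. l g (l h y)) \<e> (\<lambda>v. tmap (A \<times>\<^sub>m Y) Y act (g, y) (0, - \<xi> v y))"
    using has_tmap_compose[OF mfdG mfdY has_tmap_orbit[of y \<e>] has_tmap_translation[of g]]
    by (simp add: act_unit action_field_eq)
  show ?thesis
    using tmap_eq[OF 1] tmap_eq[OF 2] unfolding act_mult by (rule trans[OF sym, THEN fun_cong])
qed

definition "a\<^sub>l a = lrep (A \<times>\<^sub>m Y) Y (\<e>, a) a act"
definition "dom_a a = ldom (A \<times>\<^sub>m Y) Y (\<e>, a) a act"
definition "K a u = Bderiv (Bderiv (a\<^sub>l a)) (c, u)"
text \<open>All action fields at once, in coordinates: an operator from the Lie algebra to the model
  space, depending on the point. The minus sign is that of exp(-tA).\<close>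

definition chart_field :: "'y \<Rightarrow> 'vy \<Rightarrow> 'vg \<Rightarrow>\<^sub>L 'vy" where
  "chart_field a u = - (Bderiv (a\<^sub>l a) (c, u) o\<^sub>L Blinfun (\<lambda>X. (X, 0)))"

lemma chart_field_apply: "chart_field a u X = - Bderiv (a\<^sub>l a) (c, u) (X, 0)"
  by (simp add: chart_field_def blinfun.minus_left bounded_linear_Blinfun_apply[OF bounded_linear_inl])

lemma open_dom_a: "open (dom_a a)" and smooth_a: "smooth_on (dom_a a) (a\<^sub>l a)"
  unfolding dom_a_def a\<^sub>l_def
  by (intro open_ldom smooth_on_lrep mfdGY mfdY smooth_act smooth_map_continuous[OF smooth_act])+

lemma in_dom_a: "u \<in> cimg Y a \<Longrightarrow> (c, u) \<in> dom_a a" and a_c: "u \<in> cimg Y a \<Longrightarrow> a\<^sub>l a (c, u) = u"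
  using c_in by (auto simp: dom_a_def ldom_def a\<^sub>l_def lrep_def cimg_prod param_prod[OF mfdG mfdY] param_c
    act_unit param_in_cdom[OF mfdY] coord_param[OF mfdY])

lemma dom_a_D: "(s, u) \<in> dom_a a \<Longrightarrow> s \<in> cimg A \<e>" "(s, u) \<in> dom_a a \<Longrightarrow> u \<in> cimg Y a"
  by (auto simp: dom_a_def ldom_def cimg_prod)

lemma tmap_act_local:
  assumes "(s, u) \<in> dom_a a"
  shows "tmap (A \<times>\<^sub>m Y) Y act (param A \<e> s, param Y a u) (to_frame A \<e> s v, to_frame Y a u w)
    = to_frame Y a (a\<^sub>l a (s, u)) (Bderiv (a\<^sub>l a) (s, u) (v, w))"
  using tmap_to_frame[OF mfdGY mfdY smooth_act assms[unfolded dom_a_def], of "(v, w)"] dom_a_D[OF assms]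
  by (simp add: a\<^sub>l_def[symmetric] param_prod[OF mfdG mfdY] to_frame_prod[OF mfdG mfdY])

lemma action_field_local:
  assumes u: "u \<in> cimg Y a"
  shows "\<xi> X (param Y a u) = to_frame Y a u (chart_field a u X)"
  using tmap_act_local[OF in_dom_a[OF u], of X 0]
  by (simp add: param_c to_frame_c a_c[OF u] action_field_eq chart_field_apply
      linear_0[OF linear_to_frame[OF mfdY u]] linear_neg[OF linear_to_frame[OF mfdY u]])

lemma smooth_chart_field: "smooth_on (cimg Y a) (chart_field a)"
proof -
  have "smooth_on (cimg Y a) (\<lambda>u. Bderiv (a\<^sub>l a) ((c, 0) + (0, u)))"
    by (rule smooth_on_compose_affine[OF bounded_linear_inr _ smooth_on_Bderiv[OF open_dom_a smooth_a]])
      (simp add: in_dom_a)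
  then show ?thesis
    unfolding chart_field_def[abs_def]
    by (intro smooth_on_minus smooth_on_linear_compose[OF bounded_linear_blinfun_compose_right]) simp
qed

lemma K_has_derivative:
  "u \<in> cimg Y a \<Longrightarrow> (Bderiv (a\<^sub>l a) has_derivative K a u) (at (c, u))"
  unfolding K_def
  by (rule smooth_on_has_derivative[OF open_dom_a smooth_on_Bderiv[OF open_dom_a smooth_a] in_dom_a])

lemma K_commute: "u \<in> cimg Y a \<Longrightarrow> K a u z z' = K a u z' z"
  unfolding K_def by (rule Bderiv_Bderiv_commute[OF open_dom_a smooth_a in_dom_a])

lemma chart_field_has_derivative: "u \<in> cimg Y a \<Longrightarrow> (chart_field a has_derivative Bderiv (chart_field a) u) (at u)"
  by (rule smooth_on_has_derivative[OF open_cimg[OF mfdY] smooth_chart_field])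

lemma Bderiv_chart_field:
  assumes u: "u \<in> cimg Y a"
  shows "Bderiv (chart_field a) u v X = - K a u (0, v) (X, 0)"
proof -
  have 1: "((\<lambda>u. (c, u)) has_derivative (\<lambda>v. (0, v))) (at u)"
    by (auto intro!: derivative_eq_intros)
  have "((\<lambda>u. Bderiv (a\<^sub>l a) (c, u)) has_derivative (\<lambda>v. K a u (0, v))) (at u)"
    using has_derivative_compose[OF 1 K_has_derivative[OF u]] .
  from has_derivative_minus[OF bounded_linear.has_derivative[OF bounded_linear_apply_blinfun this, of "(X, 0)"]]
  have "((\<lambda>u. chart_field a u X) has_derivative (\<lambda>v. - K a u (0, v) (X, 0))) (at u)"
    by (simp add: chart_field_apply)
  moreover have "((\<lambda>u. chart_field a u X) has_derivative (\<lambda>v. Bderiv (chart_field a) u v X)) (at u)"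
    by (rule bounded_linear.has_derivative[OF bounded_linear_apply_blinfun chart_field_has_derivative[OF u]])
  ultimately show ?thesis
    by (metis has_derivative_unique)
qed

lemma K_derivative_group:
  assumes u: "u \<in> cimg Y a"
  shows "((\<lambda>s. Bderiv (a\<^sub>l a) (s, u)) has_derivative (\<lambda>X. K a u (X, 0))) (at c)"
proof -
  have 1: "((\<lambda>s. (s, u)) has_derivative (\<lambda>X. (X, 0))) (at c)"
    by (auto intro!: derivative_eq_intros)
  show ?thesis
    using has_derivative_compose[OF 1 K_has_derivative[OF u]] .
qed

lemma open_slice: "open {s. (s, u) \<in> dom_a a}"
proof -
  have "{s. (s, u) \<in> dom_a a} = (\<lambda>s. (s, u)) -` dom_a a" by auto
  moreover have "open ((\<lambda>s. (s, u)) -` dom_a a)"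
    by (intro open_vimage open_dom_a continuous_intros)
  ultimately show ?thesis by simp
qed

text \<open>The right side is the coordinate expression of the vector field bracket of
  \<open>\<xi> X\<close> and \<open>\<xi> X'\<close>, so this says that \<xi> is a Lie algebra
  homomorphism. It is the derivative of \<open>tmap_act_left_inv_field\<close> in the group
  variable, antisymmetrised; the pure group part of the second derivative of the action is symmetric
  and cancels.\<close>

lemma chart_field_bracket:
  assumes u: "u \<in> cimg Y a"
  shows "chart_field a u (bracket G X X') = Bderiv (chart_field a) u (chart_field a u X) X' - Bderiv (chart_field a) u (chart_field a u X') X"
proof -
  let ?a1 = "Bderiv (a\<^sub>l a) (c, u)"
  \<comment> \<open>This is \<open>tmap_act_left_inv_field\<close> in coordinates with the frame
    removed. It holds for all \<open>s\<close> in a neighbourhood of \<open>c\<close>, so it may be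
    differentiated in \<open>s\<close>.\<close>
  have eq: "Bderiv (a\<^sub>l a) (s, u) (Bderiv m (s, c) (0, Z), 0) = Bderiv (a\<^sub>l a) (s, u) (0, ?a1 (Z, 0))"
    if s: "(s, u) \<in> dom_a a" for s Z
  proof -
    have s': "s \<in> cimg A \<e>" using dom_a_D[OF s] by blast
    have w: "a\<^sub>l a (s, u) \<in> cimg Y a"
      using s by (auto simp: dom_a_def ldom_def a\<^sub>l_def lrep_def coord_in_cimg)
    have "to_frame Y a (a\<^sub>l a (s, u)) (Bderiv (a\<^sub>l a) (s, u) (Bderiv m (s, c) (0, Z), 0))
        = to_frame Y a (a\<^sub>l a (s, u)) (Bderiv (a\<^sub>l a) (s, u) (0, - chart_field a u Z))"
      unfolding tmap_act_local[OF s, symmetric]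
      using tmap_act_left_inv_field[of "param A \<e> s" "param Y a u" Z]
      by (simp add: left_inv_field_local[OF s'] action_field_local[OF u]
          linear_0[OF linear_to_frame[OF mfdY u]] linear_0[OF linear_to_frame[OF mfdG s']]
          linear_neg[OF linear_to_frame[OF mfdY u]])
    then show ?thesis
      using of_frame_to_frame[OF mfdY w] by (metis chart_field_apply minus_minus)
  qed
  \<comment> \<open>Both sides of \<open>eq\<close> are differentiated at \<open>s = c\<close> in
    the direction \<open>X\<close>; \<open>Bderiv_m_c\<close> simplifies the term in which the outer
    factor is differentiated.\<close>
  have D: "?a1 (D2m (X, 0) (0, Z), 0) = K a u (X, 0) (0, ?a1 (Z, 0)) - K a u (X, 0) (Z, 0)" for X Z
  proof -
    have "((\<lambda>s. Bderiv (a\<^sub>l a) (s, u) (Bderiv m (s, c) (0, Z), 0)) has_derivative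
        (\<lambda>X. ?a1 (D2m (X, 0) (0, Z), 0) + K a u (X, 0) (Bderiv m (c, c) (0, Z), 0))) (at c)"
      by (intro bounded_bilinear.FDERIV[OF bounded_bilinear_blinfun_apply K_derivative_group[OF u]]
          bounded_linear.has_derivative[OF bounded_linear_inl]
          bounded_linear.has_derivative[OF bounded_linear_apply_blinfun D2m_derivative])
    then have 1: "((\<lambda>s. Bderiv (a\<^sub>l a) (s, u) (Bderiv m (s, c) (0, Z), 0)) has_derivative
        (\<lambda>X. ?a1 (D2m (X, 0) (0, Z), 0) + K a u (X, 0) (Z, 0))) (at c)"
      by (simp add: Bderiv_m_c)
    have "((\<lambda>s. Bderiv (a\<^sub>l a) (s, u) (0, ?a1 (Z, 0))) has_derivative
        (\<lambda>X. K a u (X, 0) (0, ?a1 (Z, 0)))) (at c)"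
      by (rule bounded_linear.has_derivative[OF bounded_linear_apply_blinfun K_derivative_group[OF u]])
    then have 2: "((\<lambda>s. Bderiv (a\<^sub>l a) (s, u) (Bderiv m (s, c) (0, Z), 0)) has_derivative
        (\<lambda>X. K a u (X, 0) (0, ?a1 (Z, 0)))) (at c)"
      by (rule has_derivative_transform_within_open[OF _ open_slice[of u a]])
        (use in_dom_a[OF u] eq in auto)
    from has_derivative_unique[OF 1 2] have "?a1 (D2m (X, 0) (0, Z), 0) + K a u (X, 0) (Z, 0) = K a u (X, 0) (0, ?a1 (Z, 0))"
      by (rule fun_cong)
    then show ?thesis by (simp add: algebra_simps)
  qed
  have neg: "(0, - x) = - (0 :: 'vg, x)" for x :: 'vy by simp
  have "?a1 (bracket G X X', 0) = ?a1 ((D2m (X, 0) (0, X'), 0) - (D2m (X', 0) (0, X), 0))"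
    by (simp add: bracket_eq)
  also have "\<dots> = K a u (X, 0) (0, ?a1 (X', 0)) - K a u (X', 0) (0, ?a1 (X, 0))"
    unfolding blinfun.diff_right D using K_commute[OF u, of "(X, 0)" "(X', 0)"] by simp
  finally show ?thesis
    unfolding Bderiv_chart_field[OF u] chart_field_apply neg blinfun.minus_right blinfun.minus_left
    using K_commute[OF u, of "(X, 0)"] K_commute[OF u, of "(X', 0)"] by simp
qed

end

section \<open>Invariant one-forms: vanishing Lie derivative and Cartan's formula\<close>

locale invariant_form = lie_action G Y l
  for G :: "('g::t2_space, 'vg::banach) lie_group"
    and Y :: "('y::t2_space, 'vy::banach) atlas" and l +
  fixes \<Theta> :: "('y, 'vy, 'k::banach) form1"
  assumes \<Theta>: "smooth_form1 Y \<Theta>" and inv: "preserves_form1 Y l \<Theta>"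
begin

abbreviation "\<theta> \<equiv> \<lambda>a. lform Y a \<Theta>"

text \<open>Coordinate form of the vanishing Lie derivative of \<Theta> along
  \<open>\<xi> X\<close>. By invariance, the pull-back of \<Theta> under translation by
  \<open>param A \<e> s\<close>, evaluated on the fixed vector \<open>v\<close>, is constant in
  \<open>s\<close>; the identity is its derivative at \<open>s = c\<close>, up to sign.\<close>

lemma lie_derivative_zero:
  assumes u: "u \<in> cimg Y a"
  shows "Bderiv (\<theta> a) u (chart_field a u X) v + \<theta> a u (Bderiv (chart_field a) u v X) = 0"
proof -
  have eq: "\<theta> a (a\<^sub>l a (s, u)) (Bderiv (a\<^sub>l a) (s, u) (0, v)) = \<theta> a u v" if s: "(s, u) \<in> dom_a a" for s v
  proof -
    let ?g = "param A \<e> s" and ?y = "param Y a u"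
    have s': "s \<in> cimg A \<e>" using dom_a_D[OF s] by blast
    have w: "a\<^sub>l a (s, u) \<in> cimg Y a" "param Y a (a\<^sub>l a (s, u)) = l ?g ?y"
      using s by (auto simp: dom_a_def ldom_def a\<^sub>l_def lrep_def coord_in_cimg cimg_prod
          param_prod[OF mfdG mfdY] param_coord[OF mfdY])
    have "pullback1 Y Y (l ?g) \<Theta> ?y (to_frame Y a u v) = \<Theta> ?y (to_frame Y a u v)"
      using inv by (simp add: preserves_form1_def)
    then have "\<Theta> (l ?g ?y) (tmap (A \<times>\<^sub>m Y) Y act (?g, ?y) (0, to_frame Y a u v)) = \<Theta> ?y (to_frame Y a u v)"
      by (simp add: pullback1_def tmap_eq[OF has_tmap_translation])
    then show ?thesis
      using tmap_act_local[OF s, of 0 v]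
      by (simp add: lform_apply[OF mfdY \<Theta>] w u local1_def linear_0[OF linear_to_frame[OF mfdG s']])
  qed
  \<comment> \<open>The unit acts as the identity, so the partial derivative of the action in the
    \<open>Y\<close> variable is the identity there.\<close>
  have a1: "Bderiv (a\<^sub>l a) (c, u) (0, v) = v"
  proof -
    have "\<And>v. tmap (A \<times>\<^sub>m Y) Y act (\<e>, param Y a u) (0, v) = v"
      using has_derivative_unique has_tmap_translation[of \<e> "param Y a u"] has_tmap_ident[OF mfdY, of "param Y a u"]
      unfolding act_unit[abs_def] by (metis tmap_eq)
    then have "to_frame Y a u (Bderiv (a\<^sub>l a) (c, u) (0, v)) = to_frame Y a u v"
      using tmap_act_local[OF in_dom_a[OF u], of 0 v] by (simp add: param_c a_c[OF u] to_frame_c)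
    then show ?thesis using of_frame_to_frame[OF mfdY u] by metis
  qed
  have pt: "((\<lambda>s. (s, u)) has_derivative (\<lambda>X. (X, 0))) (at c)"
    by (auto intro!: derivative_eq_intros)
  have "(a\<^sub>l a has_derivative Bderiv (a\<^sub>l a) (c, u)) (at (c, u))"
    by (rule smooth_on_has_derivative[OF open_dom_a smooth_a in_dom_a[OF u]])
  from has_derivative_compose[OF pt this]
  have al: "((\<lambda>s. a\<^sub>l a (s, u)) has_derivative (\<lambda>X. Bderiv (a\<^sub>l a) (c, u) (X, 0))) (at c)" .
  have "(\<theta> a has_derivative Bderiv (\<theta> a) u) (at (a\<^sub>l a (c, u)))"
    using lform_has_derivative[OF mfdY \<Theta> u] by (simp add: a_c[OF u])
  from has_derivative_compose[OF al this]
  have th: "((\<lambda>s. \<theta> a (a\<^sub>l a (s, u))) has_derivative (\<lambda>X. Bderiv (\<theta> a) u (Bderiv (a\<^sub>l a) (c, u) (X, 0)))) (at c)" .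
  have 1: "((\<lambda>s. \<theta> a (a\<^sub>l a (s, u)) (Bderiv (a\<^sub>l a) (s, u) (0, v))) has_derivative
      (\<lambda>X. \<theta> a (a\<^sub>l a (c, u)) (K a u (X, 0) (0, v))
        + Bderiv (\<theta> a) u (Bderiv (a\<^sub>l a) (c, u) (X, 0)) (Bderiv (a\<^sub>l a) (c, u) (0, v)))) (at c)"
    by (rule bounded_bilinear.FDERIV[OF bounded_bilinear_blinfun_apply th
        bounded_linear.has_derivative[OF bounded_linear_apply_blinfun K_derivative_group[OF u]]])
  have 2: "((\<lambda>s. \<theta> a (a\<^sub>l a (s, u)) (Bderiv (a\<^sub>l a) (s, u) (0, v))) has_derivative (\<lambda>X. 0)) (at c)"
    by (rule has_derivative_transform_within_open[OF has_derivative_const[of "\<theta> a u v"] open_slice[of u a]])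
      (use in_dom_a[OF u] eq in auto)
  from fun_cong[OF has_derivative_unique[OF 1 2], of X] show ?thesis
    unfolding Bderiv_chart_field[OF u] a1 a_c[OF u] K_commute[OF u, of "(X, 0)"] chart_field_apply
    by (simp add: blinfun.minus_left blinfun.minus_right algebra_simps)
      (metis add.commute neg_eq_iff_add_eq_0)
qed

text \<open>The moment map of \<Theta> in the chart \<open>a\<close>, sending \<open>X\<close> to
  \<Theta>(\<xi> X); operator-valued so that it can be composed with a Lie algebra valued
  form.\<close>

definition "moment a u = \<theta> a u o\<^sub>L chart_field a u"

text \<open>Cartan's formula: in the product rule, \<open>lie_derivative_zero\<close> replaces the
  term that differentiates the field by the missing half of d\<Theta>.\<close>

lemma moment_has_derivative:
  assumes u: "u \<in> cimg Y a"
  shows "(moment a has_derivative Bderiv (moment a) u) (at u)"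
    and "Bderiv (moment a) u v X = chart_ext_deriv (\<theta> a) u v (chart_field a u X)"
proof -
  have D: "(moment a has_derivative (\<lambda>v. (\<theta> a u o\<^sub>L Bderiv (chart_field a) u v) + (Bderiv (\<theta> a) u v o\<^sub>L chart_field a u))) (at u)"
    unfolding moment_def[abs_def]
    by (rule bounded_bilinear.FDERIV[OF bounded_bilinear_blinfun_compose
        lform_has_derivative[OF mfdY \<Theta> u] chart_field_has_derivative[OF u]])
  have d: "moment a differentiable at u"
    by (rule differentiableI[OF D])
  have eq: "blinfun_apply (Bderiv (moment a) u) = (\<lambda>v. (\<theta> a u o\<^sub>L Bderiv (chart_field a) u v) + (Bderiv (\<theta> a) u v o\<^sub>L chart_field a u))"
    by (rule has_derivative_unique[OF has_derivative_Bderiv[OF d] D])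
  show "(moment a has_derivative Bderiv (moment a) u) (at u)"
    by (rule has_derivative_Bderiv[OF d])
  show "Bderiv (moment a) u v X = chart_ext_deriv (\<theta> a) u v (chart_field a u X)"
  proof -
    have *: "y + z = z - x" if "x + y = 0" for x y z :: 'k
    proof -
      have "y = - x" using that by (simp add: add_eq_0_iff)
      then show ?thesis by simp
    qed
    show ?thesis
      unfolding eq chart_ext_deriv_def blinfun.add_left blinfun_apply_blinfun_compose
      by (rule *) (rule lie_derivative_zero[OF u])
  qed
qed

text \<open>Each half of d\<Theta> differentiates \<Theta> along an action field. Moving both
  derivatives onto the fields by \<open>lie_derivative_zero\<close> leaves \<Theta> of their
  bracket, and \<open>chart_field_bracket\<close> identifies it.\<close>

lemma chart_ext_deriv_fields:
  assumes u: "u \<in> cimg Y a"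
  shows "chart_ext_deriv (\<theta> a) u (chart_field a u X) (chart_field a u X') = \<theta> a u (chart_field a u (bracket G X X'))"
proof -
  have *: "x = - y" if "x + y = 0" for x y :: 'k
    using that by (simp add: eq_neg_iff_add_eq_0)
  show ?thesis
    unfolding chart_field_bracket[OF u] blinfun.diff_right chart_ext_deriv_def
    using *[OF lie_derivative_zero[OF u, of X' "chart_field a u X"]] *[OF lie_derivative_zero[OF u, of X "chart_field a u X'"]]
    by simp
qed

end

section \<open>The Weil element of an invariant connection\<close>

locale invariant_connection = invariant_form G Y l \<Theta> + H: lie_grp H
  for G :: "('g::t2_space, 'vg::banach) lie_group"
    and Y :: "('y::t2_space, 'vy::banach) atlas" and l
    and \<Theta> :: "('y, 'vy, 'k::banach) form1"
    and H :: "('h::t2_space, 'k) lie_group"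
begin

abbreviation "\<Omega> \<equiv> curvature H Y \<Theta>"

definition "Om a u v w = chart_ext_deriv (\<theta> a) u v w + bracket H (\<theta> a u v) (\<theta> a u w)"

lemma curvature_local: "u \<in> cimg Y a \<Longrightarrow> local2 Y a \<Omega> u v w = Om a u v w"
  using local2_ext_deriv[OF mfdY \<Theta>, of u a v w]
  by (simp add: Om_def local2_def H.curvature_eq lform_apply[OF mfdY \<Theta>] local1_def)

lemma curvature_center: "\<Omega> p v w = Om p (coord Y p p) v w"
  using curvature_local[OF center_in_cimg[OF mfdY]] local2_center[OF mfdY] by metis

lemma curvature_action_fields_local:
  assumes u: "u \<in> cimg Y a"
  shows "\<Omega> (param Y a u) (\<xi> X (param Y a u)) (to_frame Y a u v) = Om a u (chart_field a u X) v"
  using curvature_local[OF u] by (simp add: local2_def action_field_local[OF u])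

text \<open>The general base point map \<open>L\<close> and arguments \<open>V\<close>,
  \<open>W\<close> let one lemma cover the coefficients of form degree 2, 1 and 0 built from
  \<Omega> in \<open>curvature_weil\<close>.\<close>

lemma smooth_Om:
  assumes L: "bounded_linear L" "\<And>z. z \<in> T \<Longrightarrow> L z \<in> cimg Y a"
    and V: "smooth_on T V" and W: "smooth_on T W"
  shows "smooth_on T (\<lambda>z. Om a (L z) (V z) (W z))"
proof -
  note bl = smooth_on_bilinear[OF bounded_bilinear_blinfun_apply]
  have th: "smooth_on T (\<lambda>z. \<theta> a (L z))"
    by (rule smooth_on_compose_linear[OF L smooth_on_lform[OF mfdY \<Theta>]])
  have D: "smooth_on T (\<lambda>z. Bderiv (\<theta> a) (L z))"
    by (rule smooth_on_compose_linear[OF L smooth_on_Bderiv[OF open_cimg[OF mfdY] smooth_on_lform[OF mfdY \<Theta>]]])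
  show ?thesis
    unfolding Om_def chart_ext_deriv_def
    by (rule smooth_on_add[OF smooth_on_diff[OF bl[OF bl[OF D V] W] bl[OF bl[OF D W] V]]
          smooth_on_bilinear[OF H.bounded_bilinear_bracket bl[OF th V] bl[OF th W]]])
qed

sublocale br: bounded_bilinear "bracket H"
  by (rule H.bounded_bilinear_bracket)

lemma bilinear_curvature: "bilinear (\<Omega> p)"
  unfolding bilinear_def curvature_center Om_def chart_ext_deriv_def
  by (intro conjI allI linearI)
    (simp_all add: blinfun.add_left blinfun.add_right blinfun.scaleR_left blinfun.scaleR_right
      br.add_left br.add_right br.scaleR_left br.scaleR_right algebra_simps)

lemma Om_alternating: "Om a u v w = - Om a u w v"
  unfolding Om_def chart_ext_deriv_def using H.bracket_commute[of "\<theta> a u v"] by simp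

lemma curvature_alternating: "\<Omega> p v w = - \<Omega> p w v"
  unfolding curvature_center by (rule Om_alternating)

lemma curvature_self: "\<Omega> p v v = 0"
  unfolding curvature_center Om_def chart_ext_deriv_def using H.bracket_eq by simp

lemma linear_curvature: "linear (\<Omega> p v)" "linear (\<lambda>v. \<Omega> p v w)"
  using bilinear_curvature unfolding bilinear_def by blast+

lemma linear_form: "linear (\<Theta> p)"
  using \<Theta> unfolding smooth_form1_def by blast

lemma form_translation: "\<Theta> (l g y) (tmap Y Y (l g) y v) = \<Theta> y v"
  using inv unfolding preserves_form1_def by (metis pullback1_def)

lemma curvature_translation: "\<Omega> (l g y) (tmap Y Y (l g) y v) (tmap Y Y (l g) y w) = \<Omega> y v w"
proof -
  have "smooth_map Y Y (l g)"
    by (rule smooth_translation)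
  from H.curvature_pullback[OF mfdY mfdY this \<Theta>, symmetric] show ?thesis
    using inv by (simp add: preserves_form1_def)
qed

text \<open>The parts \<open>w\<theta>\<close> and \<open>w\<theta>\<theta>\<close> are solved from
  the equations of \<open>weil_horizontal\<close>. After substitution they supply the cross terms
  and the quadratic term that complete \<Omega>(v, v') to \<Omega>(v - \<xi> (\<phi> u), v' - \<xi>
  (\<phi> u')).\<close>

definition curvature_weil :: "('vg, 'y, 'vy, 'k) weil2" where
  "curvature_weil = \<lparr> w\<Omega> = \<Omega>, w\<theta> = (\<lambda>X y v. - \<Omega> y (\<xi> X y) v),
     w\<theta>\<theta> = (\<lambda>X X' y. \<Omega> y (\<xi> X y) (\<xi> X' y)), w\<nu> = (\<lambda>X y. - \<Theta> y (\<xi> X y)) \<rparr>"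

lemma weil_element_curvature: "weil_element Y curvature_weil"
proof -
  have oU: "open (cimg Y a)" for a
    by (rule open_cimg[OF mfdY])
  have f2: "smooth_form2 Y \<Omega>"
    unfolding smooth_form2_def cimg_def[symmetric]
  proof (intro conjI allI bilinear_curvature curvature_self)
    fix a
    have "smooth_on (cimg Y a \<times> UNIV) (\<lambda>z. Om a (fst z) (fst (snd z)) (snd (snd z)))"
      by (rule smooth_Om) (auto intro: smooth_on_bounded_linear bounded_linear_fst
          bounded_linear_fst_comp bounded_linear_snd_comp bounded_linear_snd)
    then show "smooth_on (cimg Y a \<times> UNIV) (\<lambda>(u, v, w). local2 Y a \<Omega> u v w)"
      by (rule smooth_on_cong[OF open_Times[OF oU open_UNIV], rotated]) (auto simp: curvature_local)
  qed
  have chart_field: "smooth_on (cimg Y a) (\<lambda>u. chart_field a u X)" for a X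
    by (rule smooth_on_linear_compose[OF bounded_linear_apply_blinfun smooth_chart_field])
  have f1: "smooth_form1 Y (\<lambda>y v. - \<Omega> y (\<xi> X y) v)" for X
    unfolding smooth_form1_def cimg_def[symmetric]
  proof (intro conjI allI)
    show "linear (\<lambda>v. - \<Omega> p (\<xi> X p) v)" for p
      using linear_compose[OF linear_curvature(1) linear_uminus] by (simp add: o_def)
    fix a
    have "smooth_on (cimg Y a \<times> UNIV) (\<lambda>z. - Om a (fst z) (chart_field a (fst z) X) (snd z))"
      by (intro smooth_on_minus smooth_Om bounded_linear_fst smooth_on_bounded_linear[OF bounded_linear_snd]
          smooth_on_compose_linear[OF bounded_linear_fst _ chart_field]) auto
    then show "smooth_on (cimg Y a \<times> UNIV) (\<lambda>(u, v). local1 Y a (\<lambda>y v. - \<Omega> y (\<xi> X y) v) u v)"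
      by (rule smooth_on_cong[OF open_Times[OF oU open_UNIV], rotated])
        (auto simp: local1_def curvature_action_fields_local)
  qed
  have f00: "smooth_form0 Y (\<lambda>y. \<Omega> y (\<xi> X y) (\<xi> X' y))" for X X'
    unfolding smooth_form0_def cimg_def[symmetric]
  proof
    fix a
    have "smooth_on (cimg Y a) (\<lambda>u. Om a u (chart_field a u X) (chart_field a u X'))"
      by (rule smooth_Om[OF bounded_linear_ident _ chart_field chart_field])
    then show "smooth_on (cimg Y a) ((\<lambda>y. \<Omega> y (\<xi> X y) (\<xi> X' y)) \<circ> param Y a)"
      by (rule smooth_on_cong[OF oU, rotated])
        (simp add: curvature_action_fields_local[symmetric] action_field_local)
  qed
  have f0: "smooth_form0 Y (\<lambda>y. - \<Theta> y (\<xi> X y))" for X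
    unfolding smooth_form0_def cimg_def[symmetric]
  proof
    fix a
    have "smooth_on (cimg Y a) (\<lambda>u. - \<theta> a u (chart_field a u X))"
      by (intro smooth_on_minus smooth_on_bilinear[OF bounded_bilinear_blinfun_apply]
          smooth_on_lform[OF mfdY \<Theta>] chart_field)
    then show "smooth_on (cimg Y a) ((\<lambda>y. - \<Theta> y (\<xi> X y)) \<circ> param Y a)"
      by (rule smooth_on_cong[OF oU, rotated])
        (simp add: lform_apply[OF mfdY \<Theta>] local1_def action_field_local)
  qed
  have lin1: "linear (\<lambda>X. \<Omega> y (\<xi> X y) v)" and lin2: "linear (\<lambda>X. \<Omega> y v (\<xi> X y))"
    and lin3: "linear (\<lambda>X. - \<Omega> y (\<xi> X y) v)" and lin4: "linear (\<lambda>X. - \<Theta> y (\<xi> X y))" for y v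
    using linear_compose[OF linear_action_field[of y] linear_curvature(2)]
      linear_compose[OF linear_action_field[of y] linear_curvature(1)]
      linear_compose[OF linear_compose[OF linear_action_field[of y] linear_curvature(2)] linear_uminus]
      linear_compose[OF linear_compose[OF linear_action_field[of y] linear_form] linear_uminus]
    by (simp_all add: o_def)
  show ?thesis
    unfolding weil_element_def curvature_weil_def weil2.simps bilinear_def
    using f2 f1 f00 f0 lin1 lin2 lin3 lin4 curvature_self by blast
qed

text \<open>Translation by \<open>g\<close> carries \<open>\<xi> A\<close> to
  \<open>\<xi> (Ad G g A)\<close>, which matches the \<open>Ad\<close> twist of the generators;
  \<Theta> and \<Omega> are themselves invariant. Horizontality reduces to antisymmetry of
  \<Omega>.\<close>

lemma weil_basic_curvature: "weil_basic G Y l curvature_weil"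
proof -
  have "weil_invariant G Y l curvature_weil"
    unfolding weil_invariant_def curvature_weil_def weil2.simps pullback1_def pullback2_def comp_def
    by (simp add: fun_eq_iff curvature_translation tmap_translation_action_field[symmetric] form_translation)
  moreover have "weil_horizontal G Y l curvature_weil"
  proof -
    have "\<Omega> y v w + \<Omega> y w v = 0" for y v w
      using curvature_alternating[of y v w] by simp
    then show ?thesis
      unfolding weil_horizontal_def curvature_weil_def weil2.simps by simp
  qed
  ultimately show ?thesis
    unfolding weil_basic_def using weil_element_curvature by blast
qed

text \<open>The basis-free coefficient \<open>w\<nu>\<close> is matched with the indexed formula by
  expanding \<open>X\<close> in \<open>e\<close>, since \<Theta>(\<xi> X) is linear in
  \<open>X\<close>.\<close>

lemma weil_to_cartan_curvature:
  assumes e: "is_basis e"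
  shows "weil_to_cartan curvature_weil =
    (\<Omega>, \<lambda>X p. - (\<Sum>a\<in>e. dual_basis e a X *\<^sub>R contraction (\<xi> a) \<Theta> p))"
proof -
  have *: "\<Theta> p (\<xi> X p) = (\<Sum>a\<in>e. representation e X a *\<^sub>R \<Theta> p (\<xi> a p))" for X p
  proof -
    have X: "X = (\<Sum>a\<in>e. representation e X a *\<^sub>R a)"
      using e real_vector.sum_representation_eq[of e X e] unfolding is_basis_def by auto
    have lin: "linear (\<lambda>X. \<Theta> p (\<xi> X p))"
      using linear_compose[OF linear_action_field[of p] linear_form[of p]] by (simp add: o_def)
    have "\<Theta> p (\<xi> X p) = \<Theta> p (\<xi> (\<Sum>a\<in>e. representation e X a *\<^sub>R a) p)"
      using X by simp
    then show ?thesis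
      using linear_sum[OF lin, of "\<lambda>a. representation e X a *\<^sub>R a" e] linear_scale[OF lin] by simp
  qed
  have "(\<lambda>X p. - \<Theta> p (\<xi> X p)) = (\<lambda>X p. - (\<Sum>a\<in>e. representation e X a *\<^sub>R \<Theta> p (\<xi> a p)))"
    by (intro ext arg_cong[where f = uminus] *)
  then show ?thesis
    by (simp add: weil_to_cartan_def curvature_weil_def dual_basis_def contraction_def)
qed

end

text \<open>The Cartan image retains \<open>w\<Omega>\<close> and \<open>w\<nu>\<close>; the first
  horizontality equation recovers \<open>w\<theta>\<close> from \<open>w\<Omega>\<close>, and the
  second then recovers \<open>w\<theta>\<theta>\<close> from \<open>w\<theta>\<close>.\<close>

lemma weil_horizontal_unique:
  assumes "weil_horizontal G Y l w" "weil_horizontal G Y l w'" "weil_to_cartan w = weil_to_cartan w'"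
  shows "w = w'"
proof -
  have *: "w\<theta> w = (\<lambda>X y v. - w\<Omega> w y (action_field G Y l X y) v)"
    "w\<theta>\<theta> w = (\<lambda>X X' y. w\<theta> w X' y (action_field G Y l X y))"
    if "weil_horizontal G Y l w" for w
    using that unfolding weil_horizontal_def by (auto simp: fun_eq_iff eq_neg_iff_add_eq_0 add.commute)
  have "w\<Omega> w = w\<Omega> w'" "w\<nu> w = w\<nu> w'"
    using assms(3) by (auto simp: weil_to_cartan_def)
  then show ?thesis
    using *[OF assms(1)] *[OF assms(2)] by (intro weil2.equality) auto
qed

section \<open>The induced connection and its curvature\<close>

context lie_grp
begin

lemma has_tmap_right_orbit:
  assumes Y: "smooth_manifold Y" and r: "right_action G Y r"
  shows "has_tmap A Y (r y) \<e> (tmap A Y (r y) \<e>)"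
proof -
  have "smooth_map (Y \<times>\<^sub>m A) Y (\<lambda>(y, g). r y g)"
    using r unfolding right_action_def by blast
  from has_tmap_compose[OF mfdG smooth_manifold_prod[OF Y mfdG]
      has_tmap_Pair[OF has_tmap_const has_tmap_ident[OF mfdG]]
      smooth_map_has_tmap[OF smooth_manifold_prod[OF Y mfdG] Y this]]
  have "has_tmap A Y (r y) \<e> (\<lambda>v. tmap (Y \<times>\<^sub>m A) Y (\<lambda>(y, g). r y g) (y, \<e>) (0, v))"
    by simp
  with tmap_eq[OF this] show ?thesis by simp
qed

end

locale associated_connection = invariant_connection G "total P" lP \<Theta> H
  for G :: "('g::t2_space, 'vg::banach) lie_group" and H :: "('h::t2_space, 'vh::banach) lie_group"
    and P :: "('p::t2_space, 'vp::banach, 'x::t2_space, 'vx::banach, 'h) pbundle"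
    and \<Theta> :: "('p, 'vp, 'vh) form1" and lP :: "'g \<Rightarrow> 'p \<Rightarrow> 'p" +
  fixes lX :: "'g \<Rightarrow> 'x \<Rightarrow> 'x"
    and Q :: "('q::t2_space, 'vq::banach, 'm::t2_space, 'vm::banach, 'g) pbundle"
    and \<phi> :: "('q, 'vq, 'vg) form1"
    and E :: "('e::t2_space, 've::banach, 'b::t2_space, 'vb::banach, 'h) pbundle"
    and \<kappa> \<kappa>X and \<Theta>Q :: "('e, 've, 'vh) form1"
  assumes P: "principal_bundle H P" and conn: "connection H P \<Theta>"
    and BG: "BG_object G Q \<phi>" and assoc: "associated_bundle G H P lP lX Q E \<kappa> \<kappa>X"
    and induced: "induced_connection H P \<Theta> Q \<phi> E \<kappa> \<Theta>Q"
begin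

abbreviation "N \<equiv> total Q \<times>\<^sub>m total P"

lemma mfdQ: "smooth_manifold (total Q)" and mfdM: "smooth_manifold (base Q)"
  and mfdE: "smooth_manifold (total E)"
  and smooth_proj: "smooth_map (total Q) (base Q) (proj Q)"
  and right_Q: "right_action G (total Q) (ract Q)"
  and right_P: "right_action H (total P) (ract P)"
  and smooth_\<kappa>: "smooth_map N (total E) \<kappa>"
  and form_\<phi>: "smooth_form1 (total Q) \<phi>"
  and form_\<Theta>Q: "smooth_form1 (total E) \<Theta>Q"
  using BG assoc induced P
  unfolding BG_object_def associated_bundle_def induced_connection_def principal_bundle_def
    borel_bundle_def connection_def by auto

lemma mfdN: "smooth_manifold N"
  by (intro smooth_manifold_prod mfdQ mfdY)

lemma \<kappa>_shift: "\<kappa> (ract Q q g, p) = \<kappa> (q, lP g p)"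
proof -
  have "\<kappa> (ract Q q g, lP (inv\<^bsub>G\<^esub> g) (lP g p)) = \<kappa> (q, lP g p)"
    using assoc unfolding associated_bundle_def principal_bundle_def borel_bundle_def by auto
  then show ?thesis
    by (simp add: act_mult[symmetric] group_laws act_unit)
qed

abbreviation "T\<kappa> \<equiv> tmap N (total E) \<kappa>"

lemma has_tmap_\<kappa>: "has_tmap N (total E) \<kappa> z (T\<kappa> z)"
  by (intro smooth_map_has_tmap mfdN mfdE smooth_\<kappa>)

lemma linear_T\<kappa>: "linear (T\<kappa> z)"
  using has_tmap_linear[OF has_tmap_\<kappa>] .

text \<open>Differentiating \<open>\<kappa>_shift\<close> in \<open>g\<close> at the unit gives
  equal images for the vectors (vertical X, 0) and (0, -\<xi> X).\<close>

lemma T\<kappa>_vertical: "T\<kappa> (q, p) (tmap A (total Q) (ract Q q) \<e> X, \<xi> X p) = 0"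
proof -
  have "has_tmap A (total E) (\<lambda>h. \<kappa> (ract Q q h, p)) \<e>
      (\<lambda>v. T\<kappa> (q, p) (tmap A (total Q) (ract Q q) \<e> v, 0))"
    using has_tmap_compose[OF mfdG mfdN has_tmap_Pair[OF has_tmap_right_orbit[OF mfdQ right_Q] has_tmap_const]
        has_tmap_\<kappa>, of q p] right_Q
    by (simp add: right_action_def)
  moreover have "has_tmap A (total E) (\<lambda>h. \<kappa> (q, lP h p)) \<e> (\<lambda>v. T\<kappa> (q, p) (0, - \<xi> v p))"
    using has_tmap_compose[OF mfdG mfdN has_tmap_Pair[OF has_tmap_const has_tmap_orbit] has_tmap_\<kappa>, of q p \<e>]
    by (simp add: act_unit action_field_eq)
  ultimately have "T\<kappa> (q, p) (tmap A (total Q) (ract Q q) \<e> X, 0) = T\<kappa> (q, p) (0, - \<xi> X p)"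
    unfolding \<kappa>_shift using tmap_eq by (metis (no_types, lifting))
  moreover have "T\<kappa> (q, p) (tmap A (total Q) (ract Q q) \<e> X, \<xi> X p)
      = T\<kappa> (q, p) (tmap A (total Q) (ract Q q) \<e> X, 0) - T\<kappa> (q, p) (0, - \<xi> X p)"
    by (simp add: linear_diff[OF linear_T\<kappa>, symmetric])
  ultimately show ?thesis by simp
qed

lemma T\<kappa>_fibre:
  "T\<kappa> (q, p) (0, tmap (gatlas H) (total P) (ract P p) \<one>\<^bsub>H\<^esub> Z)
    = tmap (gatlas H) (total E) (ract E (\<kappa> (q, p))) \<one>\<^bsub>H\<^esub> Z"
proof -
  have 1: "has_tmap (gatlas H) (total E) (\<lambda>h. \<kappa> (q, ract P p h)) \<one>\<^bsub>H\<^esub>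
      (\<lambda>v. T\<kappa> (q, p) (0, tmap (gatlas H) (total P) (ract P p) \<one>\<^bsub>H\<^esub> v))"
    using has_tmap_compose[OF H.mfdG mfdN has_tmap_Pair[OF has_tmap_const H.has_tmap_right_orbit[OF mfdY right_P]]
        has_tmap_\<kappa>, of q p] right_P
    by (simp add: right_action_def)
  have "\<kappa> (q, ract P p h) = ract E (\<kappa> (q, p)) h" for h
    using assoc unfolding associated_bundle_def by metis
  with tmap_eq[OF 1] show ?thesis by simp
qed

text \<open>Three kinds of vectors determine the form: \<Theta>Q vanishes on images of ker \<phi>
  \<oplus> ker \<Theta>, vectors tangent to the fibres of \<kappa> are killed by
  \<open>T\<kappa>\<close>, and \<Theta>Q reproduces the generator of a vector tangent to an
  H-orbit.\<close>

lemma pullback_\<Theta>Q: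
  "pullback1 N (total E) \<kappa> \<Theta>Q (q, p) (u, v) = \<Theta> p v - \<Theta> p (\<xi> (\<phi> q u) p)"
proof -
  let ?X = "\<phi> q u"
  let ?vq = "tmap A (total Q) (ract Q q) \<e> ?X"
  let ?v = "v - \<xi> ?X p"
  let ?vp = "tmap (gatlas H) (total P) (ract P p) \<one>\<^bsub>H\<^esub> (\<Theta> p ?v)"
  have lin\<phi>: "linear (\<phi> q)" and linQ: "linear (\<Theta>Q (\<kappa> (q, p)))"
    using form_\<phi> form_\<Theta>Q unfolding smooth_form1_def by blast+
  have "\<phi> q (u - ?vq) = 0"
    using BG unfolding BG_object_def connection_def by (simp add: linear_diff[OF lin\<phi>])
  moreover have "\<Theta> p (?v - ?vp) = 0"
    using conn unfolding connection_def by (simp add: linear_diff[OF linear_form])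
  ultimately have hor: "\<Theta>Q (\<kappa> (q, p)) (T\<kappa> (q, p) (u - ?vq, ?v - ?vp)) = 0"
    using induced unfolding induced_connection_def by blast
  \<comment> \<open>The splitting into these three kinds: the second summand removes the
    \<phi>-component of \<open>u\<close>, and the third then removes the \<Theta>-component of
    \<open>v - \<xi> (\<phi> q u) p\<close>.\<close>
  have "(u, v) = (u - ?vq, ?v - ?vp) + (?vq, \<xi> ?X p) + (0, ?vp)"
    by simp
  then have "T\<kappa> (q, p) (u, v) = T\<kappa> (q, p) (u - ?vq, ?v - ?vp) + T\<kappa> (q, p) (?vq, \<xi> ?X p) + T\<kappa> (q, p) (0, ?vp)"
    by (metis linear_add[OF linear_T\<kappa>])
  also have "\<dots> = T\<kappa> (q, p) (u - ?vq, ?v - ?vp) + tmap (gatlas H) (total E) (ract E (\<kappa> (q, p))) \<one>\<^bsub>H\<^esub> (\<Theta> p ?v)"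
    unfolding T\<kappa>_vertical T\<kappa>_fibre by simp
  finally have "\<Theta>Q (\<kappa> (q, p)) (T\<kappa> (q, p) (u, v)) = \<Theta> p ?v"
    using hor induced unfolding induced_connection_def connection_def
    by (simp add: linear_add[OF linQ])
  then show ?thesis
    by (simp add: pullback1_def linear_diff[OF linear_form])
qed

lemma local_pullback_\<Theta>Q:
  assumes s: "s \<in> cimg (total Q) q" and t: "t \<in> cimg (total P) p"
  shows "local1 N (q, p) (pullback1 N (total E) \<kappa> \<Theta>Q) (s, t) (v, w)
    = \<theta> p t w - moment p t (lform (total Q) q \<phi> s v)"
  by (simp add: local1_def param_prod[OF mfdQ mfdY s t] to_frame_prod[OF mfdQ mfdY s t] pullback_\<Theta>Q
      moment_def lform_apply[OF mfdY \<Theta> t] lform_apply[OF mfdQ form_\<phi> s] action_field_local[OF t])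

text \<open>The product rule for the moment map applied to \<phi>: differentiating the moment map
  along P gives the mixed d\<Theta> terms by \<open>moment_has_derivative\<close>, and
  differentiating \<phi> along Q gives the last term.\<close>

lemma ext_deriv_pullback_\<Theta>Q:
  "ext_deriv N (pullback1 N (total E) \<kappa> \<Theta>Q) (q, p) (v1, w1) (v2, w2) =
    ext_deriv (total P) \<Theta> p w1 w2 - ext_deriv (total P) \<Theta> p w1 (\<xi> (\<phi> q v2) p)
    + ext_deriv (total P) \<Theta> p w2 (\<xi> (\<phi> q v1) p) - \<Theta> p (\<xi> (ext_deriv (total Q) \<phi> q v1 v2) p)"
proof -
  let ?x = "coord (total Q) q q" and ?y = "coord (total P) p p"
  let ?f = "lform (total Q) q \<phi>"
  \<comment> \<open>\<open>B\<close> is the form in the product chart as an operator-valued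
    function, and \<open>B'\<close> is its derivative at the centre by the product rule.\<close>
  define B where "B z = (\<theta> p (snd z) o\<^sub>L snd_blinfun) - ((moment p (snd z) o\<^sub>L ?f (fst z)) o\<^sub>L fst_blinfun)" for z
  define B' where "B' z = (Bderiv (\<theta> p) ?y (snd z) o\<^sub>L snd_blinfun) -
    (((moment p ?y o\<^sub>L Bderiv ?f ?x (fst z)) + (Bderiv (moment p) ?y (snd z) o\<^sub>L ?f ?x)) o\<^sub>L fst_blinfun)" for z
  have x: "?x \<in> cimg (total Q) q" and y: "?y \<in> cimg (total P) p"
    by (rule center_in_cimg[OF mfdQ], rule center_in_cimg[OF mfdY])
  have dfst: "(fst has_derivative fst) (at (?x, ?y))" and dsnd: "(snd has_derivative snd) (at (?x, ?y))"
    by (intro bounded_linear_imp_has_derivative bounded_linear_fst bounded_linear_snd)+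
  have D\<theta>: "((\<lambda>z. \<theta> p (snd z)) has_derivative (\<lambda>z. Bderiv (\<theta> p) ?y (snd z))) (at (?x, ?y))"
    using has_derivative_compose[OF dsnd, of "\<theta> p"] lform_has_derivative[OF mfdY \<Theta> y] by simp
  have Dmom: "((\<lambda>z. moment p (snd z)) has_derivative (\<lambda>z. Bderiv (moment p) ?y (snd z))) (at (?x, ?y))"
    using has_derivative_compose[OF dsnd, of "moment p"] moment_has_derivative(1)[OF y] by simp
  have Df: "((\<lambda>z. ?f (fst z)) has_derivative (\<lambda>z. Bderiv ?f ?x (fst z))) (at (?x, ?y))"
    using has_derivative_compose[OF dfst, of ?f] lform_has_derivative[OF mfdQ form_\<phi> x] by simp
  have comp: "((\<lambda>z. moment p (snd z) o\<^sub>L ?f (fst z)) has_derivative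
      (\<lambda>z. (moment p ?y o\<^sub>L Bderiv ?f ?x (fst z)) + (Bderiv (moment p) ?y (snd z) o\<^sub>L ?f ?x))) (at (?x, ?y))"
    using bounded_bilinear.FDERIV[OF bounded_bilinear_blinfun_compose Dmom Df] by simp
  have "(B has_derivative B') (at (?x, ?y))"
    unfolding B_def[abs_def] B'_def[abs_def]
    by (intro has_derivative_diff bounded_linear.has_derivative[OF bounded_linear_blinfun_compose_right] D\<theta> comp)
  then have B: "(B has_derivative B') (at (coord N (q, p) (q, p)))"
    by (simp add: coord_prod)
  have "ext_deriv N (pullback1 N (total E) \<kappa> \<Theta>Q) (q, p) (v1, w1) (v2, w2)
      = B' (v1, w1) (v2, w2) - B' (v2, w2) (v1, w1)"
  proof (rule ext_deriv_eqI[OF mfdN open_UNIV _ _ B])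
    fix u w assume "u \<in> cimg N (q, p)"
    then show "local1 N (q, p) (pullback1 N (total E) \<kappa> \<Theta>Q) u w = blinfun_apply (B u) w"
      by (cases u; cases w) (simp add: cimg_prod local_pullback_\<Theta>Q B_def blinfun.diff_left)
  qed auto
  also have "\<dots> = chart_ext_deriv (\<theta> p) ?y w1 w2 - chart_ext_deriv (\<theta> p) ?y w1 (chart_field p ?y (\<phi> q v2))
      + chart_ext_deriv (\<theta> p) ?y w2 (chart_field p ?y (\<phi> q v1)) - moment p ?y (chart_ext_deriv ?f ?x v1 v2)"
    by (simp add: B'_def blinfun.diff_left blinfun.add_left blinfun.diff_right moment_has_derivative(2)[OF y]
        chart_ext_deriv_def[of ?f] lform_center[OF mfdQ form_\<phi>]) (simp add: chart_ext_deriv_def)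
  also have "\<dots> = ext_deriv (total P) \<Theta> p w1 w2 - ext_deriv (total P) \<Theta> p w1 (\<xi> (\<phi> q v2) p)
    + ext_deriv (total P) \<Theta> p w2 (\<xi> (\<phi> q v1) p) - \<Theta> p (\<xi> (ext_deriv (total Q) \<phi> q v1 v2) p)"
    using action_field_local[OF y]
    by (simp add: ext_deriv_center[OF mfdY \<Theta>] ext_deriv_center[OF mfdQ form_\<phi>] moment_def
        param_center[OF mfdY] to_frame_center[OF mfdY] lform_center[OF mfdY \<Theta>])
  finally show ?thesis .
qed

section \<open>Comparison with the Weil form, and descent\<close>

lemma ext_deriv_fields: "ext_deriv (total P) \<Theta> p (\<xi> X p) (\<xi> X' p) = \<Theta> p (\<xi> (bracket G X X') p)"
  using chart_ext_deriv_fields[OF center_in_cimg[OF mfdY]] action_field_local[OF center_in_cimg[OF mfdY, of p]]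
  by (simp add: ext_deriv_center[OF mfdY \<Theta>] param_center[OF mfdY] to_frame_center[OF mfdY] lform_center[OF mfdY \<Theta>])

lemma ext_deriv_alternating: "ext_deriv M \<alpha> p v w = - ext_deriv M \<alpha> p w v"
  by (simp add: ext_deriv_def)

lemma curvature_fst:
  "curvature G N (pullback1 N (total Q) fst \<phi>) z x y = curvature G (total Q) \<phi> (fst z) (fst x) (fst y)"
  using curvature_pullback[OF mfdN mfdQ smooth_map_fst[OF mfdQ mfdY] form_\<phi>, of z x y]
  by (simp add: tmap_eq[OF has_tmap_fst[OF mfdQ mfdY]])

text \<open>Naturality moves the curvature of \<Theta>Q to \<open>Q \<times> P\<close>, where both
  sides are explicit. Expanding \<Omega>(w1 - \<xi> X1, w2 - \<xi> X2) produces d\<Theta>(\<xi> X1,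
  \<xi> X2), which by \<open>ext_deriv_fields\<close> cancels \<Theta>(\<xi> [X1, X2]) coming from
  the curvature of \<phi>; the Lie brackets in the structure algebra of H agree by
  bilinearity.\<close>

lemma weil_value_curvature:
  "weil_value G N (total P) (pullback1 N (total Q) fst \<phi>) snd curvature_weil (q, p) (v1, w1) (v2, w2)
    = curvature H (total E) \<Theta>Q (\<kappa> (q, p)) (T\<kappa> (q, p) (v1, w1)) (T\<kappa> (q, p) (v2, w2))"
proof -
  let ?X1 = "\<phi> q v1" and ?X2 = "\<phi> q v2"
  have fst: "pullback1 N (total Q) fst \<phi> (q, p) (v, w) = \<phi> q v" for v w
    by (simp add: pullback1_def tmap_eq[OF has_tmap_fst[OF mfdQ mfdY]])
  have F: "curvature G N (pullback1 N (total Q) fst \<phi>) (q, p) (v1, w1) (v2, w2)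
      = ext_deriv (total Q) \<phi> q v1 v2 + bracket G ?X1 ?X2"
    by (simp only: curvature_fst fst_conv) (simp only: curvature_eq)
  have lin: "linear (\<lambda>X. \<Theta> p (\<xi> X p))"
    using linear_compose[OF linear_action_field[of p] linear_form[of p]] by (simp add: o_def)
  have "curvature H (total E) \<Theta>Q (\<kappa> (q, p)) (T\<kappa> (q, p) (v1, w1)) (T\<kappa> (q, p) (v2, w2))
      = curvature H N (pullback1 N (total E) \<kappa> \<Theta>Q) (q, p) (v1, w1) (v2, w2)"
    by (rule H.curvature_pullback[OF mfdN mfdE smooth_\<kappa> form_\<Theta>Q, symmetric])
  also have "\<dots> = ext_deriv (total P) \<Theta> p w1 w2 - ext_deriv (total P) \<Theta> p w1 (\<xi> ?X2 p)
      + ext_deriv (total P) \<Theta> p w2 (\<xi> ?X1 p) - \<Theta> p (\<xi> (ext_deriv (total Q) \<phi> q v1 v2) p)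
      + bracket H (\<Theta> p w1 - \<Theta> p (\<xi> ?X1 p)) (\<Theta> p w2 - \<Theta> p (\<xi> ?X2 p))"
    by (simp add: H.curvature_eq ext_deriv_pullback_\<Theta>Q pullback_\<Theta>Q)
  also have "\<dots> = weil_value G N (total P) (pullback1 N (total Q) fst \<phi>) snd curvature_weil (q, p) (v1, w1) (v2, w2)"
    unfolding weil_value_def fst F
    by (simp add: curvature_weil_def pullback1_def pullback2_def tmap_eq[OF has_tmap_snd[OF mfdQ mfdY]]
        H.curvature_eq linear_add[OF lin] ext_deriv_fields br.diff_left br.diff_right
        ext_deriv_alternating[of _ _ _ "\<xi> _ _" w1] ext_deriv_alternating[of _ _ _ "\<xi> _ _" w2]
        H.bracket_commute[of "\<Theta> p (\<xi> ?X2 p)" "\<Theta> p w1"])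
  finally show ?thesis by simp
qed

text \<open>The tautological case: \<open>Q \<times> P\<close> over \<open>E\<close> carries the
  connection pulled back from Q, and the projection \<open>snd\<close> is its equivariant map to
  P.\<close>

lemma descends_universal:
  "descends_to N (total E) \<kappa> (weil_value G N (total P) (pullback1 N (total Q) fst \<phi>) snd curvature_weil)
    (curvature H (total E) \<Theta>Q)"
  unfolding descends_to_def pullback2_def fun_eq_iff
  using weil_value_curvature by (metis surj_pair)

text \<open>The relation \<open>s \<circ> proj Q = \<kappa> \<circ> (id, f)\<close> reduces this to
  the tautological case: pulling that form back along \<open>q \<mapsto> (q, f q)\<close> turns
  \<open>fst\<close> into the identity and \<open>snd\<close> into \<open>f\<close>.\<close>

lemma descends_section:
  assumes f: "equivariant_map G Q (total P) lP f" and s: "section_of_map Q (total E) \<kappa> f s"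
  shows "descends_to (total Q) (base Q) (proj Q) (weil_value G (total Q) (total P) \<phi> f curvature_weil)
    (pullback2 (base Q) (total E) s (curvature H (total E) \<Theta>Q))"
proof -
  let ?Tf = "tmap (total Q) (total P) f"
  have sf: "smooth_map (total Q) (total P) f"
    using f by (simp add: equivariant_map_def)
  have ss: "smooth_map (base Q) (total E) s" and eq: "s (proj Q q) = \<kappa> (q, f q)" for q
    using s by (auto simp: section_of_map_def)
  have T: "tmap (base Q) (total E) s (proj Q q) (tmap (total Q) (base Q) (proj Q) q v) = T\<kappa> (q, f q) (v, ?Tf q v)"
    for q v
  proof -
    have 1: "has_tmap (total Q) (total E) (\<lambda>q. s (proj Q q)) q
        (\<lambda>v. tmap (base Q) (total E) s (proj Q q) (tmap (total Q) (base Q) (proj Q) q v))"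
      by (rule has_tmap_compose[OF mfdQ mfdM smooth_map_has_tmap[OF mfdQ mfdM smooth_proj]
            smooth_map_has_tmap[OF mfdM mfdE ss]])
    have 2: "has_tmap (total Q) (total E) (\<lambda>q. \<kappa> (q, f q)) q (\<lambda>v. T\<kappa> (q, f q) (v, ?Tf q v))"
      by (rule has_tmap_compose[OF mfdQ mfdN has_tmap_Pair[OF has_tmap_ident[OF mfdQ]
            smooth_map_has_tmap[OF mfdQ mfdY sf]] has_tmap_\<kappa>])
    show ?thesis
      using tmap_eq[OF 1] tmap_eq[OF 2] unfolding eq by (rule trans[OF sym, THEN fun_cong])
  qed
  have "weil_value G (total Q) (total P) \<phi> f curvature_weil q u v
      = weil_value G N (total P) (pullback1 N (total Q) fst \<phi>) snd curvature_weil (q, f q) (u, ?Tf q u) (v, ?Tf q v)"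
    for q u v
    unfolding weil_value_def curvature_fst
    by (simp add: pullback1_def pullback2_def tmap_eq[OF has_tmap_fst[OF mfdQ mfdY]]
        tmap_eq[OF has_tmap_snd[OF mfdQ mfdY]])
  then show ?thesis
    by (simp add: descends_to_def pullback2_def fun_eq_iff weil_value_curvature T eq)
qed

end

theorem theorem8:
  fixes G :: "('g::{t2_space,second_countable_topology}, 'vg::banach) lie_group"
    and H :: "('h::t2_space, 'vh::banach) lie_group"
    and P :: "('p::t2_space, 'vp::banach, 'x::t2_space, 'vx::banach, 'h) pbundle"
    and \<Theta> :: "('p, 'vp, 'vh) form1"
    and lP :: "'g \<Rightarrow> 'p \<Rightarrow> 'p" and lX :: "'g \<Rightarrow> 'x \<Rightarrow> 'x"
    and e :: "'vg set"
  assumes "is_lie_group G" and "is_basis e" and "is_lie_group H"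
    and "principal_bundle H P" and "connection H P \<Theta>"
    and "bundle_action G P lP lX" and "preserves_form1 (total P) lP \<Theta>"
  shows "\<exists>w. weil_basic G (total P) lP w \<and>
    weil_to_cartan w =
      (curvature H (total P) \<Theta>,
       \<lambda>A p. - (\<Sum>a\<in>e. dual_basis e a A *\<^sub>R contraction (action_field G (total P) lP a) \<Theta> p)) \<and>
    (\<forall>w'. weil_basic G (total P) lP w' \<and> weil_to_cartan w' = weil_to_cartan w \<longrightarrow> w' = w) \<and>
    (\<forall>(Q :: ('q::{t2_space,second_countable_topology}, 'vq::banach,
             'm::{t2_space,second_countable_topology}, 'vm::banach, 'g) pbundle) \<phi>
        (E :: ('e::t2_space, 've::banach, 'b::t2_space, 'vb::banach, 'h) pbundle) \<kappa>P \<kappa>X \<Theta>Q.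
      BG_object G Q \<phi> \<and> associated_bundle G H P lP lX Q E \<kappa>P \<kappa>X \<and>
      induced_connection H P \<Theta> Q \<phi> E \<kappa>P \<Theta>Q \<longrightarrow>
        descends_to (total Q \<times>\<^sub>m total P) (total E) \<kappa>P
          (weil_value G (total Q \<times>\<^sub>m total P) (total P)
             (pullback1 (total Q \<times>\<^sub>m total P) (total Q) fst \<phi>) snd w)
          (curvature H (total E) \<Theta>Q) \<and>
        (\<forall>f s. equivariant_map G Q (total P) lP f \<and> section_of_map Q (total E) \<kappa>P f s \<longrightarrow>
           descends_to (total Q) (base Q) (proj Q)
             (weil_value G (total Q) (total P) \<phi> f w)
             (pullback2 (base Q) (total E) s (curvature H (total E) \<Theta>Q))))"
proof -
  interpret invariant_connection G "total P" lP \<Theta> H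
    using assms
    by unfold_locales (auto simp: principal_bundle_def bundle_action_def connection_def)
  show ?thesis
  \<comment> \<open>The witness is built from P, \<Theta> and the action before any test bundle is
    introduced, so the same element serves all of them.\<close>
  proof (rule exI[of _ curvature_weil], intro conjI allI impI)
    show "weil_basic G (total P) lP curvature_weil"
      by (rule weil_basic_curvature)
    show "weil_to_cartan curvature_weil = (curvature H (total P) \<Theta>,
       \<lambda>A p. - (\<Sum>a\<in>e. dual_basis e a A *\<^sub>R contraction (action_field G (total P) lP a) \<Theta> p))"
      by (rule weil_to_cartan_curvature[OF assms(2)])
    show "w' = curvature_weil"
      if "weil_basic G (total P) lP w' \<and> weil_to_cartan w' = weil_to_cartan curvature_weil" for w'
      using that weil_basic_curvature weil_horizontal_unique unfolding weil_basic_def by blast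
  next
    fix Q :: "('q, 'vq, 'm, 'vm, 'g) pbundle" and \<phi>
      and E :: "('e, 've, 'b, 'vb, 'h) pbundle" and \<kappa>P \<kappa>X \<Theta>Q
    assume *: "BG_object G Q \<phi> \<and> associated_bundle G H P lP lX Q E \<kappa>P \<kappa>X \<and>
      induced_connection H P \<Theta> Q \<phi> E \<kappa>P \<Theta>Q"
    interpret associated_connection G H P \<Theta> lP lX Q \<phi> E \<kappa>P \<kappa>X \<Theta>Q
      using * assms by unfold_locales auto
    show "descends_to (total Q \<times>\<^sub>m total P) (total E) \<kappa>P
          (weil_value G (total Q \<times>\<^sub>m total P) (total P)
             (pullback1 (total Q \<times>\<^sub>m total P) (total Q) fst \<phi>) snd curvature_weil)
          (curvature H (total E) \<Theta>Q)"
      by (rule descends_universal)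
    show "descends_to (total Q) (base Q) (proj Q)
             (weil_value G (total Q) (total P) \<phi> f curvature_weil)
             (pullback2 (base Q) (total E) s (curvature H (total E) \<Theta>Q))"
      if "equivariant_map G Q (total P) lP f \<and> section_of_map Q (total E) \<kappa>P f s" for f s
      using that descends_section by blast
  qed
qed

end
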